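(* Let $\Omega$ be a domain in a Carnot group $\mathbb{G}$, $(Y,d)$ a metric space, $\varphi:\Omega\to Y$ a mapping, $V\subset Y$ an open subset, and $A\ge0$ a number. Let $1\le q<\infty$ and suppose that every $1$-Lipschitz function $u:Y\to\mathbb R$ with $\mathrm{dist}(\operatorname{spt}u,Y\setminus V)>0$ satisfies $u\circ\varphi\in L^1_q(\Omega)$ and $$\int_{\varphi^{-1}(V)}|\nabla_h(u\circ\varphi)(x)|^q\,dx\le A. \qquad ( * )$$ Then inequality $( * )$ holds for every $1$-Lipschitz function $u:Y\to\mathbb R$ with $u\circ\varphi\in L^1_q(\Omega)$.
   Context: Carnot group: a connected simply-connected Lie group $\mathbb{G}$ whose Lie algebra $\mathfrak g$ of left-invariant vector fields decomposes as $\mathfrak g=\mathfrak g_1\oplus\dots\oplus\mathfrak g_m$ with $[\mathfrak g_1,\mathfrak g_i]=\mathfrak g_{i+1}$ for $1\le i\le m-1$ and $[\mathfrak g_1,\mathfrak g_m]=\{0\}$. An inner product on $\mathfrak g$ is fixed, and $X_1,\dots,X_n$ is an orthonormal basis of the horizontal space $\mathfrak g_1$. Via the exponential map $\mathbb G$ is identified with $\mathbb R^N$, $N=\dim\mathfrak g$; $dx$ is (suitably normalized) Lebesgue measure, a bi-invariant Haar measure. A domain is a nonempty connected open set. $L^1_q(\Omega)$: the functions $u\in L_{1,\mathrm{loc}}(\Omega)$ having generalized (weak) derivatives $X_ju\in L_q(\Omega)$, $j=1,\dots,n$, meaning $\int_\Omega (X_ju)v\,dx=-\int_\Omega uX_jv\,dx$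 for all $v\in C_0^\infty(\Omega)$. Put $\nabla_hu=(X_1u,\dots,X_nu)$, with Euclidean norm $|\nabla_hu|$. $\operatorname{spt}u=\overline{\{y\in Y\mid u(y)\ne0\}}$; the distance between two sets is $+\infty$ if one of them is empty. Under the hypotheses the set $\varphi^{-1}(V)$ is Lebesgue measurable, so the integrals make sense. *)

theory Defs
  imports "HOL-Analysis.Analysis"
begin

text \<open>Continuous differentiability, by iterated directional derivatives.\<close>

primrec Ck :: "nat \<Rightarrow> ('a::euclidean_space \<Rightarrow> 'b::euclidean_space) \<Rightarrow> bool" where
  "Ck 0 f \<longleftrightarrow> continuous_on UNIV f"
| "Ck (Suc k) f \<longleftrightarrow>
     (\<forall>x. f differentiable (at x)) \<and> (\<forall>v. Ck k (\<lambda>x. frechet_derivative f (at x) v))"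

definition smooth :: "('a::euclidean_space \<Rightarrow> 'b::euclidean_space) \<Rightarrow> bool" where
  "smooth f \<longleftrightarrow> (\<forall>k. Ck k f)"

text \<open>
  A vector field on \<open>\<real>\<^sup>N\<close> is a map from points to tangent vectors; it acts on functions
  by \<open>(Z f)(x) = Df(x) (Z x)\<close>, and \<open>vf_bracket Z W\<close> is the field whose action is
  \<open>Z W - W Z\<close>.
\<close>

definition vf_apply ::
    "('a::euclidean_space \<Rightarrow> 'a) \<Rightarrow> ('a \<Rightarrow> 'b::euclidean_space) \<Rightarrow> 'a \<Rightarrow> 'b" where
  "vf_apply Z f x = frechet_derivative f (at x) (Z x)"

definition vf_bracket ::
    "('a::euclidean_space \<Rightarrow> 'a) \<Rightarrow> ('a \<Rightarrow> 'a) \<Rightarrow> 'a \<Rightarrow> 'a" where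
  "vf_bracket Z W x = vf_apply Z W x - vf_apply W Z x"

text \<open>
  For a group law \<open>mul\<close> on \<open>\<real>\<^sup>N\<close> with identity \<open>0\<close>, a left-invariant vector field is
  determined by its value at \<open>0\<close>.  So the Lie algebra of left-invariant vector fields is
  carried by the tangent space at \<open>0\<close>, which is the whole type: \<open>v\<close> stands for the field
  \<open>left_inv_vf mul v\<close>.
\<close>

definition left_inv_vf ::
    "('a::euclidean_space \<Rightarrow> 'a \<Rightarrow> 'a) \<Rightarrow> 'a \<Rightarrow> 'a \<Rightarrow> 'a" where
  "left_inv_vf mul v x = frechet_derivative (mul x) (at 0) v"

definition lie_bracket ::
    "('a::euclidean_space \<Rightarrow> 'a \<Rightarrow> 'a) \<Rightarrow> 'a \<Rightarrow> 'a \<Rightarrow> 'a" where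
  "lie_bracket mul v w = vf_bracket (left_inv_vf mul v) (left_inv_vf mul w) 0"

definition lie_bracket_span ::
    "('a::euclidean_space \<Rightarrow> 'a \<Rightarrow> 'a) \<Rightarrow> 'a set \<Rightarrow> 'a set \<Rightarrow> 'a set" where
  "lie_bracket_span mul S T = span {lie_bracket mul v w | v w. v \<in> S \<and> w \<in> T}"

text \<open>
  A Carnot group in exponential coordinates: the underlying manifold is \<open>\<real>\<^sup>N\<close>, and the
  exponential map is the identity, i.e. \<open>t \<mapsto> t *\<^sub>R v\<close> is the one-parameter subgroup
  generated by \<open>v\<close>.  The Lie algebra has the strata \<open>g 1, \<dots>, g m\<close> and the inner
  product \<open>ip\<close> (unrelated to the one of the type), and \<open>e 1, \<dots>, e n\<close> is an \<open>ip\<close>-orthonormal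
  basis of \<open>g 1\<close>.  The horizontal fields \<open>X\<^sub>j\<close> are \<open>left_inv_vf mul (e j)\<close>.
\<close>

locale carnot_group = Groups.group mul 0 ginv
  for mul :: "'a::euclidean_space \<Rightarrow> 'a \<Rightarrow> 'a" and ginv :: "'a \<Rightarrow> 'a" +
  fixes m :: nat and g :: "nat \<Rightarrow> 'a set"
    and ip :: "'a \<Rightarrow> 'a \<Rightarrow> real"
    and n :: nat and e :: "nat \<Rightarrow> 'a"
  assumes smooth_mul: "smooth (\<lambda>(x, y). mul x y)"
    and smooth_inv: "smooth ginv"
    and exp_coords: "mul (s *\<^sub>R v) (t *\<^sub>R v) = (s + t) *\<^sub>R v"
    and step_pos: "1 \<le> m"
    and subspace_strata: "i \<in> {1..m} \<Longrightarrow> subspace (g i)"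
    and direct_sum: "\<exists>!f. f \<in> (\<Pi>\<^sub>E i\<in>{1..m}. g i) \<and> v = (\<Sum>i=1..m. f i)"
    and bracket_strata: "i \<in> {1..<m} \<Longrightarrow> lie_bracket_span mul (g 1) (g i) = g (i + 1)"
    and bracket_top: "lie_bracket_span mul (g 1) (g m) = {0}"
    and ip_bilinear: "bilinear ip"
    and ip_sym: "ip v w = ip w v"
    and ip_pos: "v \<noteq> 0 \<Longrightarrow> 0 < ip v v"
    and horizontal_orthonormal:
      "i \<in> {1..n} \<Longrightarrow> j \<in> {1..n} \<Longrightarrow> ip (e i) (e j) = (if i = j then 1 else 0)"
    and horizontal_span: "span (e ` {1..n}) = g 1"

definition spt :: "('y::topological_space \<Rightarrow> real) \<Rightarrow> 'y set" where
  "spt u = closure {y. u y \<noteq> 0}"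

text \<open>Unlike \<^const>\<open>setdist\<close>, this distance is \<open>\<infinity>\<close> if one of the sets is empty.\<close>

definition edist_sets :: "'y::metric_space set \<Rightarrow> 'y set \<Rightarrow> ereal" where
  "edist_sets S T = (INF (x, y) \<in> S \<times> T. ereal (dist x y))"

text \<open>
  Functions on an open set \<open>\<Omega>\<close> are represented by total functions whose values outside
  \<open>\<Omega>\<close> play no role.  The measure \<open>M\<close> is a positive multiple of Lebesgue measure.
\<close>

definition test_fun :: "'a::euclidean_space set \<Rightarrow> ('a \<Rightarrow> real) \<Rightarrow> bool" where
  "test_fun \<Omega> v \<longleftrightarrow> smooth v \<and> compact (spt v) \<and> spt v \<subseteq> \<Omega>"

definition L1_loc :: "'a::euclidean_space measure \<Rightarrow> 'a set \<Rightarrow> ('a \<Rightarrow> real) set" where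
  "L1_loc M \<Omega> = {u. \<forall>K. compact K \<longrightarrow> K \<subseteq> \<Omega> \<longrightarrow> set_integrable M K u}"

definition Lq :: "'a::euclidean_space measure \<Rightarrow> real \<Rightarrow> 'a set \<Rightarrow> ('a \<Rightarrow> real) set" where
  "Lq M q \<Omega> = {u. set_borel_measurable M \<Omega> u \<and> set_integrable M \<Omega> (\<lambda>x. \<bar>u x\<bar> powr q)}"

definition is_weak_deriv ::
    "'a::euclidean_space measure \<Rightarrow> 'a set \<Rightarrow> ('a \<Rightarrow> 'a) \<Rightarrow> ('a \<Rightarrow> real) \<Rightarrow> ('a \<Rightarrow> real) \<Rightarrow> bool"
where
  "is_weak_deriv M \<Omega> Z u w \<longleftrightarrow> w \<in> L1_loc M \<Omega> \<and>
     (\<forall>v. test_fun \<Omega> v \<longrightarrow> (LINT x:\<Omega>|M. w x * v x) = - (LINT x:\<Omega>|M. u x * vf_apply Z v x))"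

text \<open>A chosen representative; on \<open>\<Omega>\<close>, weak derivatives are unique up to null sets.\<close>

definition weak_deriv ::
    "'a::euclidean_space measure \<Rightarrow> 'a set \<Rightarrow> ('a \<Rightarrow> 'a) \<Rightarrow> ('a \<Rightarrow> real) \<Rightarrow> 'a \<Rightarrow> real" where
  "weak_deriv M \<Omega> Z u = (SOME w. is_weak_deriv M \<Omega> Z u w)"

definition L1q ::
    "'a::euclidean_space measure \<Rightarrow> ('a \<Rightarrow> 'a \<Rightarrow> 'a) \<Rightarrow> nat \<Rightarrow> (nat \<Rightarrow> 'a) \<Rightarrow> real \<Rightarrow> 'a set
      \<Rightarrow> ('a \<Rightarrow> real) set" where
  "L1q M mul n e q \<Omega> = {u \<in> L1_loc M \<Omega>.
     \<forall>j\<in>{1..n}. \<exists>w \<in> Lq M q \<Omega>. is_weak_deriv M \<Omega> (left_inv_vf mul (e j)) u w}"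

definition hgrad ::
    "'a::euclidean_space measure \<Rightarrow> ('a \<Rightarrow> 'a \<Rightarrow> 'a) \<Rightarrow> (nat \<Rightarrow> 'a) \<Rightarrow> 'a set
      \<Rightarrow> ('a \<Rightarrow> real) \<Rightarrow> 'a \<Rightarrow> nat \<Rightarrow> real" where
  "hgrad M mul e \<Omega> u x j = weak_deriv M \<Omega> (left_inv_vf mul (e j)) u x"

definition hgrad_norm ::
    "'a::euclidean_space measure \<Rightarrow> ('a \<Rightarrow> 'a \<Rightarrow> 'a) \<Rightarrow> nat \<Rightarrow> (nat \<Rightarrow> 'a) \<Rightarrow> 'a set
      \<Rightarrow> ('a \<Rightarrow> real) \<Rightarrow> 'a \<Rightarrow> real" where
  "hgrad_norm M mul n e \<Omega> u x = L2_set (hgrad M mul e \<Omega> u x) {1..n}"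

end

theory Submission
  imports Defs
begin

text \<open>
  Write \<open>f = u \<circ> \<phi>\<close>, let \<open>N\<close> be the complement of \<open>V\<close>, and suppose \<open>N\<close> is nonempty (otherwise \<open>u\<close> itself
  is one of the functions that the hypothesis covers).  For \<open>h > 0\<close> fold the values of \<open>u\<close> into
  \<open>[0, h]\<close> by the triangle wave of slope \<open>\<plusminus>1\<close> and period \<open>2 h\<close>, and cut the result off by the
  1-Lipschitz function \<open>max (dist(\<cdot>, N) - h) 0\<close>, taking the minimum of the two.  The resulting
  \<open>\<omega>\<close> is 1-Lipschitz and its support has distance at least \<open>h\<close> from \<open>N\<close>, so the hypothesis bounds
  the energy of \<open>\<omega> \<circ> \<phi>\<close> by \<open>A\<close>.  Where \<open>dist(\<cdot>, N) > 2 h\<close> the minimum is the triangle wave, which is at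
  every point \<open>\<plusminus>u\<close> plus one of countably many constants.  If weak derivatives only see the function
  on the set where they are evaluated, then \<open>\<omega> \<circ> \<phi>\<close> and \<open>f\<close> have the same \<open>|\<nabla>\<^sub>h|\<close> almost everywhere on
  the part of \<open>\<Omega>\<close> with \<open>dist(\<phi>(x), N) > 2 h\<close>; thus the energy of \<open>f\<close> there is at most \<open>A\<close>, and
  \<open>h \<rightarrow> 0\<close> with monotone convergence gives the claim.

  The analytic core is therefore the locality statement \<open>weak_deriv_eq_AE_on_level_set\<close>: if
  \<open>f = \<sigma> p + \<kappa>\<close> on a set, then \<open>Z f = \<sigma> Z p\<close> almost everywhere on it.  By linearity this is a
  statement about zero sets, provided that constants have weak derivative \<open>0\<close>, that is,
  that left-invariant fields have divergence \<open>0\<close> for Lebesgue measure.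

  Divergence (\<open>divergence_Z_eq_0\<close>).  Let \<open>filtr k\<close> be the sum of the strata of degree at least \<open>k\<close>.
  Left invariance gives \<open>[Z v, Z w] = Z [v, w]\<close> everywhere and, after one more differentiation, the
  Jacobi identity, hence \<open>[x, filtr k] \<subseteq> filtr (k + 1)\<close> for all \<open>x\<close>.  Since \<open>t \<mapsto> t x\<close> is a one-parameter
  subgroup, the inverse of the left-invariant frame satisfies a linear differential equation along
  rays, which shows that the frame is the identity on \<open>filtr k\<close> modulo \<open>filtr (k + 1)\<close>.  The bracket relation then
  says that the differential of \<open>Z v\<close> at any point maps \<open>filtr k\<close> into \<open>filtr (k + 1)\<close>; it is nilpotent and
  its trace, the divergence, vanishes.

  Zero sets (\<open>integral_weak_deriv_zero_set\<close>).  Divergence \<open>0\<close> makes the flow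
  \<open>R\<^sub>t x = x \<cdot> exp(t v)\<close> of \<open>Z v\<close> measure preserving.  For a test function \<open>\<psi>\<close>, the weak derivative \<open>w\<close> of
  \<open>f\<close> satisfies \<open>d/dt \<integral> f (\<psi> \<circ> R\<^sub>-\<^sub>t) = \<integral> w (\<psi> \<circ> R\<^sub>-\<^sub>t)\<close>.  If \<open>f\<close> vanishes on the compact set \<open>B\<close>, take for \<open>\<psi>\<close>
  an approximation of the indicator function of \<open>{x \<in> B. R\<^sub>t x \<in> B}\<close>, which fills most of \<open>B\<close> for
  small \<open>t\<close>.  The difference of the left-hand integrals at \<open>t\<close> and \<open>0\<close> is negligible against \<open>t\<close>,
  so by the mean value theorem \<open>\<integral>\<^sub>B w = 0\<close>.  As \<open>B\<close> is an arbitrary compact subset of the zero set, \<open>w\<close>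
  vanishes almost everywhere there.
\<close>

section \<open>Calculus of smooth maps\<close>

abbreviation D :: "('a::euclidean_space \<Rightarrow> 'b::euclidean_space) \<Rightarrow> 'a \<Rightarrow> 'a \<Rightarrow> 'b" where
  "D f x \<equiv> frechet_derivative f (at x)"

lemma D_eqI: "(f has_derivative f') (at x) \<Longrightarrow> D f x = f'"
  by (rule frechet_derivative_at[symmetric])

lemma Ck_imp_continuous: "Ck k f \<Longrightarrow> continuous_on UNIV f"
  by (cases k) (auto simp: continuous_on_eq_continuous_at differentiable_imp_continuous_within)

lemma Ck_Suc_imp_Ck: "Ck (Suc k) f \<Longrightarrow> Ck k f"
proof (induction k arbitrary: f)
  case 0
  then show ?case unfolding Ck.simps(1) by (rule Ck_imp_continuous)
next
  case (Suc k)
  from Suc.prems have "\<And>x. f differentiable (at x)" "\<And>v. Ck (Suc k) (\<lambda>x. D f x v)"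
    by (simp_all only: Ck.simps(2)[of "Suc k"])
  then show ?case using Suc.IH by (subst Ck.simps(2)) blast
qed

lemma Ck_has_derivative: "Ck (Suc k) f \<Longrightarrow> (f has_derivative D f x) (at x)"
  by (simp flip: frechet_derivative_works)

lemma Ck_SucI:
  assumes "\<And>x. (f has_derivative f' x) (at x)" "\<And>v. Ck k (\<lambda>x. f' x v)"
  shows "Ck (Suc k) f"
  using assms by (auto simp: D_eqI[OF assms(1)] intro: differentiableI)

lemma Ck_const: "Ck k (\<lambda>x. c)"
  by (induction k arbitrary: c) auto

lemma Ck_linear: "linear f \<Longrightarrow> Ck k f"
proof (cases k)
  case (Suc j)
  assume "linear f"
  then show ?thesis unfolding Suc
    by (intro Ck_SucI[where f' = "\<lambda>x. f"] linear_imp_has_derivative Ck_const)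
qed (simp add: linear_continuous_on linear_conv_bounded_linear)

lemma Ck_add: "Ck k f \<Longrightarrow> Ck k g \<Longrightarrow> Ck k (\<lambda>x. f x + g x)"
proof (induction k arbitrary: f g)
  case (Suc k)
  show ?case
    by (rule Ck_SucI, rule has_derivative_add[OF Suc.prems[THEN Ck_has_derivative]])
       (use Suc in auto)
qed (auto intro: continuous_intros)

lemma Ck_sum: "(\<And>i. i \<in> I \<Longrightarrow> Ck k (f i)) \<Longrightarrow> Ck k (\<lambda>x. \<Sum>i\<in>I. f i x)"
  by (induction I rule: infinite_finite_induct) (auto intro: Ck_add Ck_const)

lemma Ck_bilinear:
  fixes f :: "'a::euclidean_space \<Rightarrow> 'b::euclidean_space" and g :: "'a \<Rightarrow> 'c::euclidean_space"
    and h :: "'b \<Rightarrow> 'c \<Rightarrow> 'd::euclidean_space"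
  assumes h: "bounded_bilinear h"
  shows "Ck k f \<Longrightarrow> Ck k g \<Longrightarrow> Ck k (\<lambda>x. h (f x) (g x))"
proof (induction k arbitrary: f g)
  case 0
  then show ?case by (auto intro: bounded_bilinear.continuous_on[OF h])
next
  case (Suc k)
  show ?case
    by (rule Ck_SucI, rule bounded_bilinear.FDERIV[OF h Suc.prems[THEN Ck_has_derivative]])
       (intro Ck_add Suc.IH, use Suc.prems Ck_Suc_imp_Ck[OF Suc.prems(1)] Ck_Suc_imp_Ck[OF Suc.prems(2)] in auto)
qed

lemma linear_D: "Ck (Suc k) f \<Longrightarrow> linear (D f x)"
  by (simp add: linear_frechet_derivative)

text \<open>
  Expanding the direction in the basis separates it from the base point.  This reduces
  differentiability of \<open>x \<mapsto> D f (\<gamma> x) (V x)\<close> with moving direction \<open>V x\<close> to fixed directions, the only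
  ones that occur in the definition of \<^const>\<open>Ck\<close>.
\<close>

lemma D_expand_basis:
  assumes "Ck (Suc k) f"
  shows "D f x v = (\<Sum>b\<in>Basis. (v \<bullet> b) *\<^sub>R D f x b)"
proof -
  have "D f x v = D f x (\<Sum>b\<in>Basis. (v \<bullet> b) *\<^sub>R b)" by (simp add: euclidean_representation)
  also have "\<dots> = (\<Sum>b\<in>Basis. (v \<bullet> b) *\<^sub>R D f x b)"
    by (simp add: linear_sum[OF linear_D[OF assms]] linear_cmul[OF linear_D[OF assms]])
  finally show ?thesis .
qed

lemma Ck_D_along:
  assumes "Ck (Suc k) f" "Ck k \<gamma>" "Ck k V" "\<And>b. Ck k (\<lambda>x. D f (\<gamma> x) b)"
  shows "Ck k (\<lambda>x. D f (\<gamma> x) (V x))"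
  unfolding D_expand_basis[OF assms(1), of _ "V _"]
  by (intro Ck_sum Ck_bilinear[OF bounded_bilinear_scaleR] Ck_bilinear[OF bounded_bilinear_inner]
      Ck_const assms(2-4))

lemma Ck_compose:
  fixes f :: "'b::euclidean_space \<Rightarrow> 'c::euclidean_space" and g :: "'a::euclidean_space \<Rightarrow> 'b"
  shows "Ck k f \<Longrightarrow> Ck k g \<Longrightarrow> Ck k (\<lambda>x. f (g x))"
proof (induction k arbitrary: f g)
  case 0
  then show ?case by (auto intro: continuous_on_compose2)
next
  case (Suc k)
  have g: "Ck k g" by (rule Ck_Suc_imp_Ck) (rule Suc.prems)
  have "Ck k (\<lambda>x. D f (g x) (D g x v))" for v
  proof (rule Ck_D_along[OF Suc.prems(1) g])
    show "Ck k (\<lambda>x. D g x v)" using Suc.prems(2) by simp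
    show "Ck k (\<lambda>x. D f (g x) b)" for b
      by (rule Suc.IH[of "\<lambda>y. D f y b"]) (use Suc.prems(1) g in auto)
  qed
  then show ?case
    by (intro Ck_SucI[OF has_derivative_compose[OF Suc.prems(2,1)[THEN Ck_has_derivative]]])
qed

lemma smooth_imp_Ck: "smooth f \<Longrightarrow> Ck k f"
  by (simp add: smooth_def)

lemma smooth_D: "smooth f \<Longrightarrow> smooth (\<lambda>x. D f x v)"
  unfolding smooth_def by (rule allI, drule_tac x = "Suc k" in spec) simp

lemma smooth_has_derivative: "smooth f \<Longrightarrow> (f has_derivative D f x) (at x)"
  by (rule Ck_has_derivative) (rule smooth_imp_Ck)

lemma smooth_linear_D: "smooth f \<Longrightarrow> linear (D f x)"
  by (rule linear_D) (rule smooth_imp_Ck)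

lemma smooth_continuous: "smooth f \<Longrightarrow> continuous_on S f"
  by (rule continuous_on_subset[OF Ck_imp_continuous[OF smooth_imp_Ck[of f 0]]]) auto

lemma smooth_const: "smooth (\<lambda>x. c)"
  by (simp add: smooth_def Ck_const)

lemma smooth_linear: "linear f \<Longrightarrow> smooth f"
  by (simp add: smooth_def Ck_linear)

lemma smooth_add: "smooth f \<Longrightarrow> smooth g \<Longrightarrow> smooth (\<lambda>x. f x + g x)"
  by (simp add: smooth_def Ck_add)

lemma smooth_sum: "(\<And>i. i \<in> I \<Longrightarrow> smooth (f i)) \<Longrightarrow> smooth (\<lambda>x. \<Sum>i\<in>I. f i x)"
  by (simp add: smooth_def Ck_sum)

lemma smooth_bilinear: "bounded_bilinear h \<Longrightarrow> smooth f \<Longrightarrow> smooth g \<Longrightarrow> smooth (\<lambda>x. h (f x) (g x))"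
  by (simp add: smooth_def Ck_bilinear)

lemmas smooth_scaleR = smooth_bilinear[OF bounded_bilinear_scaleR]
  and smooth_inner = smooth_bilinear[OF bounded_bilinear_inner]

lemma smooth_mult:
  fixes f g :: "'a::euclidean_space \<Rightarrow> real"
  shows "smooth f \<Longrightarrow> smooth g \<Longrightarrow> smooth (\<lambda>x. f x * g x)"
  by (rule smooth_bilinear[OF bounded_bilinear_mult])

lemma smooth_compose: "smooth f \<Longrightarrow> smooth g \<Longrightarrow> smooth (\<lambda>x. f (g x))"
  by (simp add: smooth_def Ck_compose)

lemma smooth_Pair: 
  fixes f :: "'a::euclidean_space \<Rightarrow> 'b::euclidean_space" and g :: "'a \<Rightarrow> 'c::euclidean_space"
  assumes "smooth f" "smooth g" shows "smooth (\<lambda>x. (f x, g x))"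
proof -
  have 1: "smooth (\<lambda>x. (f x, 0) :: 'b \<times> 'c)"
    by (rule smooth_compose[OF smooth_linear assms(1), where f = "\<lambda>y. (y, 0)"]) (simp add: linear_iff)
  have 2: "smooth (\<lambda>x. (0, g x) :: 'b \<times> 'c)"
    by (rule smooth_compose[OF smooth_linear assms(2), where f = "\<lambda>y. (0, y)"]) (simp add: linear_iff)
  show ?thesis using smooth_add[OF 1 2] by simp
qed

lemma smooth_ident: "smooth (\<lambda>x. x)"
  by (rule smooth_linear) (simp add: linear_iff)

lemma smooth_diff:
  assumes "smooth f" "smooth g" shows "smooth (\<lambda>x. f x - g x)"
proof -
  have "smooth (\<lambda>x. f x + (-1) *\<^sub>R g x)"
    by (intro smooth_add smooth_scaleR smooth_const assms)
  then show ?thesis by simp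
qed

lemma smooth_D_along:
  assumes "smooth f" "smooth \<gamma>" "smooth V"
  shows "smooth (\<lambda>x. D f (\<gamma> x) (V x))"
  unfolding D_expand_basis[OF smooth_imp_Ck[OF assms(1)], of _ "V _"]
  by (intro smooth_sum smooth_scaleR smooth_inner smooth_const assms
      smooth_compose[OF smooth_D[OF assms(1)]])

lemma D_compose:
  assumes "smooth f" "smooth g"
  shows "D (\<lambda>x. f (g x)) x v = D f (g x) (D g x v)"
  by (simp add: D_eqI[OF has_derivative_compose[OF assms(2,1)[THEN smooth_has_derivative]]])

section \<open>Second derivatives\<close>

abbreviation DD :: "('a::euclidean_space \<Rightarrow> 'b::euclidean_space) \<Rightarrow> 'a \<Rightarrow> 'a \<Rightarrow> 'a \<Rightarrow> 'b" where
  "DD f x u v \<equiv> D (\<lambda>y. D f y v) x u"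

text \<open>
  All derivatives of the left-invariant frame below are computed by this product rule for a
  differential whose base point and direction both move.
\<close>

lemma has_derivative_D_along:
  assumes f: "smooth f" and g: "(\<gamma> has_derivative \<gamma>') (at a)" and V: "(V has_derivative V') (at a)"
  shows "((\<lambda>x. D f (\<gamma> x) (V x)) has_derivative
           (\<lambda>h. DD f (\<gamma> a) (\<gamma>' h) (V a) + D f (\<gamma> a) (V' h))) (at a)"
proof -
  note exp = D_expand_basis[OF smooth_imp_Ck[OF f]]
  have "((\<lambda>x. \<Sum>b\<in>Basis. (V x \<bullet> b) *\<^sub>R D f (\<gamma> x) b) has_derivative
     (\<lambda>h. \<Sum>b\<in>Basis. (V a \<bullet> b) *\<^sub>R DD f (\<gamma> a) (\<gamma>' h) b + (V' h \<bullet> b) *\<^sub>R D f (\<gamma> a) b)) (at a)"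
    using V by (auto intro!: derivative_eq_intros has_derivative_compose[OF g smooth_has_derivative[OF smooth_D[OF f]]])
  moreover have "DD f (\<gamma> a) (\<gamma>' h) (V a) = (\<Sum>b\<in>Basis. (V a \<bullet> b) *\<^sub>R DD f (\<gamma> a) (\<gamma>' h) b)" for h
  proof -
    have "D (\<lambda>y. \<Sum>b\<in>Basis. (V a \<bullet> b) *\<^sub>R D f y b) (\<gamma> a) = (\<lambda>h. \<Sum>b\<in>Basis. (V a \<bullet> b) *\<^sub>R DD f (\<gamma> a) h b)"
      by (rule D_eqI) (auto intro!: derivative_eq_intros smooth_has_derivative smooth_D f)
    then show ?thesis by (simp add: exp[of _ "V a"])
  qed
  ultimately show ?thesis
    by (simp add: exp[of _ "V _"] exp[of _ "V' _"] sum.distrib)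
qed

lemma has_real_derivative_on_line:
  fixes f :: "'a::euclidean_space \<Rightarrow> real"
  assumes f: "smooth f"
  shows "((\<lambda>s. f (p + s *\<^sub>R v)) has_real_derivative D f (p + s *\<^sub>R v) v) (at s)"
proof -
  have "((\<lambda>s. f (p + s *\<^sub>R v)) has_derivative (\<lambda>h. D f (p + s *\<^sub>R v) (h *\<^sub>R v))) (at s)"
    by (rule has_derivative_compose[OF _ smooth_has_derivative[OF f]])
       (auto intro!: derivative_eq_intros)
  moreover have "(\<lambda>h. D f (p + s *\<^sub>R v) (h *\<^sub>R v)) = (*) (D f (p + s *\<^sub>R v) v)"
    by (simp add: fun_eq_iff linear_cmul[OF smooth_linear_D[OF f]])
  ultimately show ?thesis by (simp add: has_field_derivative_def)
qed

text \<open>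
  The second difference is symmetric in \<open>u\<close> and \<open>v\<close>, while two applications of the mean value theorem
  express it by the second derivative in one fixed order at a nearby point.  Exchanging the roles of
  \<open>u\<close> and \<open>v\<close> and shrinking \<open>t\<close> yields the symmetry of the second derivative.
\<close>

lemma second_difference_mvt:
  fixes f :: "'a::euclidean_space \<Rightarrow> real"
  assumes f: "smooth f" and t: "t > 0"
  shows "\<exists>r s. 0 < r \<and> r < t \<and> 0 < s \<and> s < t \<and>
     f (x + t *\<^sub>R u + t *\<^sub>R v) - f (x + t *\<^sub>R u) - f (x + t *\<^sub>R v) + f x
      = t * t * DD f (x + r *\<^sub>R u + s *\<^sub>R v) v u"
proof -
  have d1: "((\<lambda>r. f (x + r *\<^sub>R u + t *\<^sub>R v) - f (x + r *\<^sub>R u)) has_real_derivative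
       D f (x + r *\<^sub>R u + t *\<^sub>R v) u - D f (x + r *\<^sub>R u) u) (at r)" for r
    using DERIV_diff[OF has_real_derivative_on_line[OF f, of "x + t *\<^sub>R v" u r]
        has_real_derivative_on_line[OF f, of x u r]]
    by (simp add: add.commute add.left_commute)
  obtain r where r: "0 < r" "r < t" and e1:
     "(f (x + t *\<^sub>R u + t *\<^sub>R v) - f (x + t *\<^sub>R u)) - (f (x + 0 *\<^sub>R u + t *\<^sub>R v) - f (x + 0 *\<^sub>R u))
      = (t - 0) * (D f (x + r *\<^sub>R u + t *\<^sub>R v) u - D f (x + r *\<^sub>R u) u)"
    using MVT2[OF t d1] by blast
  have d2: "((\<lambda>s. D f (x + r *\<^sub>R u + s *\<^sub>R v) u) has_real_derivative
       DD f (x + r *\<^sub>R u + s *\<^sub>R v) v u) (at s)" for s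
    by (rule has_real_derivative_on_line[OF smooth_D[OF f]])
  obtain s where s: "0 < s" "s < t" and e2:
     "D f (x + r *\<^sub>R u + t *\<^sub>R v) u - D f (x + r *\<^sub>R u + 0 *\<^sub>R v) u
      = (t - 0) * DD f (x + r *\<^sub>R u + s *\<^sub>R v) v u"
    using MVT2[OF t d2] by blast
  show ?thesis
    by (rule exI[of _ r], rule exI[of _ s]) (use r s e1 e2 in \<open>simp add: algebra_simps\<close>)
qed

lemma DD_symmetric_real:
  fixes f :: "'a::euclidean_space \<Rightarrow> real"
  assumes f: "smooth f"
  shows "DD f x u v = DD f x v u"
proof (rule ccontr)
  assume ne: "DD f x u v \<noteq> DD f x v u"
  define \<epsilon> where "\<epsilon> = \<bar>DD f x u v - DD f x v u\<bar> / 2"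
  have e: "\<epsilon> > 0" using ne by (simp add: \<epsilon>_def)
  have c: "\<exists>d>0. \<forall>y. dist y x < d \<longrightarrow> \<bar>DD f y a b - DD f x a b\<bar> < \<epsilon>" for a b
    using e smooth_continuous[OF smooth_D[OF smooth_D[OF f]], of UNIV] 
    by (auto simp: continuous_on_iff dist_real_def)
  obtain d1 where d1: "d1 > 0" "\<And>y. dist y x < d1 \<Longrightarrow> \<bar>DD f y u v - DD f x u v\<bar> < \<epsilon>"
    using c[where a = u and b = v] by blast
  obtain d2 where d2: "d2 > 0" "\<And>y. dist y x < d2 \<Longrightarrow> \<bar>DD f y v u - DD f x v u\<bar> < \<epsilon>"
    using c[where a = v and b = u] by blast
  define d where "d = min d1 d2"
  \<comment> \<open>so small that the whole parallelogram with sides \<open>t u\<close> and \<open>t v\<close> lies within distance \<open>d\<close> of \<open>x\<close>\<close>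
  define t where "t = d / (norm u + norm v + 1)"
  have pos: "norm u + norm v + 1 > 0" by (simp add: add_nonneg_pos)
  have t: "t > 0" using d1 d2 pos by (simp add: t_def d_def)
  have near: "dist (x + r *\<^sub>R u + s *\<^sub>R v) x < d" if "0 < r" "r < t" "0 < s" "s < t" for r s
  proof -
    have "dist (x + r *\<^sub>R u + s *\<^sub>R v) x \<le> r * norm u + s * norm v"
      using norm_triangle_ineq[of "r *\<^sub>R u" "s *\<^sub>R v"] that by (simp add: dist_norm algebra_simps)
    also have "\<dots> \<le> t * norm u + t * norm v"
      using that by (intro add_mono mult_right_mono) auto
    also have "\<dots> < t * (norm u + norm v + 1)" using t by (simp add: algebra_simps)
    also have "\<dots> = d" using pos by (simp add: t_def)
    finally show ?thesis .
  qed
  obtain r s where 1: "0 < r" "r < t" "0 < s" "s < t" 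
     "f (x + t *\<^sub>R u + t *\<^sub>R v) - f (x + t *\<^sub>R u) - f (x + t *\<^sub>R v) + f x
      = t * t * DD f (x + r *\<^sub>R u + s *\<^sub>R v) v u"
    using second_difference_mvt[OF f t] by blast
  obtain r' s' where 2: "0 < r'" "r' < t" "0 < s'" "s' < t" 
     "f (x + t *\<^sub>R v + t *\<^sub>R u) - f (x + t *\<^sub>R v) - f (x + t *\<^sub>R u) + f x
      = t * t * DD f (x + r' *\<^sub>R v + s' *\<^sub>R u) u v"
    using second_difference_mvt[OF f t] by blast
  have "t * t * DD f (x + r *\<^sub>R u + s *\<^sub>R v) v u = t * t * DD f (x + r' *\<^sub>R v + s' *\<^sub>R u) u v"
    unfolding 1(5)[symmetric] 2(5)[symmetric] by (simp add: algebra_simps)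
  then have eq: "DD f (x + r *\<^sub>R u + s *\<^sub>R v) v u = DD f (x + r' *\<^sub>R v + s' *\<^sub>R u) u v"
    using t by simp
  have "dist (x + r *\<^sub>R u + s *\<^sub>R v) x < d2" "dist (x + r' *\<^sub>R v + s' *\<^sub>R u) x < d1"
    using near[OF 1(1-4)] near[OF 2(3,4) 2(1,2)] by (auto simp: d_def algebra_simps)
  then have "\<bar>DD f x u v - DD f x v u\<bar> < 2 * \<epsilon>"
    using d1(2)[of "x + r' *\<^sub>R v + s' *\<^sub>R u"] d2(2)[of "x + r *\<^sub>R u + s *\<^sub>R v"] eq by linarith
  then show False by (simp add: \<epsilon>_def)
qed

lemma DD_symmetric:
  assumes f: "smooth f"
  shows "DD f x u v = DD f x v u"
proof (rule euclidean_eqI)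
  fix b :: 'b assume "b \<in> Basis"
  have s: "smooth (\<lambda>y. f y \<bullet> b)" by (intro smooth_inner f smooth_const)
  have i: "D (\<lambda>y. g y \<bullet> b) y w = D g y w \<bullet> b" if "smooth g" for g :: "'a \<Rightarrow> 'b" and y w
  proof -
    have "D (\<lambda>y. g y \<bullet> b) y = (\<lambda>w. D g y w \<bullet> b)"
      by (rule D_eqI) (auto intro!: derivative_eq_intros smooth_has_derivative that)
    then show ?thesis by simp
  qed
  show "DD f x u v \<bullet> b = DD f x v u \<bullet> b"
    using DD_symmetric_real[OF s, where x = x and u = u and v = v] by (simp add: i f smooth_D)
qed

section \<open>Left-invariant vector fields in exponential coordinates\<close>

text \<open>
  Testing against vectors orthogonal to \<open>S\<close> turns statements about derivatives of vector-valued maps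
  into statements about real functions with derivative zero.
\<close>

lemma mem_subspace_if_orthogonal:
  fixes x :: "'a::euclidean_space"
  assumes S: "subspace S" and x: "\<And>z. (\<And>w. w \<in> S \<Longrightarrow> w \<bullet> z = 0) \<Longrightarrow> x \<bullet> z = 0"
  shows "x \<in> S"
proof -
  obtain y z where yz: "y \<in> span S" "\<And>w. w \<in> span S \<Longrightarrow> orthogonal z w" "x = y + z"
    using orthogonal_subspace_decomp_exists by blast
  have orth: "w \<bullet> z = 0" if "w \<in> S" for w
    using yz(2)[of w] that by (simp add: orthogonal_def inner_commute span_base)
  have y: "y \<in> S" using yz(1) S by (metis span_eq_iff)
  have "z \<bullet> z = x \<bullet> z - y \<bullet> z" using yz(3) by (simp add: inner_add_left)
  also have "\<dots> = 0" using x[OF orth] orth[OF y] by simp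
  finally show ?thesis using yz(3) y by simp
qed

lemma curve_in_subspace:
  fixes c :: "real \<Rightarrow> 'a::euclidean_space"
  assumes S: "subspace S" and c: "\<And>t. (c has_vector_derivative c' t) (at t)"
    and 0: "c 0 \<in> S" and c': "\<And>t. c' t \<in> S"
  shows "c t \<in> S"
proof (rule mem_subspace_if_orthogonal[OF S])
  fix z assume orth: "\<And>w. w \<in> S \<Longrightarrow> w \<bullet> z = 0"
  have "((\<lambda>t. c t \<bullet> z) has_real_derivative 0) (at t)" for t
    using bounded_linear.has_vector_derivative[OF bounded_linear_inner_left c, of z t]
    by (simp add: has_real_derivative_iff_has_vector_derivative orth[OF c'])
  then have "c t \<bullet> z = c 0 \<bullet> z" by (intro DERIV_isconst_all allI)
  then show "c t \<bullet> z = 0" using orth[OF 0] by simp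
qed

lemma derivative_in_subspace:
  fixes f :: "'b::real_normed_vector \<Rightarrow> 'a::euclidean_space"
  assumes S: "subspace S" and f: "(f has_derivative f') (at x)" and in_S: "\<And>x. f x \<in> S"
  shows "f' h \<in> S"
proof (rule mem_subspace_if_orthogonal[OF S])
  fix z assume orth: "\<And>w. w \<in> S \<Longrightarrow> w \<bullet> z = 0"
  have "((\<lambda>x. f x \<bullet> z) has_derivative (\<lambda>h. f' h \<bullet> z)) (at x)"
    by (rule has_derivative_inner_left[OF f])
  moreover have "((\<lambda>x. f x \<bullet> z) has_derivative (\<lambda>h. 0)) (at x)"
    by (simp add: orth[OF in_S])
  ultimately show "f' h \<bullet> z = 0" by (metis has_derivative_unique)
qed

definition trace :: "('a::euclidean_space \<Rightarrow> 'a) \<Rightarrow> real" where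
  "trace L = (\<Sum>b\<in>Basis. L b \<bullet> b)"

lemma trace_commute:
  fixes A B :: "'a::euclidean_space \<Rightarrow> 'a"
  assumes "linear A" "linear B"
  shows "trace (\<lambda>x. A (B x)) = trace (\<lambda>x. B (A x))"
proof -
  have expand: "A (B b) \<bullet> b = (\<Sum>c\<in>Basis. (B b \<bullet> c) * (A c \<bullet> b))" if "linear A" for A B :: "'a \<Rightarrow> 'a" and b
  proof -
    have "A (B b) = A (\<Sum>c\<in>Basis. (B b \<bullet> c) *\<^sub>R c)" by (simp add: euclidean_representation)
    also have "\<dots> = (\<Sum>c\<in>Basis. (B b \<bullet> c) *\<^sub>R A c)"
      by (simp add: linear_sum[OF that] linear_cmul[OF that])
    finally show ?thesis by (simp add: inner_sum_left)
  qed
  show ?thesis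
    unfolding trace_def expand[OF assms(1), where B = B] expand[OF assms(2), where B = A]
    by (subst sum.swap) (simp add: mult.commute)
qed

context carnot_group
begin

abbreviation Z :: "'a \<Rightarrow> 'a \<Rightarrow> 'a" where "Z \<equiv> left_inv_vf mul"
abbreviation lie :: "'a \<Rightarrow> 'a \<Rightarrow> 'a" where "lie \<equiv> lie_bracket mul"

lemma smooth_mul_compose: "smooth a \<Longrightarrow> smooth b \<Longrightarrow> smooth (\<lambda>x. mul (a x) (b x))"
  using smooth_compose[OF smooth_mul smooth_Pair[of a b]] by simp

lemma smooth_left_translation: "smooth (mul x)"
  by (rule smooth_mul_compose[OF smooth_const smooth_ident])

lemma D_left_translation: "D (mul x) y v = D (\<lambda>(x, y). mul x y) (x, y) (0, v)"
proof -
  have "((\<lambda>y. (x, y)) has_derivative (\<lambda>v. (0, v))) (at y)" by (auto intro!: derivative_eq_intros)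
  from has_derivative_compose[OF this smooth_has_derivative[OF smooth_mul]]
  have "((\<lambda>y. mul x y) has_derivative (\<lambda>v. D (\<lambda>(x, y). mul x y) (x, y) (0, v))) (at y)" by simp
  then show ?thesis by (simp add: D_eqI)
qed

lemma Z_eq: "Z v x = D (\<lambda>(x, y). mul x y) (x, 0) (0, v)"
  by (simp add: left_inv_vf_def D_left_translation)

lemma smooth_Z: "smooth (Z v)"
  unfolding Z_eq[abs_def]
  by (intro smooth_D_along smooth_mul smooth_Pair smooth_const smooth_ident)

lemma linear_Z: "linear (\<lambda>v. Z v x)"
  unfolding left_inv_vf_def by (rule smooth_linear_D[OF smooth_left_translation])

lemma has_derivative_Z:
  assumes V: "(V has_derivative V') (at a)" and \<gamma>: "(\<gamma> has_derivative \<gamma>') (at a)"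
  shows "((\<lambda>s. Z (V s) (\<gamma> s)) has_derivative (\<lambda>h. D (Z (V a)) (\<gamma> a) (\<gamma>' h) + Z (V' h) (\<gamma> a))) (at a)"
proof -
  let ?F = "\<lambda>(x, y). mul x y"
  have *: "((\<lambda>s. Z (V s) (\<gamma> s)) has_derivative
     (\<lambda>h. DD ?F (\<gamma> a, 0) (\<gamma>' h, 0) (0, V a) + D ?F (\<gamma> a, 0) (0, V' h))) (at a)"
    if "(V has_derivative V') (at a)" "(\<gamma> has_derivative \<gamma>') (at a)"
    for V V' \<gamma> \<gamma>' and a :: "'c::real_normed_vector"
    unfolding Z_eq by (rule has_derivative_D_along[OF smooth_mul]) (auto intro!: derivative_eq_intros that)
  have "D (Z v) x h = DD ?F (x, 0) (h, 0) (0, v)" for v x h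
  proof -
    have "(Z v has_derivative (\<lambda>h. DD ?F (x, 0) (h, 0) (0, v) + D ?F (x, 0) (0, 0))) (at x)"
      using *[OF has_derivative_const has_derivative_ident] by simp
    moreover have "D ?F (x, 0) (0, 0) = 0"
      using linear_0[OF smooth_linear_D[OF smooth_mul]] by (simp add: zero_prod_def)
    ultimately show ?thesis by (simp add: D_eqI)
  qed
  with *[OF assms] show ?thesis by (simp add: Z_eq)
qed

lemma Z_at_0 [simp]: "Z v 0 = v"
proof -
  have "mul 0 = (\<lambda>x. x)" by (simp add: fun_eq_iff group_left_neutral)
  then show ?thesis by (simp add: left_inv_vf_def)
qed

text \<open>
  The one place where exponential coordinates enter: \<open>t \<mapsto> t x\<close> is a one-parameter subgroup, so it is an
  integral curve of \<open>Z x\<close>.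
\<close>

lemma Z_along_ray: "Z x (t *\<^sub>R x) = x"
proof -
  have ray: "((\<lambda>s. s *\<^sub>R x) has_derivative (\<lambda>h. h *\<^sub>R x)) (at 0)" by (auto intro!: derivative_eq_intros)
  have "((\<lambda>s. mul (t *\<^sub>R x) (s *\<^sub>R x)) has_derivative (\<lambda>h. D (mul (t *\<^sub>R x)) (0 *\<^sub>R x) (h *\<^sub>R x))) (at 0)"
    by (rule has_derivative_compose[OF ray smooth_has_derivative[OF smooth_left_translation]])
  moreover have "((\<lambda>s. mul (t *\<^sub>R x) (s *\<^sub>R x)) has_derivative (\<lambda>h. h *\<^sub>R x)) (at 0)"
    unfolding exp_coords by (auto intro!: derivative_eq_intros simp: algebra_simps)
  ultimately have "(\<lambda>h. D (mul (t *\<^sub>R x)) (0 *\<^sub>R x) (h *\<^sub>R x)) = (\<lambda>h. h *\<^sub>R x)"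
    by (rule has_derivative_unique)
  from fun_cong[OF this, of 1] show ?thesis by (simp add: left_inv_vf_def)
qed

lemma mul_0_right [simp]: "mul x 0 = x"
  using exp_coords[of 1 x 0] by simp

lemma mul_neg: "mul x (- x) = 0" "mul (- x) x = 0"
  using exp_coords[of 1 x "-1"] exp_coords[of "-1" x 1] by auto

lemma Z_left_invariant: "Z w (mul x y) = D (mul x) y (Z w y)"
proof -
  have "D (\<lambda>z. mul x (mul y z)) 0 w = D (mul x) (mul y 0) (D (mul y) 0 w)"
    by (rule D_compose[OF smooth_left_translation smooth_left_translation])
  moreover have "(\<lambda>z. mul x (mul y z)) = mul (mul x y)" by (simp add: fun_eq_iff assoc)
  ultimately show ?thesis by (simp add: left_inv_vf_def)
qed

text \<open>
  Differentiate \<open>Z w (x y) = D (mul x) y (Z w y)\<close> with respect to \<open>y\<close> at \<open>0\<close> in direction \<open>v\<close>.  The second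
  derivative of the left translation that appears is symmetric in \<open>v\<close> and \<open>w\<close>, so it
  cancels in the commutator.
\<close>

lemma bracket_of_Z:
  "D (Z w) x (Z v x) - D (Z v) x (Z w x) = Z (lie v w) x"
proof -
  have *: "D (Z w) x (Z v x) = DD (mul x) 0 v w + Z (D (Z w) 0 v) x" for v w
  proof -
    have "((\<lambda>y. Z w (mul x y)) has_derivative (\<lambda>v. D (Z w) (mul x 0) (D (mul x) 0 v))) (at 0)"
      by (rule has_derivative_compose[OF smooth_has_derivative[OF smooth_left_translation]
           smooth_has_derivative[OF smooth_Z]])
    moreover have "((\<lambda>y. Z w (mul x y)) has_derivative
        (\<lambda>v. DD (mul x) 0 v (Z w 0) + D (mul x) 0 (D (Z w) 0 v))) (at 0)"
      unfolding Z_left_invariant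
      by (rule has_derivative_D_along[OF smooth_left_translation has_derivative_ident
           smooth_has_derivative[OF smooth_Z]])
    ultimately have "(\<lambda>v. D (Z w) (mul x 0) (D (mul x) 0 v)) = (\<lambda>v. DD (mul x) 0 v (Z w 0) + D (mul x) 0 (D (Z w) 0 v))"
      by (rule has_derivative_unique)
    from fun_cong[OF this, of v] show ?thesis by (simp flip: left_inv_vf_def[of mul])
  qed
  have "lie v w = D (Z w) 0 v - D (Z v) 0 w"
    by (simp add: lie_bracket_def vf_bracket_def vf_apply_def)
  then show ?thesis
    unfolding *[of w v] *[of v w]
    using DD_symmetric[OF smooth_left_translation, where x = 0 and u = v and v = w]
    by (simp add: linear_diff[OF linear_Z])
qed

text \<open>
  The first-order term of the frame at the identity.  It turns out to be antisymmetric, because rays are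
  integral curves, and so it is half of the Lie bracket.
\<close>

definition half_lie :: "'a \<Rightarrow> 'a \<Rightarrow> 'a" where "half_lie v w = D (Z w) 0 v"

lemma linear_half_lie_left: "linear (\<lambda>v. half_lie v w)"
  unfolding half_lie_def by (rule smooth_linear_D[OF smooth_Z])

lemma linear_half_lie_right: "linear (half_lie v)"
proof (rule linearI)
  show "half_lie v (w + w') = half_lie v w + half_lie v w'" for w w'
  proof -
    have "Z (w + w') = (\<lambda>x. Z w x + Z w' x)" by (simp add: fun_eq_iff linear_add[OF linear_Z])
    moreover have "D (\<lambda>x. Z w x + Z w' x) 0 = (\<lambda>h. D (Z w) 0 h + D (Z w') 0 h)"
      by (intro D_eqI has_derivative_add smooth_has_derivative smooth_Z)
    ultimately show ?thesis by (simp add: half_lie_def)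
  qed
  show "half_lie v (r *\<^sub>R w) = r *\<^sub>R half_lie v w" for r w
  proof -
    have "Z (r *\<^sub>R w) = (\<lambda>x. r *\<^sub>R Z w x)" by (simp add: fun_eq_iff linear_cmul[OF linear_Z])
    moreover have "D (\<lambda>x. r *\<^sub>R Z w x) 0 = (\<lambda>h. r *\<^sub>R D (Z w) 0 h)"
      by (intro D_eqI has_derivative_scaleR_right smooth_has_derivative smooth_Z)
    ultimately show ?thesis by (simp add: half_lie_def)
  qed
qed

lemma half_lie_self: "half_lie x x = 0"
proof -
  have ray: "((\<lambda>s. s *\<^sub>R x) has_derivative (\<lambda>h. h *\<^sub>R x)) (at 0)" by (auto intro!: derivative_eq_intros)
  have "((\<lambda>s. Z x (s *\<^sub>R x)) has_derivative (\<lambda>h. D (Z x) (0 *\<^sub>R x) (h *\<^sub>R x))) (at 0)"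
    by (rule has_derivative_compose[OF ray smooth_has_derivative[OF smooth_Z]])
  moreover have "((\<lambda>s. Z x (s *\<^sub>R x)) has_derivative (\<lambda>h. 0)) (at 0)"
    unfolding Z_along_ray by simp
  ultimately have "(\<lambda>h. D (Z x) (0 *\<^sub>R x) (h *\<^sub>R x)) = (\<lambda>h. 0)"
    by (rule has_derivative_unique)
  from fun_cong[OF this, of 1] show ?thesis by (simp add: half_lie_def)
qed

lemma half_lie_antisym: "half_lie v w = - half_lie w v"
proof -
  have "half_lie (v + w) (v + w) = half_lie v v + half_lie v w + (half_lie w v + half_lie w w)"
    by (simp add: linear_add[OF linear_half_lie_left] linear_add[OF linear_half_lie_right])
  then show ?thesis by (simp add: half_lie_self eq_neg_iff_add_eq_0)
qed

lemma lie_eq: "lie v w = 2 *\<^sub>R half_lie v w"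
proof -
  have "lie v w = half_lie v w - half_lie w v"
    by (simp add: lie_bracket_def vf_bracket_def vf_apply_def half_lie_def)
  then show ?thesis using half_lie_antisym[of w v] by (simp add: scaleR_2)
qed

lemma linear_lie_left: "linear (\<lambda>v. lie v w)"
  unfolding lie_eq by (intro linear_compose_scale_right linear_half_lie_left)

lemma linear_lie_right: "linear (lie v)"
  unfolding lie_eq[abs_def] by (intro linear_compose_scale_right linear_half_lie_right)

lemma lie_antisym: "lie v w = - lie w v"
  unfolding lie_eq by (subst half_lie_antisym) simp

text \<open>
  Differentiating \<open>bracket_of_Z\<close> at \<open>0\<close> in direction \<open>u\<close> expresses \<open>[u, [v, w]]\<close> by second derivatives of
  the fields and by iterated brackets.  In the cyclic sum the second derivatives cancel by symmetry; what
  remains is \<open>4 S = 0\<close> for the cyclic sum \<open>S\<close>.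
\<close>

lemma half_lie_jacobi: "half_lie u (half_lie v w) + half_lie v (half_lie w u) + half_lie w (half_lie u v) = 0"
proof -
  have *: "DD (Z w) 0 u v - DD (Z v) 0 u w = 2 *\<^sub>R half_lie u (half_lie v w) + half_lie w (half_lie u v) + half_lie v (half_lie w u)" for u v w
  proof -
    have d: "((\<lambda>x. D (Z w) x (Z v x)) has_derivative
        (\<lambda>h. DD (Z w) 0 h (Z v 0) + D (Z w) 0 (D (Z v) 0 h))) (at 0)" for v w
      by (rule has_derivative_D_along[OF smooth_Z has_derivative_ident smooth_has_derivative[OF smooth_Z]])
    have "((\<lambda>x. D (Z w) x (Z v x) - D (Z v) x (Z w x)) has_derivative
        (\<lambda>h. DD (Z w) 0 h (Z v 0) + D (Z w) 0 (D (Z v) 0 h) -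
             (DD (Z v) 0 h (Z w 0) + D (Z v) 0 (D (Z w) 0 h)))) (at 0)"
      by (rule has_derivative_diff[OF d d])
    moreover have "((\<lambda>x. D (Z w) x (Z v x) - D (Z v) x (Z w x)) has_derivative D (Z (lie v w)) 0) (at 0)"
      unfolding bracket_of_Z by (rule smooth_has_derivative[OF smooth_Z])
    ultimately have "(\<lambda>h. DD (Z w) 0 h (Z v 0) + D (Z w) 0 (D (Z v) 0 h) -
             (DD (Z v) 0 h (Z w 0) + D (Z v) 0 (D (Z w) 0 h))) = D (Z (lie v w)) 0"
      by (rule has_derivative_unique)
    from fun_cong[OF this, of u]
    have "DD (Z w) 0 u v + half_lie (half_lie u v) w - (DD (Z v) 0 u w + half_lie (half_lie u w) v) = half_lie u (lie v w)"
      by (simp add: half_lie_def)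
    moreover have "half_lie u (lie v w) = 2 *\<^sub>R half_lie u (half_lie v w)"
      by (simp add: lie_eq linear_cmul[OF linear_half_lie_right])
    moreover have "half_lie (half_lie u v) w = - half_lie w (half_lie u v)" by (rule half_lie_antisym)
    moreover have "half_lie (half_lie u w) v = half_lie v (half_lie w u)"
      using half_lie_antisym[of "half_lie u w" v] half_lie_antisym[of u w] linear_neg[OF linear_half_lie_right] by simp
    ultimately show ?thesis by (simp add: algebra_simps)
  qed
  note s = DD_symmetric[OF smooth_Z, where x = 0]
  let ?S = "half_lie u (half_lie v w) + half_lie v (half_lie w u) + half_lie w (half_lie u v)"
  have four: "4 *\<^sub>R x = 2 *\<^sub>R x + x + x" for x :: 'a
    using scaleR_add_left[of 2 2 x] by (simp add: scaleR_2)
  have "4 *\<^sub>R ?S = (2 *\<^sub>R half_lie u (half_lie v w) + half_lie w (half_lie u v) + half_lie v (half_lie w u))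
      + (2 *\<^sub>R half_lie v (half_lie w u) + half_lie u (half_lie v w) + half_lie w (half_lie u v))
      + (2 *\<^sub>R half_lie w (half_lie u v) + half_lie v (half_lie w u) + half_lie u (half_lie v w))"
    unfolding scaleR_add_right four by (simp only: add_ac)
  also have "\<dots> = 0"
    unfolding *[symmetric] s[of w u v] s[of v w u] s[of u v w] by simp
  finally show ?thesis by simp
qed

lemma lie_jacobi: "lie (lie a b) y = lie a (lie b y) - lie b (lie a y)"
proof -
  have "half_lie (half_lie a b) y = half_lie a (half_lie b y) - half_lie b (half_lie a y)"
  proof -
    have "half_lie (half_lie a b) y = - half_lie y (half_lie a b)" by (rule half_lie_antisym)
    moreover have "half_lie b (half_lie y a) = - half_lie b (half_lie a y)"
      by (subst half_lie_antisym[of y a]) (simp add: linear_neg[OF linear_half_lie_right])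
    ultimately have "half_lie a (half_lie b y) - half_lie b (half_lie a y) + half_lie y (half_lie a b) = 0" using half_lie_jacobi[of a b y] by simp
    then have "half_lie a (half_lie b y) - half_lie b (half_lie a y) = - half_lie y (half_lie a b)" by (simp only: eq_neg_iff_add_eq_0)
    then show ?thesis using \<open>half_lie (half_lie a b) y = - half_lie y (half_lie a b)\<close> by simp
  qed
  then show ?thesis
    by (simp add: lie_eq linear_cmul[OF linear_half_lie_right] linear_cmul[OF linear_half_lie_left] scaleR_diff_right)
qed

subsection \<open>The filtration by degree\<close>

text \<open>
  The strata themselves are not preserved by the frame \<open>v \<mapsto> Z v x\<close>, whose Taylor expansion in \<open>x\<close> adds terms
  of higher degree; the sums of all strata from degree \<open>k\<close> on are.
\<close>

definition filtr :: "nat \<Rightarrow> 'a set" where "filtr k = span (\<Union>i\<in>{k..m}. g i)"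

lemma subspace_filtr: "subspace (filtr k)"
  by (simp add: filtr_def)

lemma filtr_antimono: "k \<le> l \<Longrightarrow> filtr l \<subseteq> filtr k"
  unfolding filtr_def by (intro span_mono UN_mono) auto

lemma stratum_subset_filtr: "k \<le> i \<Longrightarrow> i \<le> m \<Longrightarrow> g i \<subseteq> filtr k"
  unfolding filtr_def by (metis (no_types, lifting) UN_upper atLeastAtMost_iff order_trans span_superset)

lemma filtr_top: "filtr (m + 1) = {0}"
  by (simp add: filtr_def)

lemma filtr_1: "filtr 1 = UNIV"
proof -
  have "v \<in> filtr 1" for v
  proof -
    obtain f where f: "f \<in> (\<Pi>\<^sub>E i\<in>{1..m}. g i)" "v = (\<Sum>i=1..m. f i)"
      using direct_sum[of v] by blast
    have "f i \<in> filtr 1" if "i \<in> {1..m}" for i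
      using PiE_mem[OF f(1) that] stratum_subset_filtr[of 1 i] that by auto
    then show ?thesis unfolding f(2) by (intro subspace_sum[OF subspace_filtr])
  qed
  then show ?thesis by auto
qed

lemma lie_horizontal_filtr:
  assumes x: "x \<in> g 1" and k: "1 \<le> k" and y: "y \<in> filtr k"
  shows "lie x y \<in> filtr (k + 1)"
  using y unfolding filtr_def[of k]
proof (induction rule: span_induct)
  case base
  show ?case using linear_lie_right subspace_filtr by (intro linear_subspace_linear_preimage)
next
  case (step y)
  then obtain j where j: "k \<le> j" "j \<le> m" "y \<in> g j" by auto
  have "lie x y \<in> lie_bracket_span mul (g 1) (g j)"
    unfolding lie_bracket_span_def using x j by (intro span_base) auto
  moreover have "lie_bracket_span mul (g 1) (g j) \<subseteq> filtr (k + 1)"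
  proof (cases "j = m")
    case True
    then show ?thesis using bracket_top subspace_0[OF subspace_filtr] by simp
  next
    case False
    then show ?thesis using bracket_strata[of j] j k stratum_subset_filtr[of "k + 1" "j + 1"] by simp
  qed
  ultimately show ?case by blast
qed

text \<open>
  The axioms only speak of brackets with the first stratum.  The higher strata are
  generated by it, so the Jacobi identity carries the inclusion upwards.
\<close>

lemma lie_stratum_filtr:
  assumes "1 \<le> i" "i \<le> m" "x \<in> g i" "1 \<le> k" "y \<in> filtr k"
  shows "lie x y \<in> filtr (k + 1)"
  using assms
proof (induction i arbitrary: x y k rule: nat_induct_at_least)
  case base
  then show ?case using lie_horizontal_filtr by blast
next
  case (Suc i)
  have "g (Suc i) = span {lie v w | v w. v \<in> g 1 \<and> w \<in> g i}"
    using bracket_strata[of i] Suc by (simp add: lie_bracket_span_def)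
  then have "x \<in> span {lie v w | v w. v \<in> g 1 \<and> w \<in> g i}" using Suc by simp
  then show ?case
  proof (induction rule: span_induct)
    case base
    show ?case using linear_lie_left subspace_filtr by (intro linear_subspace_linear_preimage)
  next
    case (step x)
    then obtain a b where ab: "x = lie a b" "a \<in> g 1" "b \<in> g i" by auto
    have "lie b y \<in> filtr (k + 1)" using Suc ab by simp
    moreover have "lie b (lie a y) \<in> filtr (k + 1 + 1)"
      by (rule Suc.IH[OF _ ab(3) _ lie_horizontal_filtr[OF ab(2) Suc.prems(3,4)]]) (use Suc.prems in auto)
    ultimately have "lie a (lie b y) - lie b (lie a y) \<in> filtr (k + 1 + 1)"
      using lie_horizontal_filtr[OF ab(2), of "k + 1"] by (intro subspace_diff[OF subspace_filtr]) auto
    then show ?case unfolding ab(1) lie_jacobi using filtr_antimono[of "k + 1" "k + 1 + 1"] by auto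
  qed
qed

lemma lie_filtr:
  assumes "1 \<le> k" "y \<in> filtr k" shows "lie x y \<in> filtr (k + 1)"
proof -
  have "x \<in> filtr 1" unfolding filtr_1 by simp
  then show ?thesis unfolding filtr_def[of 1]
  proof (induction rule: span_induct)
    case base
    show ?case using linear_lie_left subspace_filtr by (intro linear_subspace_linear_preimage)
  next
    case (step x)
    then show ?case using lie_stratum_filtr assms by auto
  qed
qed

subsection \<open>Unipotence of the left-invariant frame\<close>

text \<open>
  Since \<open>- x\<close> is the inverse of \<open>x\<close>, this is the inverse of \<open>v \<mapsto> Z v x\<close>: the left Maurer-Cartan form.  Unlike the
  frame it satisfies a linear differential equation along rays.
\<close>

definition coframe :: "'a \<Rightarrow> 'a \<Rightarrow> 'a" where "coframe x v = D (mul (- x)) x v"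

lemma Z_coframe: "Z (coframe x v) x = v"
proof -
  have "D (\<lambda>y. mul x (mul (- x) y)) x v = D (mul x) (mul (- x) x) (D (mul (- x)) x v)"
    by (rule D_compose[OF smooth_left_translation smooth_left_translation])
  moreover have "(\<lambda>y. mul x (mul (- x) y)) = (\<lambda>y. y)"
    by (simp add: mul_neg group_left_neutral flip: assoc)
  ultimately show ?thesis by (simp add: left_inv_vf_def coframe_def mul_neg)
qed

lemma coframe_Z: "coframe x (Z v x) = v"
proof -
  have "D (\<lambda>y. mul (- x) (mul x y)) 0 v = D (mul (- x)) (mul x 0) (D (mul x) 0 v)"
    by (rule D_compose[OF smooth_left_translation smooth_left_translation])
  moreover have "(\<lambda>y. mul (- x) (mul x y)) = (\<lambda>y. y)"
    by (simp add: mul_neg group_left_neutral flip: assoc)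
  ultimately show ?thesis by (simp add: left_inv_vf_def coframe_def)
qed

lemma smooth_coframe: "smooth (\<lambda>x. coframe x v)"
  unfolding coframe_def D_left_translation
  by (intro smooth_D_along smooth_mul smooth_Pair smooth_const smooth_ident smooth_linear)
     (simp add: linear_iff)

text \<open>
  Differentiate \<open>Z x (t x) = x\<close> in \<open>x\<close>, which occurs both as the index of the field and in the point.
\<close>

lemma D_Z_along_ray: "D (Z x) (t *\<^sub>R x) (t *\<^sub>R y) = y - Z y (t *\<^sub>R x)"
proof -
  have "((\<lambda>x. Z x (t *\<^sub>R x)) has_derivative (\<lambda>h. D (Z x) (t *\<^sub>R x) (t *\<^sub>R h) + Z h (t *\<^sub>R x))) (at x)"
    by (rule has_derivative_Z) (auto intro!: derivative_eq_intros)
  moreover have "((\<lambda>x. Z x (t *\<^sub>R x)) has_derivative (\<lambda>h. h)) (at x)"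
    unfolding Z_along_ray by simp
  ultimately have "(\<lambda>h. D (Z x) (t *\<^sub>R x) (t *\<^sub>R h) + Z h (t *\<^sub>R x)) = (\<lambda>h. h)"
    by (rule has_derivative_unique)
  from fun_cong[OF this, of y] show ?thesis by (simp add: eq_diff_eq)
qed

text \<open>
  With \<open>W t = t (coframe (t x) v)\<close> one has \<open>Z (W t) (t x) = t v\<close>.  Differentiating this in \<open>t\<close> produces the
  derivative of \<open>Z (W t)\<close> along the ray, which \<open>bracket_of_Z\<close> exchanges for a bracket and the derivative
  of \<open>Z x\<close>, known from \<open>D_Z_along_ray\<close>.  All terms then lie in the image of the frame at \<open>t x\<close>, which is
  injective.
\<close>

lemma coframe_ode:
  "((\<lambda>t. t *\<^sub>R coframe (t *\<^sub>R x) v) has_vector_derivative v - lie x (t *\<^sub>R coframe (t *\<^sub>R x) v)) (at t)"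
proof -
  define W where "W t = t *\<^sub>R coframe (t *\<^sub>R x) v" for t
  have ray: "((\<lambda>s. s *\<^sub>R x) has_derivative (\<lambda>h. h *\<^sub>R x)) (at t)" for t
    by (auto intro!: derivative_eq_intros)
  have "smooth (\<lambda>t. coframe (t *\<^sub>R x) v)"
    by (rule smooth_compose[OF smooth_coframe]) (intro smooth_scaleR smooth_ident smooth_const)
  then have "smooth W" unfolding W_def[abs_def] by (intro smooth_scaleR smooth_ident)
  then have W: "(W has_derivative D W t) (at t)" by (rule smooth_has_derivative)
  define W' where "W' = D W t 1"
  have "((\<lambda>s. Z (W s) (s *\<^sub>R x)) has_derivative
      (\<lambda>h. D (Z (W t)) (t *\<^sub>R x) (h *\<^sub>R x) + Z (D W t h) (t *\<^sub>R x))) (at t)"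
    by (rule has_derivative_Z[OF W ray])
  moreover have "((\<lambda>s. Z (W s) (s *\<^sub>R x)) has_derivative (\<lambda>h. h *\<^sub>R v)) (at t)"
    unfolding W_def linear_cmul[OF linear_Z] Z_coframe by (auto intro!: derivative_eq_intros)
  ultimately have "(\<lambda>h. D (Z (W t)) (t *\<^sub>R x) (h *\<^sub>R x) + Z (D W t h) (t *\<^sub>R x)) = (\<lambda>h. h *\<^sub>R v)"
    by (rule has_derivative_unique)
  from fun_cong[OF this, of 1] have 1: "D (Z (W t)) (t *\<^sub>R x) x = v - Z W' (t *\<^sub>R x)"
    by (simp add: W'_def eq_diff_eq)
  have "Z (W t) (t *\<^sub>R x) = t *\<^sub>R v" by (simp add: W_def linear_cmul[OF linear_Z] Z_coframe)
  with bracket_of_Z[of "W t" "t *\<^sub>R x" x] 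
  have "Z (lie x (W t)) (t *\<^sub>R x) = v - Z W' (t *\<^sub>R x) - (v - Z v (t *\<^sub>R x))"
    by (simp add: Z_along_ray 1 D_Z_along_ray)
  then have "Z W' (t *\<^sub>R x) = Z (v - lie x (W t)) (t *\<^sub>R x)"
    by (simp add: linear_diff[OF linear_Z] algebra_simps)
  then have "W' = v - lie x (W t)" by (metis coframe_Z)
  moreover have "D W t h = h *\<^sub>R W'" for h
    using linear_cmul[OF has_derivative_linear[OF W], of h 1] by (simp add: W'_def)
  then have "D W t = (\<lambda>h. h *\<^sub>R W')" by (rule ext)
  ultimately show ?thesis using W
    by (simp add: has_vector_derivative_def W_def[abs_def])
qed

text \<open>
  The solution \<open>W\<close> of \<open>W' = v - [x, W]\<close> with \<open>W 0 = 0\<close> and \<open>v\<close> in degree \<open>k\<close> climbs the filtration: as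
  bracketing raises the degree, \<open>W \<in> filtr j\<close> with \<open>j < k\<close> puts \<open>W'\<close>, hence \<open>W\<close>, into \<open>filtr (j + 1)\<close>.  Once
  \<open>W\<close> is in \<open>filtr k\<close>, the derivative of \<open>W t - t v\<close> is in \<open>filtr (k + 1)\<close>.
\<close>

lemma coframe_unipotent:
  assumes k: "1 \<le> k" and v: "v \<in> filtr k"
  shows "coframe x v - v \<in> filtr (k + 1)"
proof -
  define W where "W t = t *\<^sub>R coframe (t *\<^sub>R x) v" for t
  have W: "(W has_vector_derivative v - lie x (W t)) (at t)" for t
    unfolding W_def[abs_def] by (rule coframe_ode)
  have "W t \<in> filtr j" if "1 \<le> j" "j \<le> k" for j t
    using that
  proof (induction j arbitrary: t rule: nat_induct_at_least)
    case base
    show ?case unfolding filtr_1 by simp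
  next
    case (Suc j)
    have "v - lie x (W t) \<in> filtr (Suc j)" for t
      using Suc lie_filtr[of j "W t" x] filtr_antimono[of "Suc j" k] v by (intro subspace_diff[OF subspace_filtr]) auto
    then show ?case
      by (rule curve_in_subspace[OF subspace_filtr W, rotated]) (simp add: W_def subspace_0[OF subspace_filtr])
  qed
  then have lie: "lie x (W t) \<in> filtr (k + 1)" for t using k lie_filtr by simp
  have "((\<lambda>t. W t - t *\<^sub>R v) has_vector_derivative - lie x (W t)) (at t)" for t
    by (rule has_vector_derivative_eq_rhs, rule has_vector_derivative_diff[OF W])
       (auto intro!: derivative_eq_intros simp: has_vector_derivative_def)
  then have "W 1 - 1 *\<^sub>R v \<in> filtr (k + 1)"
    by (rule curve_in_subspace[OF subspace_filtr _ _ subspace_neg[OF subspace_filtr lie]])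
       (simp add: W_def subspace_0[OF subspace_filtr])
  then show ?thesis by (simp add: W_def)
qed

text \<open>
  Downward induction on the degree: \<open>Z v x - v\<close> is the image under the frame of \<open>v - coframe x v\<close>, an element of
  degree \<open>k + 1\<close>, where the frame is already known to preserve the filtration.
\<close>

lemma Z_unipotent:
  assumes "1 \<le> k" "v \<in> filtr k"
  shows "Z v x - v \<in> filtr (k + 1)"
proof (cases "k \<le> m")
  case False
  then have "filtr k \<subseteq> {0}" using filtr_antimono[of "m + 1" k] filtr_top by simp
  then have "v = 0" using assms by auto
  then show ?thesis using linear_0[OF linear_Z, of x] subspace_0[OF subspace_filtr] by simp
next
  case True
  then show ?thesis using assms
  proof (induction k arbitrary: v rule: inc_induct)
    case base
    have "coframe x v = v" using coframe_unipotent[OF base] filtr_top by simp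
    then have "Z v x = v" by (metis Z_coframe)
    then show ?case using subspace_0[OF subspace_filtr] by simp
  next
    case (step k)
    have r: "v - coframe x v \<in> filtr (Suc k)"
      using coframe_unipotent[OF step.prems, of x] subspace_neg[OF subspace_filtr] by fastforce
    then have "Z (v - coframe x v) x - (v - coframe x v) \<in> filtr (Suc k + 1)" using step by simp
    then have "Z (v - coframe x v) x - (v - coframe x v) \<in> filtr (Suc k)" using filtr_antimono[of "Suc k" "Suc k + 1"] by auto
    from subspace_add[OF subspace_filtr this r] have "Z (v - coframe x v) x \<in> filtr (Suc k)" by simp
    then show ?case by (simp add: linear_diff[OF linear_Z] Z_coframe)
  qed
qed

text \<open>
  Write \<open>y = Z w x\<close> with \<open>w\<close> of degree \<open>k\<close>.  By \<open>bracket_of_Z\<close> the derivative is \<open>Z [w, v] x\<close>, of degree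
  \<open>k + 1\<close>, plus a derivative of \<open>Z w\<close>; the latter has degree \<open>k + 1\<close> because \<open>Z w\<close> is constant modulo
  \<open>filtr (k + 1)\<close>.
\<close>

lemma D_Z_raises_filtration:
  assumes k: "1 \<le> k" and y: "y \<in> filtr k"
  shows "D (Z v) x y \<in> filtr (k + 1)"
proof -
  define w where "w = coframe x y"
  have w: "w \<in> filtr k"
    using subspace_add[OF subspace_filtr _ y] coframe_unipotent[OF k y, of x] filtr_antimono[of k "k + 1"]
    unfolding w_def by (metis diff_add_cancel le_add1 subsetD)
  have "D (Z v) x y = Z (lie w v) x + D (Z w) x (Z v x)"
    using bracket_of_Z[of v x w] by (simp add: w_def Z_coframe algebra_simps)
  moreover have "Z (lie w v) x \<in> filtr (k + 1)"
  proof -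
    have l: "lie w v \<in> filtr (k + 1)"
      using lie_antisym[of w v] lie_filtr[OF k w, of v] subspace_neg[OF subspace_filtr] by simp
    have "Z (lie w v) x - lie w v \<in> filtr (k + 1)"
      using Z_unipotent[OF _ l, of x] filtr_antimono[of "k + 1" "k + 1 + 1"] by auto
    from subspace_add[OF subspace_filtr this l] show ?thesis by simp
  qed
  moreover have "D (Z w) x (Z v x) \<in> filtr (k + 1)"
  proof -
    have "((\<lambda>x. Z w x - w) has_derivative D (Z w) x) (at x)"
      using has_derivative_diff[OF smooth_has_derivative[OF smooth_Z] has_derivative_const] by simp
    from derivative_in_subspace[OF subspace_filtr this Z_unipotent[OF k w]] show ?thesis .
  qed
  ultimately show ?thesis by (simp add: subspace_add[OF subspace_filtr])
qed

lemma stratum_projections: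
  "\<exists>\<pi>. (\<forall>v. (\<Sum>i=1..m. \<pi> i v) = v) \<and> (\<forall>i\<in>{1..m}. linear (\<pi> i) \<and>
     (\<forall>v. \<pi> i v \<in> g i \<and> (v \<in> g i \<longrightarrow> \<pi> i v = v) \<and> (v \<in> filtr (i + 1) \<longrightarrow> \<pi> i v = 0)))"
proof -
  define c where "c v = (THE f. f \<in> (\<Pi>\<^sub>E i\<in>{1..m}. g i) \<and> v = (\<Sum>i=1..m. f i))" for v
  have c: "c v \<in> (\<Pi>\<^sub>E i\<in>{1..m}. g i)" "v = (\<Sum>i=1..m. c v i)" for v
    using theI'[OF direct_sum[of v]] by (auto simp: c_def)
  have cI: "c (\<Sum>i=1..m. f i) i = f i" if "\<And>i. i \<in> {1..m} \<Longrightarrow> f i \<in> g i" "i \<in> {1..m}" for f i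
  proof -
    have "restrict f {1..m} \<in> (\<Pi>\<^sub>E i\<in>{1..m}. g i)" using that by auto
    moreover have "(\<Sum>i=1..m. f i) = (\<Sum>i=1..m. restrict f {1..m} i)" by (rule sum.cong) auto
    ultimately have "c (\<Sum>i=1..m. f i) = restrict f {1..m}"
      unfolding c_def by (intro the1_equality[OF direct_sum]) auto
    then show ?thesis using that by simp
  qed
  have mem: "c v i \<in> g i" if "i \<in> {1..m}" for v i using PiE_mem[OF c(1) that] .
  have lin: "linear (\<lambda>v. c v i)" if i: "i \<in> {1..m}" for i
  proof (rule linearI)
    fix v w :: 'a and r :: real
    have "c (\<Sum>i=1..m. c v i + c w i) i = c v i + c w i"
      by (rule cI[OF subspace_add[OF subspace_strata] i]) (use mem in auto)
    then show "c (v + w) i = c v i + c w i" using c(2)[of v] c(2)[of w] by (simp add: sum.distrib)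
    have "c (\<Sum>i=1..m. r *\<^sub>R c v i) i = r *\<^sub>R c v i"
      by (rule cI[OF subspace_scale[OF subspace_strata] i]) (use mem in auto)
    then show "c (r *\<^sub>R v) i = r *\<^sub>R c v i" using c(2)[of v] by (simp flip: scaleR_sum_right)
  qed
  have single: "c v i = (if i = j then v else 0)" if "v \<in> g j" "i \<in> {1..m}" "j \<in> {1..m}" for v i j
  proof -
    have "c (\<Sum>i=1..m. if i = j then v else 0) i = (if i = j then v else 0)"
      by (rule cI) (use that subspace_0[OF subspace_strata] in auto)
    then show ?thesis using that by (simp add: sum.delta)
  qed
  have zero: "c v i = 0" if i: "i \<in> {1..m}" and v: "v \<in> filtr (i + 1)" for i v
    using v unfolding filtr_def
  proof (induction rule: span_induct)
    case base
    show ?case using linear_subspace_linear_preimage[OF lin[OF i] subspace_single_0] by simp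
  next
    case (step v)
    then obtain j where "j \<in> {i + 1..m}" "v \<in> g j" by auto
    then show ?case using single[of v j i] i by auto
  qed
  show ?thesis
  proof (intro exI[of _ "\<lambda>i v. c v i"] conjI allI ballI impI)
    show "(\<Sum>i=1..m. c v i) = v" for v by (rule c(2)[symmetric])
    show "c v i = v" if "i \<in> {1..m}" "v \<in> g i" for i v using single[of v i i] that by simp
  qed (fact lin mem zero)+
qed

text \<open>
  With the projections \<open>\<pi> i\<close> onto the strata, \<open>tr L\<close> is the sum of \<open>tr (L \<pi>\<^sub>i) = tr (\<pi>\<^sub>i L \<pi>\<^sub>i)\<close>, and each of
  these operators is zero.
\<close>

lemma trace_eq_0_if_raises_filtration:
  assumes L: "linear L" and raise: "\<And>k v. 1 \<le> k \<Longrightarrow> v \<in> filtr k \<Longrightarrow> L v \<in> filtr (k + 1)"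
  shows "trace L = 0"
proof -
  obtain \<pi> where p: "(\<forall>v. (\<Sum>i=1..m. \<pi> i v) = v) \<and> (\<forall>i\<in>{1..m}. linear (\<pi> i) \<and>
     (\<forall>v. \<pi> i v \<in> g i \<and> (v \<in> g i \<longrightarrow> \<pi> i v = v) \<and> (v \<in> filtr (i + 1) \<longrightarrow> \<pi> i v = 0)))"
    using stratum_projections by (rule exE)
  have \<pi>: "i \<in> {1..m} \<Longrightarrow> linear (\<pi> i)" "(\<Sum>i=1..m. \<pi> i v) = v"
    "i \<in> {1..m} \<Longrightarrow> \<pi> i v \<in> g i" "i \<in> {1..m} \<Longrightarrow> v \<in> g i \<Longrightarrow> \<pi> i v = v"
    "i \<in> {1..m} \<Longrightarrow> v \<in> filtr (i + 1) \<Longrightarrow> \<pi> i v = 0" for i v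
    using p by blast+
  have "trace L = (\<Sum>b\<in>Basis. L (\<Sum>i=1..m. \<pi> i b) \<bullet> b)" unfolding \<pi>(2) trace_def ..
  also have "\<dots> = (\<Sum>i=1..m. trace (\<lambda>v. L (\<pi> i v)))"
    unfolding trace_def by (subst sum.swap) (simp add: linear_sum[OF L] inner_sum_left)
  also have "\<dots> = 0"
  proof (rule sum.neutral, rule ballI)
    fix i assume i: "i \<in> {1..m}"
    have "trace (\<lambda>v. L (\<pi> i v)) = trace (\<lambda>v. L (\<pi> i (\<pi> i v)))" using \<pi>(3,4)[OF i] by simp
    also have "\<dots> = trace (\<lambda>v. \<pi> i (L (\<pi> i v)))"
      using trace_commute[OF linear_compose[OF \<pi>(1)[OF i] L] \<pi>(1)[OF i]] by (simp add: o_def)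
    also have "\<dots> = 0"
    proof -
      have "L (\<pi> i v) \<in> filtr (i + 1)" for v
        using raise[of i "\<pi> i v"] \<pi>(3)[OF i] stratum_subset_filtr[of i i] i by auto
      then show ?thesis using \<pi>(5)[OF i] by (simp add: trace_def)
    qed
    finally show "trace (\<lambda>v. L (\<pi> i v)) = 0" .
  qed
  finally show ?thesis .
qed

theorem divergence_Z_eq_0: "(\<Sum>b\<in>Basis. D (Z v) x b \<bullet> b) = 0"
  using trace_eq_0_if_raises_filtration[OF smooth_linear_D[OF smooth_Z] D_Z_raises_filtration, of v x]
  by (simp add: trace_def)

end

section \<open>Smooth approximations of indicator functions\<close>

text \<open>
  The classical flat function \<open>exp (- 1 / t)\<close> together with the factors \<open>t\<^sup>-\<^sup>n\<close> that its derivatives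
  produce: the family is closed under differentiation up to linear combinations.
\<close>

definition flat_exp :: "nat \<Rightarrow> real \<Rightarrow> real" where
  "flat_exp n t = (if t > 0 then inverse t ^ n * exp (- inverse t) else 0)"

lemma flat_exp_tendsto_0: "(flat_exp n \<longlongrightarrow> 0) (at 0)"
proof -
  have "((\<lambda>t. inverse t ^ n / exp (inverse t)) \<longlongrightarrow> 0) (at_right (0::real))"
    by (rule filterlim_compose[OF tendsto_power_div_exp_0 filterlim_inverse_at_top_right])
  then have "(flat_exp n \<longlongrightarrow> 0) (at_right 0)"
    by (rule Lim_transform_eventually)
       (auto simp: flat_exp_def eventually_at_right_less exp_minus divide_inverse intro: eventually_mono[OF eventually_at_right_less])
  moreover have "(flat_exp n \<longlongrightarrow> 0) (at_left 0)"
    by (rule Lim_transform_eventually[OF tendsto_const])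
       (auto simp: flat_exp_def eventually_at_filter)
  ultimately show ?thesis by (simp add: filterlim_at_split)
qed

lemma has_derivative_flat_exp:
  "(flat_exp n has_real_derivative - real n * flat_exp (n + 1) t + flat_exp (n + 2) t) (at t)"
proof -
  consider "t > 0" | "t < 0" | "t = 0" by linarith
  then show ?thesis
  proof cases
    case 1
    have "((\<lambda>t. inverse t ^ n * exp (- inverse t)) has_real_derivative
        - (real n * inverse t ^ (n - Suc 0) * (inverse t)\<^sup>2) * exp (- inverse t)
          + inverse t ^ n * (inverse t)\<^sup>2 * exp (- inverse t)) (at t)"
      using 1 by (auto intro!: derivative_eq_intros simp: power2_eq_square)
    also have "real n * inverse t ^ (n - Suc 0) * (inverse t)\<^sup>2 = real n * inverse t ^ (n + 1)"
      by (cases n) (auto simp: power2_eq_square)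
    also have "inverse t ^ n * (inverse t)\<^sup>2 = inverse t ^ (n + 2)" by (simp only: power_add)
    finally have "((\<lambda>t. inverse t ^ n * exp (- inverse t)) has_real_derivative
        - real n * flat_exp (n + 1) t + flat_exp (n + 2) t) (at t)"
      using 1 by (simp add: flat_exp_def mult.assoc)
    then show ?thesis
      by (rule has_field_derivative_transform_within_open[where S = "{0<..}"])
         (use 1 in \<open>auto simp: flat_exp_def\<close>)
  next
    case 2
    have "((\<lambda>t. 0) has_real_derivative - real n * flat_exp (n + 1) t + flat_exp (n + 2) t) (at t)"
      using 2 by (simp add: flat_exp_def)
    then show ?thesis
      by (rule has_field_derivative_transform_within_open[where S = "{..<0}"])
         (use 2 in \<open>auto simp: flat_exp_def\<close>)
  next
    case 3
    have "((\<lambda>h. (flat_exp n (0 + h) - flat_exp n 0) / h) \<longlongrightarrow> 0) (at 0)"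
    proof (rule Lim_transform_eventually[OF flat_exp_tendsto_0[of "n + 1"]])
      show "\<forall>\<^sub>F x in at 0. flat_exp (n + 1) x = (flat_exp n (0 + x) - flat_exp n 0) / x"
        by (auto simp: flat_exp_def eventually_at_filter divide_inverse mult_ac intro!: always_eventually)
    qed
    then show ?thesis using 3 by (simp add: DERIV_def flat_exp_def)
  qed
qed

lemma Ck_flat_exp: "Ck k (flat_exp n)"
proof (induction k arbitrary: n)
  case 0
  then show ?case
    using has_derivative_flat_exp by (auto intro!: DERIV_isCont continuous_at_imp_continuous_on)
next
  case (Suc k)
  show ?case
  proof (rule Ck_SucI)
    show "(flat_exp n has_derivative (\<lambda>v. v *\<^sub>R ((- real n) *\<^sub>R flat_exp (n + 1) t + flat_exp (n + 2) t))) (at t)" for t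
      using has_derivative_flat_exp[of n t] by (simp add: has_field_derivative_def mult.commute[of _ "_ + _"] mult_commute_abs)
    show "Ck k (\<lambda>t. v *\<^sub>R ((- real n) *\<^sub>R flat_exp (n + 1) t + flat_exp (n + 2) t))" for v
      by (intro Ck_bilinear[OF bounded_bilinear_scaleR] Ck_add Ck_const Suc)
  qed
qed

lemma Ck_inverse:
  fixes f :: "'a::euclidean_space \<Rightarrow> real"
  assumes "\<And>x. f x \<noteq> 0"
  shows "Ck k f \<Longrightarrow> Ck k (\<lambda>x. inverse (f x))"
proof (induction k)
  case 0
  then show ?case using assms by (auto intro!: continuous_on_inverse)
next
  case (Suc k)
  have f: "Ck k f" by (rule Ck_Suc_imp_Ck) (rule Suc.prems)
  show ?case
  proof (rule Ck_SucI)
    show "((\<lambda>x. inverse (f x)) has_derivative (\<lambda>v. (- 1) * (inverse (f x) * D f x v * inverse (f x)))) (at x)" for x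
      using Deriv.has_derivative_inverse[OF assms Ck_has_derivative[OF Suc.prems]] by simp
    show "Ck k (\<lambda>x. (- 1) * (inverse (f x) * D f x v * inverse (f x)))" for v
      by (intro Ck_bilinear[OF bounded_bilinear_mult] Ck_const Suc.IH f) (use Suc.prems in simp)
  qed
qed

definition smooth_step :: "real \<Rightarrow> real" where
  "smooth_step t = flat_exp 0 t * inverse (flat_exp 0 t + flat_exp 0 (1 - t))"

lemma smooth_step_denominator_pos: "flat_exp 0 t + flat_exp 0 (1 - t) > 0"
  by (auto simp: flat_exp_def add_pos_nonneg add_nonneg_pos)

lemma smooth_smooth_step: "smooth smooth_step"
proof -
  have e: "smooth (flat_exp 0)" by (simp add: smooth_def Ck_flat_exp)
  have d: "smooth (\<lambda>t. flat_exp 0 t + flat_exp 0 (1 - t))"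
    by (intro smooth_add e smooth_compose[OF e] smooth_diff smooth_const smooth_ident)
  have "smooth (\<lambda>t. inverse (flat_exp 0 t + flat_exp 0 (1 - t)))"
    using d smooth_step_denominator_pos unfolding smooth_def
    by (intro allI Ck_inverse) (auto simp: less_imp_neq[symmetric])
  with e show ?thesis unfolding smooth_step_def[abs_def] by (intro smooth_mult)
qed

lemma smooth_step_bounds: "0 \<le> smooth_step t" "smooth_step t \<le> 1"
  using smooth_step_denominator_pos[of t]
  by (auto simp: smooth_step_def flat_exp_def field_simps)

lemma smooth_step_eq_0: "t \<le> 0 \<Longrightarrow> smooth_step t = 0"
  by (simp add: smooth_step_def flat_exp_def)

lemma smooth_step_eq_1: "t \<ge> 1 \<Longrightarrow> smooth_step t = 1"
  by (simp add: smooth_step_def flat_exp_def)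

text \<open>
  The argument of the step function is the affine function of \<open>|y - x|\<^sup>2\<close> that equals \<open>1\<close> at distance \<open>r\<close> and
  \<open>0\<close> at distance \<open>2 r\<close>.
\<close>

lemma smooth_ball_cutoff:
  fixes x :: "'a::euclidean_space"
  assumes r: "r > 0"
  shows "\<exists>\<psi> :: 'a \<Rightarrow> real. smooth \<psi> \<and> (\<forall>y. 0 \<le> \<psi> y \<and> \<psi> y \<le> 1) \<and> (\<forall>y\<in>ball x r. \<psi> y = 1) \<and> (\<forall>y. y \<notin> ball x (2 * r) \<longrightarrow> \<psi> y = 0)"
proof (intro exI[of _ "\<lambda>y. smooth_step (4 / 3 - inverse (3 * r\<^sup>2) * ((y - x) \<bullet> (y - x)))"] conjI allI ballI impI)
  show "smooth (\<lambda>y. smooth_step (4 / 3 - inverse (3 * r\<^sup>2) * ((y - x) \<bullet> (y - x))))"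
    by (intro smooth_compose[OF smooth_smooth_step] smooth_diff smooth_mult smooth_inner smooth_const smooth_ident)
  fix y
  have sq: "(y - x) \<bullet> (y - x) = (dist x y)\<^sup>2" by (simp add: dist_norm power2_norm_eq_inner inner_diff inner_commute algebra_simps)
  {
    assume "y \<in> ball x r"
    then have "(dist x y)\<^sup>2 \<le> r\<^sup>2" by (intro power_mono) auto
    then show "smooth_step (4 / 3 - inverse (3 * r\<^sup>2) * ((y - x) \<bullet> (y - x))) = 1"
      unfolding sq using r by (intro smooth_step_eq_1) (simp add: field_simps)
  next
    assume "y \<notin> ball x (2 * r)"
    then have "(2 * r)\<^sup>2 \<le> (dist x y)\<^sup>2" using r by (intro power_mono) auto
    then show "smooth_step (4 / 3 - inverse (3 * r\<^sup>2) * ((y - x) \<bullet> (y - x))) = 0"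
      unfolding sq using r by (intro smooth_step_eq_0) (simp add: field_simps)
  }
qed (auto simp: smooth_step_bounds)

lemma smooth_prod:
  fixes f :: "'i \<Rightarrow> 'a::euclidean_space \<Rightarrow> real"
  shows "(\<And>i. i \<in> I \<Longrightarrow> smooth (f i)) \<Longrightarrow> smooth (\<lambda>x. \<Prod>i\<in>I. f i x)"
  by (induction I rule: infinite_finite_induct) (auto intro: smooth_mult smooth_const)

lemma spt_subset_closed: "(\<And>y. u y \<noteq> 0 \<Longrightarrow> y \<in> S) \<Longrightarrow> closed S \<Longrightarrow> spt u \<subseteq> S"
  unfolding spt_def by (rule closure_minimal) auto

lemma not_in_spt: "x \<notin> spt u \<Longrightarrow> u x = 0"
  using closure_subset[of "{y. u y \<noteq> 0}"] by (auto simp: spt_def)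

lemma smooth_cutoff:
  fixes C U :: "'a::euclidean_space set"
  assumes C: "compact C" and U: "open U" and CU: "C \<subseteq> U"
  obtains \<psi> where "test_fun U \<psi>" "\<And>y. 0 \<le> \<psi> y" "\<And>y. \<psi> y \<le> 1" "\<And>y. y \<in> C \<Longrightarrow> \<psi> y = 1"
proof -
  obtain \<epsilon> where e: "\<epsilon> > 0" "(\<Union>x\<in>C. cball x \<epsilon>) \<subseteq> U"
    using compact_subset_open_imp_cball_epsilon_subset[OF assms] .
  have "\<exists>\<psi>. smooth \<psi> \<and> (\<forall>y. 0 \<le> \<psi> y \<and> \<psi> y \<le> 1) \<and> (\<forall>y\<in>ball x (\<epsilon>/2). \<psi> y = 1) \<and>
      (\<forall>y. y \<notin> ball x \<epsilon> \<longrightarrow> \<psi> y = (0::real))" for x :: 'a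
    using smooth_ball_cutoff[of "\<epsilon>/2" x] e by simp
  then obtain \<eta> :: "'a \<Rightarrow> 'a \<Rightarrow> real" where eta: "\<And>x. smooth (\<eta> x)" "\<And>x y. 0 \<le> \<eta> x y" "\<And>x y. \<eta> x y \<le> 1"
     "\<And>x y. y \<in> ball x (\<epsilon>/2) \<Longrightarrow> \<eta> x y = 1" "\<And>x y. y \<notin> ball x \<epsilon> \<Longrightarrow> \<eta> x y = 0"
    by metis
  obtain I where I: "I \<subseteq> C" "finite I" "C \<subseteq> (\<Union>x\<in>I. ball x (\<epsilon>/2))"
    using compactE_image[OF C, of C "\<lambda>x. ball x (\<epsilon>/2)"] e(1) by force
  \<comment> \<open>equals \<open>1\<close> as soon as one factor vanishes, and \<open>0\<close> where all cutoffs vanish\<close>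
  define \<psi> where "\<psi> y = 1 - (\<Prod>x\<in>I. 1 - \<eta> x y)" for y
  have sm: "smooth \<psi>"
    unfolding \<psi>_def[abs_def] by (intro smooth_diff smooth_const smooth_prod eta)
  have nz: "y \<in> (\<Union>x\<in>I. cball x \<epsilon>)" if "\<psi> y \<noteq> 0" for y
  proof (rule ccontr)
    assume "y \<notin> (\<Union>x\<in>I. cball x \<epsilon>)"
    then have "\<eta> x y = 0" if "x \<in> I" for x using eta(5)[of y x] that by fastforce
    then show False using that by (simp add: \<psi>_def)
  qed
  have K: "compact (\<Union>x\<in>I. cball x \<epsilon>)" using I by (intro compact_UN) auto
  have spt: "spt \<psi> \<subseteq> (\<Union>x\<in>I. cball x \<epsilon>)" using nz compact_imp_closed[OF K] by (rule spt_subset_closed)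
  then have "compact (spt \<psi>)"
    using compact_Int_closed[OF K, of "spt \<psi>"] by (simp add: spt_def Int_absorb1)
  moreover have "spt \<psi> \<subseteq> U" using spt e I by blast
  ultimately have "test_fun U \<psi>" using sm by (simp add: test_fun_def)
  moreover have "0 \<le> \<psi> y" for y
    using prod_le_1[of I "\<lambda>x. 1 - \<eta> x y"] eta by (simp add: \<psi>_def)
  moreover have "\<psi> y \<le> 1" for y
    using prod_nonneg[of I "\<lambda>x. 1 - \<eta> x y"] eta by (simp add: \<psi>_def)
  moreover have "\<psi> y = 1" if y: "y \<in> C" for y
  proof -
    obtain x where "x \<in> I" "y \<in> ball x (\<epsilon>/2)" using I y by blast
    then have "(\<Prod>x\<in>I. 1 - \<eta> x y) = 0" using eta(4)[of y x] I by (intro prod_zero) auto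
    then show ?thesis by (simp add: \<psi>_def)
  qed
  ultimately show ?thesis by (rule that)
qed

lemma compact_exhaustion:
  fixes U :: "'a::euclidean_space set"
  assumes U: "open U"
  shows "\<exists>C :: nat \<Rightarrow> 'a set. (\<forall>k. compact (C k)) \<and> (\<forall>k. C k \<subseteq> U) \<and> \<Union>(range C) = U
    \<and> (\<forall>k l. k \<le> l \<longrightarrow> C k \<subseteq> C l)"
proof -
  obtain C :: "nat \<Rightarrow> 'a set"
    where C: "\<And>k. compact (C k)" "\<And>k. C k \<subseteq> U" "\<And>k. C k \<subseteq> interior (C (Suc k))" "\<Union>(range C) = U"
    using open_Union_compact_subsets[OF U] by metis
  have "C k \<subseteq> C l" if "k \<le> l" for k l
    by (rule lift_Suc_mono_le[of C, OF order_trans[OF C(3) interior_subset] that])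
  with C show ?thesis by (intro exI[of _ C]) simp
qed

lemma indicator_limit_of_test_fun:
  fixes U :: "'a::euclidean_space set"
  assumes U: "open U"
  obtains \<psi> where "\<And>k::nat. test_fun U (\<psi> k)" "\<And>k y. 0 \<le> \<psi> k y" "\<And>k y. \<psi> k y \<le> 1"
    "\<And>y. (\<lambda>k. \<psi> k y) \<longlonglongrightarrow> indicator U y"
proof -
  obtain C :: "nat \<Rightarrow> 'a set" where C: "\<And>k. compact (C k)" "\<And>k. C k \<subseteq> U" "\<Union>(range C) = U"
    and mono: "\<And>k l. k \<le> l \<Longrightarrow> C k \<subseteq> C l"
    using compact_exhaustion[OF U] by metis
  have "\<exists>\<psi>. test_fun U \<psi> \<and> (\<forall>y. 0 \<le> \<psi> y \<and> \<psi> y \<le> 1) \<and> (\<forall>y\<in>C k. \<psi> y = 1)" for k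
    using smooth_cutoff[OF C(1) U C(2)[of k]] by metis
  then obtain \<psi> where psi: "\<And>k. test_fun U (\<psi> k)" "\<And>k y. 0 \<le> \<psi> k y" "\<And>k y. \<psi> k y \<le> 1" "\<And>k y. y \<in> C k \<Longrightarrow> \<psi> k y = 1"
    by metis
  have "(\<lambda>k. \<psi> k y) \<longlonglongrightarrow> indicator U y" for y
  proof (cases "y \<in> U")
    case True
    then obtain l where "y \<in> C l" using C(3) by blast
    then have "\<psi> k y = 1" if "k \<ge> l" for k using mono[OF that] psi(4) by blast
    then have "\<forall>\<^sub>F k in sequentially. \<psi> k y = 1" by (auto simp: eventually_sequentially)
    then show ?thesis using True by (simp add: tendsto_eventually)
  next
    case False
    then have "\<psi> k y = 0" for k using psi(1)[of k] by (intro not_in_spt) (auto simp: test_fun_def)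
    then show ?thesis using False by simp
  qed
  with psi(1-3) show ?thesis by (rule that[of \<psi>])
qed

section \<open>Measure-preserving flows\<close>

lemma continuous_borel_lebesgue:
  fixes g :: "'a::euclidean_space \<Rightarrow> 'b::euclidean_space"
  assumes "continuous_on UNIV g" shows "g \<in> borel_measurable lebesgue"
  by (rule measurable_completion) (simp add: borel_measurable_continuous_onI assms)

lemma set_integrable_mult_continuous:
  fixes f g :: "'a::euclidean_space \<Rightarrow> real"
  assumes K: "compact K" and f: "set_integrable lebesgue K f" and g: "continuous_on UNIV g"
  shows "set_integrable lebesgue K (\<lambda>x. f x * g x)"
proof -
  obtain C where C: "\<And>x. x \<in> K \<Longrightarrow> norm (g x) \<le> C"
    using compact_imp_bounded[OF compact_continuous_image[OF continuous_on_subset[OF g] K]]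
    by (auto simp: bounded_iff)
  have "integrable lebesgue (\<lambda>x. (indicator K x *\<^sub>R f x) * g x)"
  proof (rule Bochner_Integration.integrable_bound)
    show "integrable lebesgue (\<lambda>x. C * (indicator K x *\<^sub>R f x))"
      using f by (auto simp: set_integrable_def)
    show "(\<lambda>x. (indicator K x *\<^sub>R f x) * g x) \<in> borel_measurable lebesgue"
      using f continuous_borel_lebesgue[OF g] unfolding set_integrable_def
      by (intro borel_measurable_times) auto
    show "AE x in lebesgue. norm ((indicator K x *\<^sub>R f x) * g x) \<le> norm (C * (indicator K x *\<^sub>R f x))"
    proof (rule AE_I2)
      fix x
      show "norm ((indicator K x *\<^sub>R f x) * g x) \<le> norm (C * (indicator K x *\<^sub>R f x))"
      proof (cases "x \<in> K")
        case True
        then have "\<bar>g x\<bar> \<le> \<bar>C\<bar>" using C[of x] by auto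
        then show ?thesis using True by (simp add: abs_mult mult.commute[of "\<bar>f x\<bar>"] mult_right_mono)
      qed simp
    qed
  qed
  then show ?thesis by (simp add: set_integrable_def mult.assoc)
qed

lemma set_integral_eq_if_vanishes:
  fixes g :: "'a::euclidean_space \<Rightarrow> real"
  assumes "\<And>x. x \<in> S - T \<Longrightarrow> g x = 0" "\<And>x. x \<in> T - S \<Longrightarrow> g x = 0"
  shows "(LINT x:S|lebesgue. g x) = (LINT x:T|lebesgue. g x)"
  unfolding set_lebesgue_integral_def
  by (rule Bochner_Integration.integral_cong) (use assms in \<open>auto simp: indicator_def\<close>)

lemma set_integrable_const_compact:
  fixes K :: "'a::euclidean_space set"
  assumes "compact K"
  shows "set_integrable lebesgue K (\<lambda>x. 1 :: real)"
proof -
  have "integrable lebesgue (indicator K :: 'a \<Rightarrow> real)"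
    by (rule integrable_real_indicator) (use lmeasurable_compact[OF assms] in \<open>auto simp: fmeasurable_def\<close>)
  then show ?thesis by (simp add: set_integrable_def)
qed

lemma integrable_compact_support:
  fixes g :: "'a::euclidean_space \<Rightarrow> real"
  assumes K: "compact K" and g: "continuous_on UNIV g" and 0: "\<And>x. x \<notin> K \<Longrightarrow> g x = 0"
  shows "integrable lebesgue g"
proof -
  from set_integrable_mult_continuous[OF K set_integrable_const_compact[OF K] g] have "integrable lebesgue (\<lambda>x. indicator K x *\<^sub>R g x)"
    by (simp add: set_integrable_def)
  moreover have "(\<lambda>x. indicator K x *\<^sub>R g x) = g" using 0 by (auto simp: indicator_def fun_eq_iff)
  ultimately show ?thesis by simp
qed

text \<open>
  Differentiation under the integral sign with a merely integrable weight \<open>f\<close>: the difference quotients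
  of \<open>h\<close> are bounded on the compact set by the mean value theorem, so dominated convergence applies.
\<close>

lemma set_integral_has_real_derivative:
  fixes f :: "'a::euclidean_space \<Rightarrow> real" and h h' :: "real \<Rightarrow> 'a \<Rightarrow> real"
  assumes K: "compact K" and f: "set_integrable lebesgue K f"
    and h: "\<And>t x. ((\<lambda>t. h t x) has_real_derivative h' t x) (at t)"
    and hc: "\<And>t. continuous_on UNIV (h t)" and h'c: "continuous_on UNIV (\<lambda>(t, x). h' t x)"
  shows "((\<lambda>t. LINT x:K|lebesgue. f x * h t x) has_real_derivative (LINT x:K|lebesgue. f x * h' t x)) (at t)"
  unfolding DERIV_def tendsto_at_iff_sequentially o_def
proof (intro allI impI)
  fix X :: "nat \<Rightarrow> real" assume X: "\<forall>i. X i \<in> UNIV - {0}" "X \<longlonglongrightarrow> 0"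
  obtain R where R: "\<And>i. norm (X i) \<le> R"
    using X(2) Bseq_def convergent_imp_Bseq convergent_def by metis
  have "compact ((\<lambda>(t, x). h' t x) ` ({t - R..t + R} \<times> K))"
    by (intro compact_continuous_image continuous_on_subset[OF h'c] compact_Times K) auto
  then obtain C where "\<forall>y\<in>(\<lambda>(t, x). h' t x) ` ({t - R..t + R} \<times> K). norm y \<le> C"
    using compact_imp_bounded bounded_iff by blast
  then have C: "\<bar>h' s x\<bar> \<le> C" if "s \<in> {t - R..t + R}" "x \<in> K" for s x
    using that by force
  define q where "q i x = (h (t + X i) x - h t x) / X i" for i x
  have qc: "continuous_on UNIV (q i)" for i
    unfolding q_def[abs_def] using X(1) by (intro continuous_intros hc) auto
  have h'ct: "continuous_on UNIV (h' t)"
    using continuous_on_compose2[OF h'c, of UNIV "\<lambda>x. (t, x)"] by (simp add: continuous_on_Pair)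
  have int_h: "integrable lebesgue (\<lambda>x. indicator K x *\<^sub>R (f x * h s x))" for s
    using set_integrable_mult_continuous[OF K f hc] by (simp add: set_integrable_def)
  have "((LINT x:K|lebesgue. f x * h (t + X i) x) - (LINT x:K|lebesgue. f x * h t x)) / X i
      = (LINT x:K|lebesgue. f x * q i x)" for i
  proof -
    have "(LINT x:K|lebesgue. f x * q i x) = (LINT x|lebesgue. (indicator K x *\<^sub>R (f x * h (t + X i) x) - indicator K x *\<^sub>R (f x * h t x)) / X i)"
      unfolding set_lebesgue_integral_def
      by (rule Bochner_Integration.integral_cong) (auto simp: q_def algebra_simps diff_divide_distrib)
    then show ?thesis
      using Bochner_Integration.integral_diff[OF int_h[of "t + X i"] int_h[of t]]
      by (simp add: set_lebesgue_integral_def)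
  qed
  moreover have "(\<lambda>i. LINT x:K|lebesgue. f x * q i x) \<longlonglongrightarrow> (LINT x:K|lebesgue. f x * h' t x)"
    unfolding set_lebesgue_integral_def
  proof (rule integral_dominated_convergence[where w = "\<lambda>x. C * \<bar>indicator K x *\<^sub>R f x\<bar>"])
    show "integrable lebesgue (\<lambda>x. C * \<bar>indicator K x *\<^sub>R f x\<bar>)"
      using f unfolding set_integrable_def by auto
    show "(\<lambda>x. indicator K x *\<^sub>R (f x * h' t x)) \<in> borel_measurable lebesgue"
      "(\<lambda>x. indicator K x *\<^sub>R (f x * q i x)) \<in> borel_measurable lebesgue" for i
      using set_integrable_mult_continuous[OF K f h'ct] set_integrable_mult_continuous[OF K f qc]
      by (auto simp: set_integrable_def)
    show "AE x in lebesgue. (\<lambda>i. indicator K x *\<^sub>R (f x * q i x)) \<longlonglongrightarrow> indicator K x *\<^sub>R (f x * h' t x)"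
    proof (rule AE_I2, intro tendsto_intros)
      show "(\<lambda>i. q i x) \<longlonglongrightarrow> h' t x" for x
        using h[of x t] X unfolding DERIV_def tendsto_at_iff_sequentially o_def q_def by blast
    qed
    show "AE x in lebesgue. norm (indicator K x *\<^sub>R (f x * q i x)) \<le> C * \<bar>indicator K x *\<^sub>R f x\<bar>" for i
    proof (rule AE_I2)
      fix x
      show "norm (indicator K x *\<^sub>R (f x * q i x)) \<le> C * \<bar>indicator K x *\<^sub>R f x\<bar>"
      proof (cases "x \<in> K")
        case True
        have "norm (h (t + X i) x - h t x) \<le> C * norm (t + X i - t)"
          by (rule field_differentiable_bound[of "{t - R..t + R}" "\<lambda>t. h t x" "\<lambda>t. h' t x"])
             (use h C True R[of i] in \<open>auto intro: has_field_derivative_at_within simp: abs_le_iff\<close>)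
        then have "\<bar>q i x\<bar> \<le> C" using X(1) by (simp add: q_def field_simps)
        from mult_left_mono[OF this, of "\<bar>f x\<bar>"] show ?thesis
          using True by (simp add: abs_mult mult.commute)
      qed simp
    qed
  qed
  ultimately show "(\<lambda>i. ((LINT x:K|lebesgue. f x * h (t + X i) x) - (LINT x:K|lebesgue. f x * h t x)) / X i)
      \<longlonglongrightarrow> (LINT x:K|lebesgue. f x * h' t x)" by simp
qed

lemma D_zero_off_spt:
  fixes h :: "'a::euclidean_space \<Rightarrow> real"
  assumes "x \<notin> spt h"
  shows "D h x v = 0"
proof -
  have "open (- spt h)" by (simp add: spt_def open_Compl)
  then have "(h has_derivative (\<lambda>v. 0)) (at x)"
    using assms
    by (intro has_derivative_transform_within_open[OF has_derivative_const[of 0] \<open>open (- spt h)\<close>])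
       (auto simp: not_in_spt)
  then show ?thesis by (simp add: D_eqI)
qed

lemma lebesgue_integral_translation:
  fixes h :: "'a::euclidean_space \<Rightarrow> real"
  assumes h: "continuous_on UNIV h"
  shows "(LINT x|lebesgue. h (x + c)) = (LINT x|lebesgue. h x)"
proof -
  have m: "h \<in> borel_measurable borel" by (rule borel_measurable_continuous_onI[OF h])
  have "(LINT x|lborel. h x) = (LINT x|distr lborel borel ((+) c). h x)" by (simp add: lborel_distr_plus)
  also have "\<dots> = (LINT x|lborel. h (c + x))" by (rule integral_distr) (auto intro: m)
  finally show ?thesis using m by (simp add: integral_completion add.commute)
qed

text \<open>
  The integral of a translate of \<open>h\<close> does not depend on the translation; differentiate it.
\<close>

lemma integral_D_test_fun:
  fixes h :: "'a::euclidean_space \<Rightarrow> real"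
  assumes h: "smooth h" and K: "compact (spt h)"
  shows "(LINT x|lebesgue. D h x b) = 0"
proof -
  let ?K = "(\<lambda>(t, y). y - t *\<^sub>R b) ` ({-1..1} \<times> spt h)"
  have K': "compact ?K"
    by (intro compact_continuous_image compact_Times K compact_Icc)
       (auto intro!: continuous_intros simp: split_beta)
  have off: "h (x + t *\<^sub>R b) = 0" if "t \<in> {-1..1}" "x \<notin> ?K" for t x
  proof (rule ccontr)
    assume "h (x + t *\<^sub>R b) \<noteq> 0"
    then have "(t, x + t *\<^sub>R b) \<in> {-1..1} \<times> spt h" using that not_in_spt by blast
    then have "x \<in> ?K" by (force intro!: image_eqI[of _ _ "(t, x + t *\<^sub>R b)"])
    then show False using that by simp
  qed
  have "((\<lambda>t. LINT x:?K|lebesgue. 1 * h (x + t *\<^sub>R b)) has_real_derivative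
      (LINT x:?K|lebesgue. 1 * D h (x + 0 *\<^sub>R b) b)) (at 0)"
  proof (rule set_integral_has_real_derivative[OF K' set_integrable_const_compact[OF K']])
    show "((\<lambda>t. h (x + t *\<^sub>R b)) has_real_derivative D h (x + t *\<^sub>R b) b) (at t)" for t x
      by (rule has_real_derivative_on_line[OF h])
    show "continuous_on UNIV (\<lambda>x. h (x + t *\<^sub>R b))" for t
      by (rule continuous_on_compose2[OF smooth_continuous[OF h, of UNIV]]) (auto intro!: continuous_intros)
    show "continuous_on UNIV (\<lambda>(t, x). D h (x + t *\<^sub>R b) b)"
      unfolding split_beta
      by (rule continuous_on_compose2[OF smooth_continuous[OF smooth_D[OF h], of UNIV]]) (auto intro!: continuous_intros)
  qed
  moreover have "((\<lambda>t. LINT x:?K|lebesgue. 1 * h (x + t *\<^sub>R b)) has_real_derivative 0) (at 0)"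
  proof (rule has_field_derivative_transform_within_open[OF DERIV_const, where S = "{-1<..<1}"])
    fix t :: real assume t: "t \<in> {-1<..<1}"
    have "(LINT x:?K|lebesgue. 1 * h (x + t *\<^sub>R b)) = (LINT x:UNIV|lebesgue. 1 * h (x + t *\<^sub>R b))"
      by (rule set_integral_eq_if_vanishes) (use t off[of t] in auto)
    then show "(LINT x|lebesgue. h x) = (LINT x:?K|lebesgue. 1 * h (x + t *\<^sub>R b))"
      by (simp add: set_lebesgue_integral_def lebesgue_integral_translation[OF smooth_continuous[OF h]])
  qed auto
  ultimately have "(LINT x:?K|lebesgue. D h x b) = 0"
    using DERIV_unique by fastforce
  moreover have "(LINT x:?K|lebesgue. D h x b) = (LINT x:UNIV|lebesgue. D h x b)"
  proof (rule set_integral_eq_if_vanishes)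
    show "D h x b = 0" if x: "x \<in> UNIV - ?K" for x
    proof (rule D_zero_off_spt, rule notI)
      assume "x \<in> spt h"
      then have "x \<in> ?K" by (force intro!: image_eqI[of _ _ "(0, x)"])
      then show False using x by simp
    qed
  qed auto
  ultimately show ?thesis by (simp add: set_lebesgue_integral_def)
qed

lemma smooth_vf_apply: "smooth X \<Longrightarrow> smooth f \<Longrightarrow> smooth (\<lambda>x. vf_apply X f x)"
  unfolding vf_apply_def by (intro smooth_D_along smooth_ident)

context carnot_group
begin

subsection \<open>Flows of left-invariant fields\<close>

text \<open>
  Integration by parts: \<open>Z \<psi>\<close> is the divergence of \<open>\<psi> Z\<close> minus \<open>\<psi>\<close> times the divergence of \<open>Z\<close>, which is zero.
\<close>

lemma integral_Z_test_fun:
  fixes \<psi> :: "'a \<Rightarrow> real"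
  assumes s: "smooth \<psi>" and K: "compact (spt \<psi>)"
  shows "(LINT x|lebesgue. vf_apply (Z v) \<psi> x) = 0"
proof -
  let ?h = "\<lambda>b x. \<psi> x * (Z v x \<bullet> b)"
  have sh: "smooth (?h b)" for b by (intro smooth_mult smooth_inner s smooth_Z smooth_const)
  have spth: "spt (?h b) \<subseteq> spt \<psi>" for b
    by (rule spt_subset_closed) (auto simp: spt_def intro: closure_subset[THEN subsetD])
  have Kh: "compact (spt (?h b))" for b
    using compact_Int_closed[OF K, of "spt (?h b)"] spth[of b] by (simp add: spt_def Int_absorb1)
  have Dh: "D (?h b) x b = D \<psi> x b * (Z v x \<bullet> b) + \<psi> x * (D (Z v) x b \<bullet> b)" for b x
  proof -
    have "(?h b has_derivative (\<lambda>u. \<psi> x * (D (Z v) x u \<bullet> b) + D \<psi> x u * (Z v x \<bullet> b))) (at x)"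
      by (intro has_derivative_mult smooth_has_derivative[OF s] has_derivative_inner_left smooth_has_derivative[OF smooth_Z])
    then show ?thesis by (simp add: D_eqI)
  qed
  have "vf_apply (Z v) \<psi> x = (\<Sum>b\<in>Basis. D (?h b) x b)" for x
  proof -
    have "(\<Sum>b\<in>Basis. D (?h b) x b) = (\<Sum>b\<in>Basis. (Z v x \<bullet> b) *\<^sub>R D \<psi> x b) + \<psi> x * (\<Sum>b\<in>Basis. D (Z v) x b \<bullet> b)"
      unfolding Dh by (simp add: sum.distrib sum_distrib_left mult.commute)
    then show ?thesis
      using divergence_Z_eq_0[of v x] D_expand_basis[OF smooth_imp_Ck[OF s], of x "Z v x"]
      by (simp add: vf_apply_def)
  qed
  moreover have "integrable lebesgue (\<lambda>x. D (?h b) x b)" for b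
    by (rule integrable_compact_support[OF Kh smooth_continuous[OF smooth_D[OF sh]] D_zero_off_spt])
  ultimately show ?thesis
    by (simp add: Bochner_Integration.integral_sum integral_D_test_fun[OF sh Kh])
qed

text \<open>
  Left-invariant fields generate right translations.  Comments write \<open>R\<^sub>t\<close> for \<open>flow v t\<close>.
\<close>

definition flow :: "'a \<Rightarrow> real \<Rightarrow> 'a \<Rightarrow> 'a" where "flow v t x = mul x (t *\<^sub>R v)"

lemma flow_0 [simp]: "flow v 0 x = x"
  by (simp add: flow_def)

lemma flow_flow [simp]: "flow v s (flow v t x) = flow v (t + s) x"
  by (simp add: flow_def assoc exp_coords)

lemma smooth_flow: "smooth (flow v t)"
  unfolding flow_def[abs_def] by (intro smooth_mul_compose smooth_ident smooth_const)

lemma continuous_flow: "continuous_on S (\<lambda>(t, x). flow v t x)"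
proof -
  have "smooth (\<lambda>p :: real \<times> 'a. mul (snd p) (fst p *\<^sub>R v))"
    by (intro smooth_mul_compose smooth_scaleR smooth_const smooth_linear linear_fst linear_snd)
  then show ?thesis unfolding flow_def split_beta by (rule smooth_continuous)
qed

lemma flow_has_derivative:
  "((\<lambda>t. flow v t x) has_derivative (\<lambda>h. h *\<^sub>R Z v (flow v t x))) (at t)"
proof -
  have "((\<lambda>s. s *\<^sub>R v) has_derivative (\<lambda>h. h *\<^sub>R v)) (at t)" by (auto intro!: derivative_eq_intros)
  from has_derivative_compose[OF this smooth_has_derivative[OF smooth_left_translation]]
  have "((\<lambda>s. mul x (s *\<^sub>R v)) has_derivative (\<lambda>h. D (mul x) (t *\<^sub>R v) (h *\<^sub>R v))) (at t)" .
  moreover have "D (mul x) (t *\<^sub>R v) v = Z v (mul x (t *\<^sub>R v))"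
    by (simp add: Z_left_invariant Z_along_ray)
  ultimately show ?thesis
    by (simp add: flow_def linear_cmul[OF smooth_linear_D[OF smooth_left_translation]])
qed

text \<open>
  A field is invariant under its own flow.  Hence \<open>Z\<close> commutes with composition by the flow, which is what
  lets a derivative in time be shifted onto a test function.
\<close>

lemma D_flow_Z: "D (flow v t) x (Z v x) = Z v (flow v t x)"
proof -
  have "((\<lambda>s. flow v t (flow v s x)) has_derivative (\<lambda>h. D (flow v t) (flow v 0 x) (h *\<^sub>R Z v (flow v 0 x)))) (at 0)"
    by (rule has_derivative_compose[OF flow_has_derivative smooth_has_derivative[OF smooth_flow]])
  moreover have "((\<lambda>s. flow v t (flow v s x)) has_derivative (\<lambda>h. h *\<^sub>R Z v (flow v t x))) (at 0)"
  proof -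
    have "((\<lambda>s. s + t) has_derivative (\<lambda>h. h)) (at 0)" by (auto intro!: derivative_eq_intros)
    from has_derivative_compose[OF this flow_has_derivative]
    show ?thesis by simp
  qed
  ultimately have "(\<lambda>h. D (flow v t) (flow v 0 x) (h *\<^sub>R Z v (flow v 0 x))) = (\<lambda>h. h *\<^sub>R Z v (flow v t x))"
    by (rule has_derivative_unique)
  from fun_cong[OF this, of 1] show ?thesis by simp
qed

lemma vf_apply_flow:
  fixes \<psi> :: "'a \<Rightarrow> real"
  assumes "smooth \<psi>"
  shows "vf_apply (Z v) (\<lambda>x. \<psi> (flow v t x)) x = vf_apply (Z v) \<psi> (flow v t x)"
  by (simp add: vf_apply_def D_compose[OF assms smooth_flow] D_flow_Z)

lemma flow_orbit_derivative:
  fixes \<psi> :: "'a \<Rightarrow> real"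
  assumes "smooth \<psi>"
  shows "((\<lambda>t. \<psi> (flow v t x)) has_real_derivative vf_apply (Z v) \<psi> (flow v t x)) (at t)"
proof -
  have "((\<lambda>t. \<psi> (flow v t x)) has_derivative (\<lambda>h. D \<psi> (flow v t x) (h *\<^sub>R Z v (flow v t x)))) (at t)"
    by (rule has_derivative_compose[OF flow_has_derivative smooth_has_derivative[OF assms]])
  moreover have "(\<lambda>h. D \<psi> (flow v t x) (h *\<^sub>R Z v (flow v t x))) = (*) (vf_apply (Z v) \<psi> (flow v t x))"
    by (simp add: fun_eq_iff vf_apply_def linear_cmul[OF smooth_linear_D[OF assms]])
  ultimately show ?thesis by (simp add: has_field_derivative_def)
qed

lemma flow_vimage: "flow v t -` S = flow v (- t) ` S"
  by (auto intro!: image_eqI[of _ _ "flow v t x" for x])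

lemma compact_flow_vimage: "compact S \<Longrightarrow> compact (flow v t -` S)"
  unfolding flow_vimage by (intro compact_continuous_image smooth_continuous smooth_flow)

lemma open_flow_vimage: "open S \<Longrightarrow> open (flow v t -` S)"
  by (intro open_vimage smooth_continuous smooth_flow)

lemma spt_flow_subset: "spt (\<lambda>x. \<psi> (flow v t x)) \<subseteq> flow v t -` spt \<psi>"
proof (rule spt_subset_closed)
  show "closed (flow v t -` spt \<psi>)"
    by (intro closed_vimage smooth_continuous smooth_flow) (simp add: spt_def)
qed (use not_in_spt in blast)

lemma test_fun_flow:
  assumes "test_fun S \<psi>" "flow v t -` spt \<psi> \<subseteq> S'"
  shows "test_fun S' (\<lambda>x. \<psi> (flow v t x))"
proof -
  have K: "compact (flow v t -` spt \<psi>)"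
    using assms by (intro compact_flow_vimage) (simp add: test_fun_def)
  have "compact (spt (\<lambda>x. \<psi> (flow v t x)))"
    using compact_Int_closed[OF K, of "spt (\<lambda>x. \<psi> (flow v t x))"] spt_flow_subset[of \<psi> v t]
    by (simp add: spt_def Int_absorb1)
  then show ?thesis
    using assms spt_flow_subset[of \<psi> v t] smooth_compose[OF _ smooth_flow] by (auto simp: test_fun_def)
qed

text \<open>
  The time derivative of the integral is the integral of \<open>Z (\<psi> \<circ> R\<^sub>t)\<close>, and \<open>\<psi> \<circ> R\<^sub>t\<close> is again a test function.
\<close>

lemma integral_test_fun_flow:
  assumes psi: "test_fun UNIV \<psi>"
  shows "(LINT x|lebesgue. \<psi> (flow v t x)) = (LINT x|lebesgue. \<psi> x)"
proof -
  have s: "smooth \<psi>" and c: "compact (spt \<psi>)" using psi by (auto simp: test_fun_def)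
  have "((\<lambda>t. LINT x|lebesgue. \<psi> (flow v t x)) has_real_derivative 0) (at t)" for t
  proof -
    let ?K = "(\<lambda>(s, y). flow v s y) ` ({- t - 1..- t + 1} \<times> spt \<psi>)"
    have K: "compact ?K"
      by (intro compact_continuous_image continuous_flow compact_Times c compact_Icc)
    have off: "\<psi> (flow v s x) = 0" if "s \<in> {t - 1<..<t + 1}" "x \<notin> ?K" for s x
    proof (rule ccontr)
      assume "\<psi> (flow v s x) \<noteq> 0"
      then have "flow v s x \<in> spt \<psi>" using not_in_spt by blast
      then have "x \<in> ?K" using that(1) by (intro image_eqI[of _ _ "(- s, flow v s x)"]) auto
      then show False using that by simp
    qed
    have 1: "((\<lambda>t. LINT x:?K|lebesgue. 1 * \<psi> (flow v t x)) has_real_derivative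
        (LINT x:?K|lebesgue. 1 * vf_apply (Z v) \<psi> (flow v t x))) (at t)"
    proof (rule set_integral_has_real_derivative[OF K set_integrable_const_compact[OF K] flow_orbit_derivative[OF s]])
      show "continuous_on UNIV (\<lambda>x. \<psi> (flow v t x))" for t
        by (intro smooth_continuous smooth_compose[OF s smooth_flow])
      show "continuous_on UNIV (\<lambda>(t, x). vf_apply (Z v) \<psi> (flow v t x))"
        using continuous_on_compose2[OF smooth_continuous[OF smooth_vf_apply[OF smooth_Z s], of UNIV] continuous_flow]
        by (simp add: split_beta)
    qed
    have "(LINT x:?K|lebesgue. 1 * vf_apply (Z v) \<psi> (flow v t x)) = (LINT x:UNIV|lebesgue. vf_apply (Z v) (\<lambda>x. \<psi> (flow v t x)) x)"
      unfolding vf_apply_flow[OF s] mult_1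
    proof (rule set_integral_eq_if_vanishes)
      fix x assume x: "x \<in> UNIV - ?K"
      have "flow v t x \<notin> spt \<psi>"
      proof
        assume "flow v t x \<in> spt \<psi>"
        then have "x \<in> ?K" by (intro image_eqI[of _ _ "(- t, flow v t x)"]) auto
        then show False using x by simp
      qed
      then show "vf_apply (Z v) \<psi> (flow v t x) = 0" unfolding vf_apply_def by (rule D_zero_off_spt)
    qed auto
    also have "\<dots> = 0"
      using integral_Z_test_fun[of "\<lambda>x. \<psi> (flow v t x)" v] test_fun_flow[OF psi, of v t UNIV]
      by (simp add: test_fun_def set_lebesgue_integral_def)
    finally have 2: "((\<lambda>t. LINT x:?K|lebesgue. 1 * \<psi> (flow v t x)) has_real_derivative 0) (at t)"
      using 1 by simp
    show ?thesis
    proof (rule has_field_derivative_transform_within_open[OF 2, where S = "{t - 1<..<t + 1}"])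
      fix s assume "s \<in> {t - 1<..<t + 1}"
      then have "(LINT x:?K|lebesgue. 1 * \<psi> (flow v s x)) = (LINT x:UNIV|lebesgue. 1 * \<psi> (flow v s x))"
        using off by (intro set_integral_eq_if_vanishes) auto
      then show "(LINT x:?K|lebesgue. 1 * \<psi> (flow v s x)) = (LINT x|lebesgue. \<psi> (flow v s x))"
        by (simp add: set_lebesgue_integral_def)
    qed auto
  qed
  then have "(LINT x|lebesgue. \<psi> (flow v t x)) = (LINT x|lebesgue. \<psi> (flow v 0 x))"
    by (intro DERIV_isconst_all) auto
  then show ?thesis by simp
qed

lemma flow_measurable: "flow v t \<in> borel_measurable borel"
  by (intro borel_measurable_continuous_onI smooth_continuous smooth_flow)

lemma distr_flow: "distr lborel borel (flow v t) = lborel"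
proof (rule lborel_eqI[symmetric])
  fix l u :: 'a assume lu: "\<And>b. b \<in> Basis \<Longrightarrow> l \<bullet> b \<le> u \<bullet> b"
  obtain \<psi> where psi: "\<And>k::nat. test_fun (box l u) (\<psi> k)" "\<And>k y. 0 \<le> \<psi> k y" "\<And>k y. \<psi> k y \<le> 1"
    "\<And>y. (\<lambda>k. \<psi> k y) \<longlonglongrightarrow> indicator (box l u) y"
    using indicator_limit_of_test_fun[OF open_box] by metis
  have s: "smooth (\<psi> k)" and sp: "spt (\<psi> k) \<subseteq> box l u" for k using psi(1) by (auto simp: test_fun_def)
  have lim: "(\<lambda>k. LINT x|lebesgue. \<psi> k (flow v r x)) \<longlonglongrightarrow> measure lebesgue (flow v r -` box l u)" for r
  proof -
    have K: "compact (flow v r -` cbox l u)" by (rule compact_flow_vimage) simp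
    have m: "flow v r -` box l u \<in> sets lebesgue"
      using open_flow_vimage[OF open_box] by (intro sets_completionI_sets) (simp add: borel_open)
    have "(\<lambda>k. LINT x|lebesgue. \<psi> k (flow v r x)) \<longlonglongrightarrow> (LINT x|lebesgue. indicator (flow v r -` box l u) x)"
    proof (rule integral_dominated_convergence[where w = "indicator (flow v r -` cbox l u)"])
      show "integrable lebesgue (indicator (flow v r -` cbox l u) :: 'a \<Rightarrow> real)"
        using set_integrable_const_compact[OF K] by (simp add: set_integrable_def)
      show "(\<lambda>x. indicator (flow v r -` box l u) x :: real) \<in> borel_measurable lebesgue"
        using m by simp
      show "(\<lambda>x. \<psi> k (flow v r x)) \<in> borel_measurable lebesgue" for k
        by (intro continuous_borel_lebesgue smooth_continuous smooth_compose[OF s smooth_flow])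
      show "AE x in lebesgue. (\<lambda>k. \<psi> k (flow v r x)) \<longlonglongrightarrow> indicator (flow v r -` box l u) x"
        using psi(4)[of "flow v r x" for x] by (intro AE_I2) (simp add: indicator_def)
      have "\<psi> k y \<le> indicator (cbox l u) y" for k y
      proof (cases "y \<in> cbox l u")
        case False
        then have "y \<notin> spt (\<psi> k)" using sp[of k] box_subset_cbox[of l u] by blast
        then show ?thesis by (simp add: not_in_spt)
      qed (simp add: psi(3))
      then show "AE x in lebesgue. norm (\<psi> k (flow v r x)) \<le> indicator (flow v r -` cbox l u) x" for k
        using psi(2) by (intro AE_I2) (simp add: indicator_def)
    qed
    moreover have "(LINT x|lebesgue. indicator (flow v r -` box l u) x) = measure lebesgue (flow v r -` box l u)"
      using m by simp
    ultimately show ?thesis by simp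
  qed
  have "test_fun UNIV (\<psi> k)" for k using psi(1) by (simp add: test_fun_def)
  from integral_test_fun_flow[OF this] lim[of t]
  have "(\<lambda>k. LINT x|lebesgue. \<psi> k x) \<longlonglongrightarrow> measure lebesgue (flow v t -` box l u)" by simp
  moreover have "(\<lambda>k. LINT x|lebesgue. \<psi> k x) \<longlonglongrightarrow> measure lebesgue (box l u)"
    using lim[of 0] by (simp add: vimage_def)
  ultimately have eq: "measure lebesgue (flow v t -` box l u) = measure lebesgue (box l u)"
    by (rule LIMSEQ_unique)
  have b: "flow v t -` box l u \<in> sets borel"
    using open_flow_vimage[OF open_box] by (rule borel_open)
  have "emeasure lborel (flow v t -` box l u) < \<infinity>"
  proof -
    have "emeasure lborel (flow v t -` box l u) \<le> emeasure lborel (flow v t -` cbox l u)"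
      using borel_compact[OF compact_flow_vimage[OF compact_cbox, of v t l u]] box_subset_cbox by (intro emeasure_mono) auto
    also have "\<dots> < \<infinity>" by (rule emeasure_compact_finite[OF compact_flow_vimage[OF compact_cbox]])
    finally show ?thesis .
  qed
  then have "emeasure lborel (flow v t -` box l u) = emeasure lborel (box l u)"
    using eq b emeasure_lborel_box_finite[of l u]
    by (simp add: emeasure_eq_ennreal_measure less_top[symmetric])
  then show "emeasure (distr lborel borel (flow v t)) (box l u) = (\<Prod>b\<in>Basis. (u - l) \<bullet> b)"
    using lu by (subst emeasure_distr) (simp_all add: flow_measurable emeasure_lborel_box)
qed simp

lemma measure_flow_vimage:
  assumes S: "S \<in> sets borel"
  shows "measure lebesgue (flow v t -` S) = measure lebesgue S"
proof -
  have "flow v t -` S \<in> sets borel" using measurable_sets[OF flow_measurable S] by simp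
  moreover have "emeasure (distr lborel borel (flow v t)) S = emeasure lborel (flow v t -` S)"
    using S by (simp add: emeasure_distr flow_measurable)
  ultimately show ?thesis using S by (simp add: distr_flow measure_def)
qed

end

section \<open>Locality of weak derivatives\<close>

text \<open>
  Absolute continuity of the integral, by splitting \<open>|f|\<close> into a part bounded by \<open>k\<close> and the excess
  over \<open>k\<close>, whose integral tends to \<open>0\<close>.
\<close>

lemma set_integral_small_on_small_sets:
  fixes f :: "'a::euclidean_space \<Rightarrow> real"
  assumes K: "compact K" and f: "set_integrable lebesgue K f" and \<epsilon>: "\<epsilon> > 0"
  shows "\<exists>\<delta>>0. \<forall>S. S \<in> sets lebesgue \<longrightarrow> S \<subseteq> K \<longrightarrow> measure lebesgue S < \<delta> \<longrightarrow>
     (LINT x:S|lebesgue. \<bar>f x\<bar>) < \<epsilon>"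
proof -
  define G where "G x = \<bar>indicator K x *\<^sub>R f x\<bar>" for x
  have G: "integrable lebesgue G" unfolding G_def[abs_def]
    using f by (auto simp: set_integrable_def)
  have "(\<lambda>k. LINT x|lebesgue. max (G x - real k) 0) \<longlonglongrightarrow> integral\<^sup>L lebesgue (\<lambda>x :: 'a. 0 :: real)"
  proof (rule integral_dominated_convergence[where w = G])
    show "(\<lambda>x. max (G x - real k) 0) \<in> borel_measurable lebesgue" for k
      using G by auto
    show "AE x in lebesgue. (\<lambda>k. max (G x - real k) 0) \<longlonglongrightarrow> 0"
    proof (rule AE_I2)
      fix x
      obtain l :: nat where l: "G x < real l" using reals_Archimedean2 by blast
      have "max (G x - real k) 0 = 0" if "k \<ge> l" for k
      proof -
        have "real l \<le> real k" using that by simp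
        with l show ?thesis by simp
      qed
      then show "(\<lambda>k. max (G x - real k) 0) \<longlonglongrightarrow> 0"
        by (intro tendsto_eventually) (auto simp: eventually_sequentially)
    qed
    show "AE x in lebesgue. norm (max (G x - real k) 0) \<le> G x" for k
      by (rule AE_I2) (simp add: G_def)
  qed (use G in auto)
  then have "(\<lambda>k. LINT x|lebesgue. max (G x - real k) 0) \<longlonglongrightarrow> 0" by simp
  from order_tendstoD(2)[OF this, of "\<epsilon> / 2"] \<epsilon>
  obtain k where k: "(LINT x|lebesgue. max (G x - real k) 0) < \<epsilon> / 2"
    by (auto simp: eventually_sequentially)
  have max_int: "integrable lebesgue (\<lambda>x. max (G x - real k) 0)"
  proof (rule Bochner_Integration.integrable_bound[OF G])
    show "(\<lambda>x. max (G x - real k) 0) \<in> borel_measurable lebesgue" using G by auto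
  qed (simp add: G_def)
  show ?thesis
  proof (intro exI[of _ "\<epsilon> / (2 * (real k + 1))"] conjI allI impI)
    show "\<epsilon> / (2 * (real k + 1)) > 0" using \<epsilon> by simp
    fix S assume S: "S \<in> sets lebesgue" "S \<subseteq> K" "measure lebesgue S < \<epsilon> / (2 * (real k + 1))"
    have fin: "emeasure lebesgue S < \<infinity>"
      using emeasure_mono[OF S(2), of lebesgue] lmeasurable_compact[OF K] by (auto simp: fmeasurable_def intro: le_less_trans)
    have iS: "integrable lebesgue (\<lambda>x. real k * indicator S x)"
      using integrable_real_indicator[OF S(1) fin] by auto
    have iG: "integrable lebesgue (\<lambda>x. indicator S x * G x)"
      using integrable_mult_indicator[OF S(1) G] by simp
    have "(LINT x:S|lebesgue. \<bar>f x\<bar>) = (LINT x|lebesgue. indicator S x * G x)"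
      unfolding set_lebesgue_integral_def
      by (rule Bochner_Integration.integral_cong) (use S(2) in \<open>auto simp: G_def indicator_def\<close>)
    also have "\<dots> \<le> (LINT x|lebesgue. real k * indicator S x + max (G x - real k) 0)"
      by (rule integral_mono[OF iG Bochner_Integration.integrable_add[OF iS max_int]])
         (auto simp: indicator_def)
    also have "\<dots> = real k * measure lebesgue S + (LINT x|lebesgue. max (G x - real k) 0)"
      using S(1) fin by (simp add: Bochner_Integration.integral_add[OF iS max_int])
    also have "\<dots> < \<epsilon> / 2 + \<epsilon> / 2"
    proof (rule add_le_less_mono[OF _ k])
      have "real k * measure lebesgue S \<le> (real k + 1) * (\<epsilon> / (2 * (real k + 1)))"
        using S(3) by (intro mult_mono) auto
      also have "(real k + 1) * (\<epsilon> / (2 * (real k + 1))) = \<epsilon> / 2"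
        by (simp add: divide_simps)
      finally show "real k * measure lebesgue S \<le> \<epsilon> / 2" .
    qed
    finally show "(LINT x:S|lebesgue. \<bar>f x\<bar>) < \<epsilon>" by simp
  qed
qed

lemma abs_integral_diff_le:
  fixes a b :: "'a::euclidean_space \<Rightarrow> real"
  assumes a: "integrable lebesgue a" and b: "integrable lebesgue b"
    and c: "integrable lebesgue c" and le: "\<And>x. \<bar>a x - b x\<bar> \<le> c x"
  shows "\<bar>(LINT x|lebesgue. a x) - (LINT x|lebesgue. b x)\<bar> \<le> (LINT x|lebesgue. c x)"
proof -
  have "\<bar>(LINT x|lebesgue. a x) - (LINT x|lebesgue. b x)\<bar> = \<bar>LINT x|lebesgue. a x - b x\<bar>"
    by (simp add: Bochner_Integration.integral_diff[OF a b])
  also have "\<dots> \<le> (LINT x|lebesgue. \<bar>a x - b x\<bar>)" by (rule integral_abs_bound)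
  also have "\<dots> \<le> (LINT x|lebesgue. c x)"
    by (rule integral_mono) (use a b c le in auto)
  finally show ?thesis .
qed

lemma L1_loc_measurable:
  fixes w :: "'a::euclidean_space \<Rightarrow> real"
  assumes U: "open U" and w: "w \<in> L1_loc lebesgue U"
  shows "(\<lambda>x. indicator U x * w x) \<in> borel_measurable lebesgue"
proof -
  obtain C :: "nat \<Rightarrow> 'a set" where C: "\<And>k. compact (C k)" "\<And>k. C k \<subseteq> U" "\<Union>(range C) = U"
    and mono: "\<And>k l. k \<le> l \<Longrightarrow> C k \<subseteq> C l"
    using compact_exhaustion[OF U] by metis
  show ?thesis
  proof (rule borel_measurable_LIMSEQ_real)
    show "(\<lambda>x. indicator (C k) x * w x) \<in> borel_measurable lebesgue" for k
      using w C(1,2) by (auto simp: L1_loc_def set_integrable_def)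
    show "(\<lambda>k. indicator (C k) x * w x) \<longlonglongrightarrow> indicator U x * w x" for x
    proof (cases "x \<in> U")
      case True
      then obtain l where "x \<in> C l" using C(3) by blast
      then have "indicator (C k) x * w x = indicator U x * w x" if "k \<ge> l" for k
        using mono[OF that] True by auto
      then show ?thesis by (intro tendsto_eventually) (auto simp: eventually_sequentially)
    next
      case False
      then have "indicator (C k) x * w x = indicator U x * w x" for k using C(2) by (auto simp: indicator_def)
      then show ?thesis by (simp only: tendsto_const)
    qed
  qed
qed

text \<open>
  A Lebesgue measurable set is a countable union of compact sets up to a null set, and a positive function with
  integral zero lives on a null set.
\<close>

lemma null_set_if_compact_integrals_vanish:
  fixes w :: "'a::euclidean_space \<Rightarrow> real"
  assumes E: "E \<in> sets lebesgue" and int: "\<And>C. compact C \<Longrightarrow> C \<subseteq> E \<Longrightarrow> set_integrable lebesgue C w"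
    and 0: "\<And>C. compact C \<Longrightarrow> C \<subseteq> E \<Longrightarrow> (LINT x:C|lebesgue. w x) = 0"
    and pos: "\<And>x. x \<in> E \<Longrightarrow> w x > 0"
  shows "E \<in> null_sets lebesgue"
proof -
  have C0: "C \<in> null_sets lebesgue" if C: "compact C" "C \<subseteq> E" for C
  proof -
    have "AE x in lebesgue. indicator C x *\<^sub>R w x = 0"
      using integral_nonneg_eq_0_iff_AE[of lebesgue "\<lambda>x. indicator C x *\<^sub>R w x"] int[OF C] 0[OF C] pos C(2)
      by (auto simp: set_integrable_def set_lebesgue_integral_def indicator_def less_imp_le subset_iff)
    then have "AE x in lebesgue. x \<notin> C"
      by eventually_elim (use pos C(2) in \<open>fastforce simp: indicator_def split: if_splits\<close>)
    then show ?thesis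
      using AE_iff_null_sets[of C lebesgue] lmeasurable_compact[OF C(1)] by (auto simp: fmeasurable_def)
  qed
  obtain S T where ST: "fsigma S" "T \<in> null_sets lebesgue" "S \<union> T = E" "disjnt S T"
    using lebesgue_set_almost_fsigma[OF E] .
  obtain H :: "nat \<Rightarrow> 'a set" where H: "range H \<subseteq> Collect compact" "S = \<Union>(range H)"
    using ST(1) by (auto simp: fsigma_Union_compact)
  have "S \<in> null_sets lebesgue"
    unfolding H(2) using H ST(3) by (intro null_sets_UN C0) auto
  then show ?thesis using ST(2,3) null_sets.Un by blast
qed

context carnot_group
begin

text \<open>
  Tube lemma: \<open>(s, y) \<mapsto> R\<^sub>s y\<close> maps a neighbourhood of \<open>{0} \<times> B\<close> into \<open>U\<close>, and compactness makes the
  neighbourhood uniform.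
\<close>

lemma flow_stays_in_open:
  assumes B: "compact B" and U: "open U" and BU: "B \<subseteq> U"
  obtains \<epsilon> where "\<epsilon> > 0" "\<And>s x y. \<bar>s\<bar> \<le> \<epsilon> \<Longrightarrow> x \<in> B \<Longrightarrow> dist x y \<le> \<epsilon> \<Longrightarrow> flow v s y \<in> U"
proof -
  let ?W = "(\<lambda>(s, y). flow v s y) -` U"
  have "compact ({0} \<times> B)" by (intro compact_Times B) simp
  moreover have "open ?W" by (rule open_vimage[OF U continuous_flow])
  moreover have "{0} \<times> B \<subseteq> ?W" using BU by auto
  ultimately obtain e where e: "e > 0" "(\<Union>p\<in>{0} \<times> B. ball p e) \<subseteq> ?W"
    by (rule compact_subset_open_imp_ball_epsilon_subset)
  show ?thesis
  proof (rule that[of "e / 3"])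
    fix s :: real and x y assume sxy: "\<bar>s\<bar> \<le> e / 3" "x \<in> B" "dist x y \<le> e / 3"
    have "dist (0, x) (s, y) \<le> \<bar>s\<bar> + dist x y"
      using sqrt_sum_squares_le_sum_abs[of "dist 0 s" "dist x y"] by (simp add: dist_Pair_Pair)
    then have "(s, y) \<in> ball (0, x) e" using sxy e(1) by simp
    then have "(s, y) \<in> (\<Union>p\<in>{0} \<times> B. ball p e)" using sxy(2) by (intro UN_I[of "(0, x)"]) auto
    with e(2) have "(s, y) \<in> ?W" by (rule subsetD)
    then show "flow v s y \<in> U" by simp
  qed (use e in simp)
qed

text \<open>
  The weak equation tested with \<open>\<psi> \<circ> R\<^sub>-\<^sub>s\<close> says that \<open>\<integral> f (\<psi> \<circ> R\<^sub>-\<^sub>s)\<close> has derivative \<open>\<integral> w (\<psi> \<circ> R\<^sub>-\<^sub>s)\<close> in \<open>s\<close>,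
  so the mean value theorem compares two times.  All integrals are taken over a compact set \<open>K\<close> that
  contains the moving supports, where \<open>f\<close> is integrable.
\<close>

lemma weak_derivative_along_flow:
  fixes f w :: "'a \<Rightarrow> real"
  assumes K: "compact K" "K \<subseteq> U" and f: "set_integrable lebesgue K f"
    and weak: "is_weak_deriv lebesgue U (Z v) f w"
    and psi: "test_fun UNIV \<psi>"
    and T: "t > 0" and stay: "\<And>s. 0 \<le> s \<Longrightarrow> s \<le> t \<Longrightarrow> flow v (- s) -` spt \<psi> \<subseteq> K"
  shows "\<exists>s. 0 < s \<and> s < t \<and>
    (LINT x:K|lebesgue. f x * \<psi> (flow v (- t) x)) - (LINT x:K|lebesgue. f x * \<psi> x)
      = t * (LINT x:K|lebesgue. w x * \<psi> (flow v (- s) x))"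
proof -
  have sm: "smooth \<psi>" using psi by (simp add: test_fun_def)
  have d: "((\<lambda>s. LINT x:K|lebesgue. f x * \<psi> (flow v (- s) x)) has_real_derivative
      (LINT x:K|lebesgue. f x * (- vf_apply (Z v) \<psi> (flow v (- s) x)))) (at s)" for s
  proof (rule set_integral_has_real_derivative[OF K(1) f])
    show "((\<lambda>s. \<psi> (flow v (- s) x)) has_real_derivative - vf_apply (Z v) \<psi> (flow v (- s) x)) (at s)" for s x
      using DERIV_chain2[OF flow_orbit_derivative[OF sm] DERIV_minus[OF DERIV_ident]] by simp
    show "continuous_on UNIV (\<lambda>x. \<psi> (flow v (- s) x))" for s
      by (intro smooth_continuous smooth_compose[OF sm smooth_flow])
    have "continuous_on UNIV (\<lambda>p :: real \<times> 'a. (- fst p, snd p))" by (intro continuous_intros)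
    from continuous_on_compose2[OF continuous_flow[of UNIV v] this]
    have "continuous_on UNIV (\<lambda>p. flow v (- fst p) (snd p))" by simp
    from continuous_on_compose2[OF smooth_continuous[OF smooth_vf_apply[OF smooth_Z sm], of UNIV] this]
    show "continuous_on UNIV (\<lambda>(s, x). - vf_apply (Z v) \<psi> (flow v (- s) x))"
      unfolding split_beta by (intro continuous_intros) auto
  qed
  have eq: "(LINT x:K|lebesgue. f x * (- vf_apply (Z v) \<psi> (flow v (- s) x))) = (LINT x:K|lebesgue. w x * \<psi> (flow v (- s) x))"
    if s: "0 < s" "s < t" for s
  proof -
    let ?\<psi> = "\<lambda>x. \<psi> (flow v (- s) x)"
    have sp: "flow v (- s) -` spt \<psi> \<subseteq> K" using stay s by simp
    have test: "test_fun U ?\<psi>" by (rule test_fun_flow[OF psi]) (use sp K in blast)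
    have off: "?\<psi> x = 0" "vf_apply (Z v) ?\<psi> x = 0" if "x \<notin> K" for x
    proof -
      have "x \<notin> spt ?\<psi>" using spt_flow_subset[of \<psi> v "- s"] sp that by blast
      then show "?\<psi> x = 0" "vf_apply (Z v) ?\<psi> x = 0"
        using not_in_spt[of x ?\<psi>] D_zero_off_spt[of x ?\<psi>] by (simp_all add: vf_apply_def)
    qed
    have "(LINT x:K|lebesgue. w x * ?\<psi> x) = (LINT x:U|lebesgue. w x * ?\<psi> x)"
      by (rule set_integral_eq_if_vanishes) (use K off in auto)
    also have "\<dots> = - (LINT x:U|lebesgue. f x * vf_apply (Z v) ?\<psi> x)"
      using weak test by (simp add: is_weak_deriv_def)
    also have "(LINT x:U|lebesgue. f x * vf_apply (Z v) ?\<psi> x) = (LINT x:K|lebesgue. f x * vf_apply (Z v) ?\<psi> x)"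
      by (rule set_integral_eq_if_vanishes) (use K off in auto)
    finally show ?thesis
      by (simp add: vf_apply_flow[OF sm] set_lebesgue_integral_def)
  qed
  obtain s where "0 < s" "s < t"
     "(LINT x:K|lebesgue. f x * \<psi> (flow v (- t) x)) - (LINT x:K|lebesgue. f x * \<psi> (flow v (- 0) x))
      = (t - 0) * (LINT x:K|lebesgue. f x * (- vf_apply (Z v) \<psi> (flow v (- s) x)))"
    using MVT2[OF T d] by blast
  then show ?thesis using eq by (intro exI[of _ s]) simp
qed

text \<open>
  Each of the two sets is completed by \<open>B \<inter> flow v s -` B\<close> to a set of the measure of \<open>B\<close>.
\<close>

lemma measure_diff_flow_commute:
  assumes B: "compact B"
  shows "measure lebesgue (B - flow v s -` B) = measure lebesgue (flow v s -` B - B)"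
proof -
  let ?B = "flow v s -` B"
  have m: "B \<in> lmeasurable" "?B \<in> lmeasurable"
    using B compact_flow_vimage[OF B] by (auto intro: lmeasurable_compact)
  have "measure lebesgue (B - ?B) = measure lebesgue B - measure lebesgue (B \<inter> ?B)"
    using m by (simp add: measurable_measure_Diff[symmetric] fmeasurable.Int Diff_Int2 Diff_Int)
  moreover have "measure lebesgue (?B - B) = measure lebesgue ?B - measure lebesgue (B \<inter> ?B)"
    using m by (simp add: measurable_measure_Diff[symmetric] fmeasurable.Int Diff_Int2 Diff_Int)
  moreover have "measure lebesgue ?B = measure lebesgue B"
    by (rule measure_flow_vimage) (rule borel_compact[OF B])
  ultimately show ?thesis by simp
qed

text \<open>
  Fix a small time \<open>t\<close>, let \<open>B'\<close> be the set of \<open>x \<in> B\<close> with \<open>R\<^sub>t x \<in> B\<close>, and let \<open>\<psi>\<close> be a cutoff equal to \<open>1\<close>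
  on \<open>B'\<close> with support in a tight neighbourhood \<open>N\<close> of it.  The integral of \<open>f (\<psi> \<circ> R\<^sub>-\<^sub>s)\<close> is small compared
  with \<open>t\<close> for \<open>s = 0\<close> and \<open>s = t\<close>, because \<open>f\<close> vanishes on \<open>B'\<close> and on \<open>R\<^sub>t B'\<close>: here the order of
  choices matters, as \<open>N\<close> is chosen after \<open>t\<close>.  So the integral of \<open>w (\<psi> \<circ> R\<^sub>-\<^sub>s)\<close> is small at some
  intermediate time \<open>s\<close>, and at every such time it is close to the integral of \<open>w\<close> over \<open>B\<close>, since
  \<open>R\<^sub>s\<close> preserves measure and moves \<open>B\<close> only a little.
\<close>

proposition integral_weak_deriv_zero_set:
  fixes f w :: "'a \<Rightarrow> real"
  assumes U: "open U" and f: "f \<in> L1_loc lebesgue U"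
    and weak: "is_weak_deriv lebesgue U (Z v) f w"
    and B: "compact B" "B \<subseteq> U" and f0: "\<And>x. x \<in> B \<Longrightarrow> f x = 0"
  shows "(LINT x:B|lebesgue. w x) = 0"
proof -
  have w: "w \<in> L1_loc lebesgue U" using weak by (simp add: is_weak_deriv_def)
  let ?\<mu> = "measure lebesgue"
  obtain r where r: "r > 0" "\<And>s x y. \<bar>s\<bar> \<le> r \<Longrightarrow> x \<in> B \<Longrightarrow> dist x y \<le> r \<Longrightarrow> flow v s y \<in> U"
    using flow_stays_in_open[OF B(1) U B(2), of v] by metis
  \<comment> \<open>\<open>K1\<close> is a compact neighbourhood of \<open>B\<close>, and \<open>K\<close> contains all its images for times up to \<open>r\<close>\<close>
  define K1 where "K1 = (\<lambda>(x, y). x + y) ` (B \<times> cball 0 r)"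
  define K where "K = (\<lambda>(s, y). flow v s y) ` ({-r..r} \<times> K1)"
  define U1 where "U1 = (\<Union>x\<in>B. ball x r)"
  have K1: "compact K1"
    unfolding K1_def by (intro compact_continuous_image compact_Times B compact_cball) (auto intro!: continuous_intros simp: split_beta)
  have K: "compact K"
    unfolding K_def by (intro compact_continuous_image compact_Times K1 compact_Icc continuous_flow)
  have K1_dist: "\<exists>x\<in>B. dist x y \<le> r" if y: "y \<in> K1" for y
  proof -
    obtain a b where "y = a + b" "a \<in> B" "norm b \<le> r" using y by (auto simp: K1_def)
    then show ?thesis by (intro bexI[of _ a]) (simp_all add: dist_norm)
  qed
  have U1K1: "U1 \<subseteq> K1"
  proof
    fix y assume "y \<in> U1"
    then obtain x where "x \<in> B" "dist x y < r" by (auto simp: U1_def)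
    then show "y \<in> K1" unfolding K1_def
      by (intro image_eqI[of _ _ "(x, y - x)"]) (auto simp: dist_norm norm_minus_commute)
  qed
  have U1: "open U1" "B \<subseteq> U1" using r(1) by (auto simp: U1_def)
  have KU: "K \<subseteq> U" using r(2) K1_dist by (fastforce simp: K_def)
  have stay: "x \<in> K" if s: "\<bar>s\<bar> \<le> r" and x: "flow v (- s) x \<in> U1" for s x
  proof -
    have "flow v (- s) x \<in> K1" using U1K1 x by auto
    then show "x \<in> K" unfolding K_def
      using s by (intro image_eqI[of _ _ "(s, flow v (- s) x)"]) auto
  qed
  have BK: "B \<subseteq> K" using stay[of 0] U1(2) r(1) by auto
  have fK: "set_integrable lebesgue K f" and wK: "set_integrable lebesgue K w"
    using f w K KU by (auto simp: L1_loc_def)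
  have small: "\<bar>LINT x:B|lebesgue. w x\<bar> \<le> 3 * \<epsilon>" if e: "\<epsilon> > 0" for \<epsilon>
  proof -
    obtain \<delta> where d: "\<delta> > 0" "\<And>S. S \<in> sets lebesgue \<Longrightarrow> S \<subseteq> K \<Longrightarrow> ?\<mu> S < \<delta> \<Longrightarrow> (LINT x:S|lebesgue. \<bar>w x\<bar>) < \<epsilon>"
      using set_integral_small_on_small_sets[OF K wK e] by blast
    obtain V where V: "open V" "B \<subseteq> V" "V - B \<in> lmeasurable" "emeasure lebesgue (V - B) < ennreal (\<delta> / 4)"
      using sets_lebesgue_outer_open[of B "\<delta> / 4"] lmeasurable_compact[OF B(1)] d(1) by (auto simp: fmeasurable_def)
    have V': "?\<mu> (V - B) < \<delta> / 4"
      using V(3,4) d(1) by (simp add: emeasure_eq_measure2 ennreal_less_iff)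
    obtain t0 where t0: "t0 > 0" "\<And>s x y. \<bar>s\<bar> \<le> t0 \<Longrightarrow> x \<in> B \<Longrightarrow> dist x y \<le> t0 \<Longrightarrow> flow v s y \<in> V"
      using flow_stays_in_open[OF B(1) V(1,2), of v] by metis
    define t where "t = min r t0"
    have t: "t > 0" "t \<le> r" "t \<le> t0" using r(1) t0(1) by (auto simp: t_def)
    have shift: "?\<mu> (flow v s -` B - B) < \<delta> / 4" "?\<mu> (B - flow v s -` B) < \<delta> / 4" if s: "\<bar>s\<bar> \<le> t" for s
    proof -
      have "flow v s -` B \<subseteq> V"
        using t0(2)[of "- s" y y for y] s t(1,3) t0(1) by (auto simp: flow_vimage)
      moreover have "flow v s -` B - B \<in> sets lebesgue"
        using B(1) compact_flow_vimage[OF B(1)] by (intro sets.Diff fmeasurableD lmeasurable_compact) auto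
      ultimately have "?\<mu> (flow v s -` B - B) \<le> ?\<mu> (V - B)"
        using V(3) by (intro measure_mono_fmeasurable) auto
      with V' show "?\<mu> (flow v s -` B - B) < \<delta> / 4" by simp
      then show "?\<mu> (B - flow v s -` B) < \<delta> / 4" by (simp add: measure_diff_flow_commute[OF B(1)])
    qed
    define B' where "B' = B \<inter> flow v t -` B"
    have B': "compact B'" unfolding B'_def
      using B(1) compact_flow_vimage[OF B(1)] by (simp add: compact_Int)
    obtain \<delta>' where d': "\<delta>' > 0" "\<And>S. S \<in> sets lebesgue \<Longrightarrow> S \<subseteq> K \<Longrightarrow> ?\<mu> S < \<delta>' \<Longrightarrow> (LINT x:S|lebesgue. \<bar>f x\<bar>) < \<epsilon> * t"
      using set_integral_small_on_small_sets[OF K fK, of "\<epsilon> * t"] e t(1) by auto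
    obtain W where W: "open W" "B' \<subseteq> W" "W - B' \<in> lmeasurable" "emeasure lebesgue (W - B') < ennreal (min \<delta>' (\<delta> / 4))"
      using sets_lebesgue_outer_open[of B' "min \<delta>' (\<delta> / 4)"] lmeasurable_compact[OF B'] d(1) d'(1) by (auto simp: fmeasurable_def)
    define N where "N = W \<inter> U1"
    have N: "open N" "B' \<subseteq> N" "N \<subseteq> U1"
      using W U1 by (auto simp: N_def B'_def)
    have Nb: "N \<in> sets borel" "B' \<in> sets borel" "B \<in> sets borel"
      using N(1) B' B(1) by (auto intro: borel_open borel_compact)
    have NB: "?\<mu> (N - B') < min \<delta>' (\<delta> / 4)"
    proof -
      have "?\<mu> (N - B') \<le> ?\<mu> (W - B')"
        using W(3) Nb by (intro measure_mono_fmeasurable) (auto simp: N_def intro!: sets_completionI_sets)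
      also have "\<dots> < min \<delta>' (\<delta> / 4)"
        using W(3,4) d(1) d'(1) by (simp add: emeasure_eq_measure2 ennreal_less_iff)
      finally show ?thesis .
    qed
    obtain \<psi> where psi: "test_fun N \<psi>" "\<And>y. 0 \<le> \<psi> y" "\<And>y. \<psi> y \<le> 1" "\<And>y. y \<in> B' \<Longrightarrow> \<psi> y = 1"
      using smooth_cutoff[OF B' N(1,2)] by metis
    have sm: "smooth \<psi>" using psi(1) by (simp add: test_fun_def)
    have psi0: "\<psi> y = 0" if "y \<notin> N" for y using psi(1) that by (intro not_in_spt) (auto simp: test_fun_def)
    have bor: "flow v s -` X \<in> sets lebesgue" if "X \<in> sets borel" for s X
      using measurable_sets[OF flow_measurable that] by (intro sets_completionI_sets) simp
    let ?I = "\<lambda>s. LINT x:K|lebesgue. w x * \<psi> (flow v (- s) x)"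
    let ?J = "\<lambda>s. LINT x:K|lebesgue. f x * \<psi> (flow v (- s) x)"
    \<comment> \<open>outside of \<open>R\<^sub>s (N - B')\<close> the integrand vanishes: either \<open>\<psi>\<close> does, or \<open>x \<in> B\<close> and \<open>f x = 0\<close>\<close>
    have J: "\<bar>?J s\<bar> < \<epsilon> * t" if s: "s = 0 \<or> s = t" for s
    proof -
      let ?X = "flow v (- s) -` (N - B')"
      have X: "?X \<in> sets lebesgue" using Nb by (intro bor) auto
      have XK: "?X \<subseteq> K" using stay[of s] s t N(3) by auto
      have van: "f x * \<psi> (flow v (- s) x) = 0" if "x \<notin> ?X" for x
      proof (cases "flow v (- s) x \<in> B'")
        case True
        then have "x \<in> B"
          using s by (auto simp: B'_def)
        then show ?thesis by (simp add: f0)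
      next
        case False
        then show ?thesis using that psi0 by auto
      qed
      have iX: "integrable lebesgue (\<lambda>x. indicator ?X x *\<^sub>R \<bar>f x\<bar>)"
        using set_integrable_subset[OF set_integrable_abs[OF fK] X XK] by (simp add: set_integrable_def)
      have "\<bar>?J s\<bar> = \<bar>(LINT x|lebesgue. indicator K x *\<^sub>R (f x * \<psi> (flow v (- s) x))) - (integral\<^sup>L lebesgue (\<lambda>x :: 'a. 0))\<bar>"
        by (simp add: set_lebesgue_integral_def)
      also have "\<dots> \<le> (LINT x|lebesgue. indicator ?X x *\<^sub>R \<bar>f x\<bar>)"
      proof (rule abs_integral_diff_le[OF _ _ iX])
        show "integrable lebesgue (\<lambda>x. indicator K x *\<^sub>R (f x * \<psi> (flow v (- s) x)))"
          using set_integrable_mult_continuous[OF K fK smooth_continuous[OF smooth_compose[OF sm smooth_flow]]]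
          by (simp add: set_integrable_def)
        show "\<bar>indicator K x *\<^sub>R (f x * \<psi> (flow v (- s) x)) - 0\<bar> \<le> indicator ?X x *\<^sub>R \<bar>f x\<bar>" for x
        proof (cases "x \<in> ?X")
          case True
          then show ?thesis
            using psi(2,3)[of "flow v (- s) x"] mult_left_mono[of "\<psi> (flow v (- s) x)" 1 "\<bar>f x\<bar>"]
            by (simp add: abs_mult indicator_def)
        qed (use van[of x] in simp)
      qed simp
      also have "\<dots> = (LINT x:?X|lebesgue. \<bar>f x\<bar>)" by (simp add: set_lebesgue_integral_def)
      also have "\<dots> < \<epsilon> * t"
        using X XK NB measure_flow_vimage[of "N - B'" v "- s"] Nb by (intro d'(2)) auto
      finally show ?thesis .
    qed
    obtain s where s: "0 < s" "s < t" and mvt: "?J t - ?J 0 = t * ?I s"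
    proof -
      have test: "test_fun UNIV \<psi>" using psi(1) by (simp add: test_fun_def)
      have sub: "flow v (- s) -` spt \<psi> \<subseteq> K" if "0 \<le> s" "s \<le> t" for s
        using stay[of s] that t psi(1) N(3) by (auto simp: test_fun_def)
      show ?thesis
        using weak_derivative_along_flow[OF K KU fK weak test t(1) sub] that by auto
    qed
    have "\<bar>t * ?I s\<bar> \<le> \<epsilon> * t + \<epsilon> * t" using J[of 0] J[of t] mvt by linarith
    then have "t * \<bar>?I s\<bar> \<le> t * (2 * \<epsilon>)" using t(1) by (simp add: abs_mult algebra_simps)
    then have I: "\<bar>?I s\<bar> \<le> 2 * \<epsilon>" using t(1) by simp
    let ?R = "\<lambda>X. flow v (- s) -` X"
    \<comment> \<open>\<open>\<psi> \<circ> R\<^sub>-\<^sub>s\<close> agrees with the indicator function of \<open>B\<close> off this set\<close>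
    let ?S = "(B - ?R B') \<union> (?R N - B)"
    have BL: "B \<in> sets lebesgue" using bor[OF Nb(3), of 0] by (simp add: vimage_def)
    have S: "?S \<in> sets lebesgue" using BL bor[OF Nb(1)] bor[OF Nb(2)] by blast
    have SK: "?S \<subseteq> K" using BK stay[of s] s t N(3) by auto
    have muS: "?\<mu> ?S < \<delta>"
    proof -
      let ?S1 = "B - ?R B" and ?S2 = "?R (B - flow v t -` B)" and ?S3 = "?R (N - B')" and ?S4 = "?R B - B"
      have tb: "flow v t -` B \<in> sets borel" using compact_flow_vimage[OF B(1)] by (rule borel_compact)
      have m: "?S1 \<in> sets lebesgue" "?S2 \<in> sets lebesgue" "?S3 \<in> sets lebesgue" "?S4 \<in> sets lebesgue"
        using BL bor[OF Nb(3)] bor[of "B - flow v t -` B"] bor[of "N - B'"] Nb tb by auto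
      have sub: "?S \<subseteq> ?S1 \<union> ?S2 \<union> ?S3 \<union> ?S4" by (auto simp: B'_def)
      have "?S1 \<union> ?S2 \<union> ?S3 \<union> ?S4 \<subseteq> K"
        using BK stay[of s] s t N(3) U1(2) by auto
      then have "?S1 \<union> ?S2 \<union> ?S3 \<union> ?S4 \<in> lmeasurable"
        using m K by (intro fmeasurableI2[OF lmeasurable_compact[OF K]]) auto
      then have "?\<mu> ?S \<le> ?\<mu> (?S1 \<union> ?S2 \<union> ?S3 \<union> ?S4)"
        using S sub by (intro measure_mono_fmeasurable) auto
      also have "\<dots> \<le> ?\<mu> ?S1 + ?\<mu> ?S2 + ?\<mu> ?S3 + ?\<mu> ?S4"
        using m by (intro order_trans[OF measure_Un_le] add_mono order_refl) auto
      also have "\<dots> < \<delta> / 4 + \<delta> / 4 + \<delta> / 4 + \<delta> / 4"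
      proof (intro add_strict_mono)
        show "?\<mu> ?S1 < \<delta> / 4" "?\<mu> ?S4 < \<delta> / 4" using shift[of "- s"] s by auto
        show "?\<mu> ?S2 < \<delta> / 4"
          using shift(2)[of t] t(1) Nb tb measure_flow_vimage[of "B - flow v t -` B" v "- s"] by simp
        show "?\<mu> ?S3 < \<delta> / 4" using NB measure_flow_vimage[of "N - B'" v "- s"] Nb by simp
      qed
      finally show ?thesis by simp
    qed
    have "\<bar>?I s - (LINT x:B|lebesgue. w x)\<bar> \<le> (LINT x:?S|lebesgue. \<bar>w x\<bar>)"
      unfolding set_lebesgue_integral_def
    proof (rule abs_integral_diff_le)
      show "integrable lebesgue (\<lambda>x. indicator K x *\<^sub>R (w x * \<psi> (flow v (- s) x)))"
        using set_integrable_mult_continuous[OF K wK smooth_continuous[OF smooth_compose[OF sm smooth_flow]]]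
        by (simp add: set_integrable_def)
      show "integrable lebesgue (\<lambda>x. indicator B x *\<^sub>R w x)"
        using set_integrable_subset[OF wK BL BK] by (simp add: set_integrable_def)
      show "integrable lebesgue (\<lambda>x. indicator ?S x *\<^sub>R \<bar>w x\<bar>)"
        using set_integrable_subset[OF set_integrable_abs[OF wK] S SK] by (simp add: set_integrable_def)
      show "\<bar>indicator K x *\<^sub>R (w x * \<psi> (flow v (- s) x)) - indicator B x *\<^sub>R w x\<bar> \<le> indicator ?S x *\<^sub>R \<bar>w x\<bar>" for x
      proof (cases "x \<in> ?S")
        case True
        then have xK: "x \<in> K" using SK by blast
        have "\<bar>w x * \<psi> (flow v (- s) x) - indicator B x * w x\<bar> = \<bar>w x\<bar> * \<bar>\<psi> (flow v (- s) x) - indicator B x\<bar>"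
          by (simp add: algebra_simps flip: abs_mult)
        also have "\<dots> \<le> \<bar>w x\<bar> * 1"
          using psi(2,3)[of "flow v (- s) x"] by (intro mult_left_mono) (auto simp: indicator_def)
        finally show ?thesis using True xK by simp
      next
        case False
        show ?thesis
        proof (cases "x \<in> B")
          case True
          then have "flow v (- s) x \<in> B'" using False by auto
          then show ?thesis using True BK False psi(4) by auto
        next
          case nB: False
          then have "flow v (- s) x \<notin> N" using False by auto
          then show ?thesis using nB False psi0 by auto
        qed
      qed
    qed
    also have "\<dots> < \<epsilon>" by (rule d(2)[OF S SK muS])
    finally show ?thesis using I by linarith
  qed
  show ?thesis
  proof (rule ccontr)
    assume "(LINT x:B|lebesgue. w x) \<noteq> 0"
    then show False using small[of "\<bar>LINT x:B|lebesgue. w x\<bar> / 4"] by auto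
  qed
qed

end

section \<open>Equality of weak derivatives on level sets\<close>

lemma set_integrable_L1_loc_mult:
  fixes w g :: "'a::euclidean_space \<Rightarrow> real"
  assumes w: "w \<in> L1_loc lebesgue U" and K: "compact K" "K \<subseteq> U"
    and g: "continuous_on UNIV g" and 0: "\<And>x. x \<notin> K \<Longrightarrow> g x = 0"
  shows "set_integrable lebesgue U (\<lambda>x. w x * g x)"
proof -
  have "set_integrable lebesgue K (\<lambda>x. w x * g x)"
    using w K by (intro set_integrable_mult_continuous g) (auto simp: L1_loc_def)
  moreover have "(\<lambda>x. indicator K x *\<^sub>R (w x * g x)) = (\<lambda>x. indicator U x *\<^sub>R (w x * g x))"
    using 0 K(2) by (auto simp: indicator_def fun_eq_iff)
  ultimately show ?thesis by (simp only: set_integrable_def)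
qed

lemma L1_loc_affine:
  fixes f g :: "'a::euclidean_space \<Rightarrow> real"
  assumes f: "f \<in> L1_loc lebesgue U" and g: "g \<in> L1_loc lebesgue U"
  shows "(\<lambda>x. f x - \<sigma> * g x - \<kappa>) \<in> L1_loc lebesgue U"
  unfolding L1_loc_def
proof (intro CollectI allI impI)
  fix K assume K: "compact K" "K \<subseteq> U"
  have c: "set_integrable lebesgue K (\<lambda>x. \<kappa>)"
    using set_integrable_mult_continuous[OF K(1) set_integrable_const_compact[OF K(1)], of "\<lambda>x. \<kappa>"]
    by simp
  have "set_integrable lebesgue K f" "set_integrable lebesgue K g"
    using f g K by (auto simp: L1_loc_def)
  then show "set_integrable lebesgue K (\<lambda>x. f x - \<sigma> * g x - \<kappa>)"
    using c by (intro set_integral_diff set_integrable_mult_right) auto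
qed

context carnot_group
begin

text \<open>
  The constant \<open>\<kappa>\<close> contributes nothing because \<open>Z \<psi>\<close> has integral zero for test functions.
\<close>

lemma is_weak_deriv_affine:
  assumes f: "f \<in> L1_loc lebesgue U" and p: "p \<in> L1_loc lebesgue U"
    and fw: "is_weak_deriv lebesgue U (Z v) f w" and pz: "is_weak_deriv lebesgue U (Z v) p z"
  shows "is_weak_deriv lebesgue U (Z v) (\<lambda>x. f x - \<sigma> * p x - \<kappa>) (\<lambda>x. w x - \<sigma> * z x)"
  unfolding is_weak_deriv_def
proof (intro conjI allI impI)
  have w: "w \<in> L1_loc lebesgue U" and z: "z \<in> L1_loc lebesgue U"
    using fw pz by (auto simp: is_weak_deriv_def)
  show "(\<lambda>x. w x - \<sigma> * z x) \<in> L1_loc lebesgue U"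
    using L1_loc_affine[OF w z, of \<sigma> 0] by simp
  fix \<psi> :: "'a \<Rightarrow> real" assume psi: "test_fun U \<psi>"
  then have sm: "smooth \<psi>" and K: "compact (spt \<psi>)" "spt \<psi> \<subseteq> U" by (auto simp: test_fun_def)
  let ?X = "vf_apply (Z v) \<psi>"
  have cpsi: "continuous_on UNIV \<psi>" and cX: "continuous_on UNIV ?X"
    using smooth_continuous[OF sm] smooth_continuous[OF smooth_vf_apply[OF smooth_Z sm]] by auto
  have 0: "\<psi> x = 0" "?X x = 0" if "x \<notin> spt \<psi>" for x
    using that not_in_spt D_zero_off_spt[of x \<psi>] by (auto simp: vf_apply_def)
  note I = set_integrable_L1_loc_mult[OF _ K]
  have int: "set_integrable lebesgue U (\<lambda>x. w x * \<psi> x)" "set_integrable lebesgue U (\<lambda>x. z x * \<psi> x)"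
    "set_integrable lebesgue U (\<lambda>x. f x * ?X x)" "set_integrable lebesgue U (\<lambda>x. p x * ?X x)"
    using I[OF w cpsi 0(1)] I[OF z cpsi 0(1)] I[OF f cX 0(2)] I[OF p cX 0(2)] by auto
  have iX: "integrable lebesgue ?X" by (rule integrable_compact_support[OF K(1) cX 0(2)])
  have X: "(LINT x:U|lebesgue. \<kappa> * ?X x) = 0" "set_integrable lebesgue U (\<lambda>x. \<kappa> * ?X x)"
  proof -
    have eq: "indicator U x *\<^sub>R (\<kappa> * ?X x) = \<kappa> * ?X x" for x
      using 0(2)[of x] K(2) by (auto simp: indicator_def)
    show "(LINT x:U|lebesgue. \<kappa> * ?X x) = 0"
      by (simp only: set_lebesgue_integral_def eq) (simp add: integral_Z_test_fun[OF sm K(1)])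
    show "set_integrable lebesgue U (\<lambda>x. \<kappa> * ?X x)"
      by (simp only: set_integrable_def eq) (simp add: iX)
  qed
  have "(LINT x:U|lebesgue. (w x - \<sigma> * z x) * \<psi> x)
      = (LINT x:U|lebesgue. w x * \<psi> x - \<sigma> * (z x * \<psi> x))"
    by (simp add: algebra_simps)
  also have "\<dots> = (LINT x:U|lebesgue. w x * \<psi> x) - \<sigma> * (LINT x:U|lebesgue. z x * \<psi> x)"
    using int by (subst set_integral_diff) auto
  also have "\<dots> = - ((LINT x:U|lebesgue. f x * ?X x) - \<sigma> * (LINT x:U|lebesgue. p x * ?X x))"
    using fw pz psi by (simp add: is_weak_deriv_def)
  also have "(LINT x:U|lebesgue. f x * ?X x) - \<sigma> * (LINT x:U|lebesgue. p x * ?X x)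
      = (LINT x:U|lebesgue. f x * ?X x - \<sigma> * (p x * ?X x)) - (LINT x:U|lebesgue. \<kappa> * ?X x)"
    using int X by (subst set_integral_diff) auto
  also have "\<dots> = (LINT x:U|lebesgue. f x * ?X x - \<sigma> * (p x * ?X x) - \<kappa> * ?X x)"
    using int X by (subst (2) set_integral_diff) (auto intro!: set_integral_diff)
  also have "\<dots> = (LINT x:U|lebesgue. (f x - \<sigma> * p x - \<kappa>) * ?X x)"
    by (simp add: algebra_simps)
  finally show "(LINT x:U|lebesgue. (w x - \<sigma> * z x) * \<psi> x)
      = - (LINT x:U|lebesgue. (f x - \<sigma> * p x - \<kappa>) * ?X x)" .
qed

lemma weak_deriv_nonpos_AE_on_zero_set:
  assumes U: "open U" and f: "f \<in> L1_loc lebesgue U" and fw: "is_weak_deriv lebesgue U (Z v) f w"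
  shows "AE x in lebesgue. x \<in> U \<longrightarrow> f x = 0 \<longrightarrow> w x \<le> 0"
proof -
  have w: "w \<in> L1_loc lebesgue U" using fw by (simp add: is_weak_deriv_def)
  note [measurable] = L1_loc_measurable[OF U f] L1_loc_measurable[OF U w]
  define E where "E = {x \<in> space lebesgue. indicator U x * w x > 0 \<and> indicator U x * f x = 0}"
  have E: "E \<in> sets lebesgue" unfolding E_def by measurable
  have Eiff: "x \<in> E \<longleftrightarrow> x \<in> U \<and> f x = 0 \<and> w x > 0" for x
    by (auto simp: E_def indicator_def)
  have "E \<in> null_sets lebesgue"
  proof (rule null_set_if_compact_integrals_vanish[OF E])
    fix C assume C: "compact C" "C \<subseteq> E"
    then have CU: "C \<subseteq> U" using Eiff by blast
    show "set_integrable lebesgue C w" using w C CU by (auto simp: L1_loc_def)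
    show "(LINT x:C|lebesgue. w x) = 0"
      by (rule integral_weak_deriv_zero_set[OF U f fw C(1) CU]) (use C Eiff in blast)
  qed (use Eiff in blast)
  from AE_not_in[OF this] show ?thesis
    by eventually_elim (use Eiff in fastforce)
qed

text \<open>
  Apply the zero set case to \<open>f - \<sigma> p - \<kappa>\<close> and to its negative.
\<close>

lemma weak_deriv_eq_AE_on_level_set:
  assumes U: "open U" and f: "f \<in> L1_loc lebesgue U" and p: "p \<in> L1_loc lebesgue U"
    and fw: "is_weak_deriv lebesgue U (Z v) f w" and pz: "is_weak_deriv lebesgue U (Z v) p z"
  shows "AE x in lebesgue. x \<in> U \<longrightarrow> f x = \<sigma> * p x + \<kappa> \<longrightarrow> w x = \<sigma> * z x"
proof -
  let ?f = "\<lambda>x. f x - \<sigma> * p x - \<kappa>" and ?w = "\<lambda>x. w x - \<sigma> * z x"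
  have 1: "?f \<in> L1_loc lebesgue U" "is_weak_deriv lebesgue U (Z v) ?f ?w"
    by (rule L1_loc_affine[OF f p], rule is_weak_deriv_affine[OF f p fw pz])
  have 0: "(\<lambda>x. 0) \<in> L1_loc lebesgue U" "is_weak_deriv lebesgue U (Z v) (\<lambda>x. 0) (\<lambda>x. 0)"
    by (auto simp: L1_loc_def is_weak_deriv_def set_integrable_def set_lebesgue_integral_def)
  have 2: "(\<lambda>x. 0 - 1 * ?f x - 0) \<in> L1_loc lebesgue U"
    "is_weak_deriv lebesgue U (Z v) (\<lambda>x. 0 - 1 * ?f x - 0) (\<lambda>x. 0 - 1 * ?w x)"
    by (rule L1_loc_affine[OF 0(1) 1(1)], rule is_weak_deriv_affine[OF 0(1) 1(1) 0(2) 1(2)])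
  show ?thesis
    using weak_deriv_nonpos_AE_on_zero_set[OF U 1] weak_deriv_nonpos_AE_on_zero_set[OF U 2]
    by eventually_elim auto
qed

end

section \<open>Multiples of Lebesgue measure\<close>

lemma scale_measure_eq_density: "scale_measure r M = density M (\<lambda>_. r)"
  by (rule measure_eqI) (auto simp: emeasure_density_const)

lemma integrable_scale_measure:
  fixes f :: "'a \<Rightarrow> real"
  assumes c: "c > 0"
  shows "integrable (scale_measure (ennreal c) M) f \<longleftrightarrow> integrable M f"
proof (cases "f \<in> borel_measurable M")
  case True
  then show ?thesis
    using c integrable_density[of f M "\<lambda>_. c"] by (simp add: scale_measure_eq_density)
next
  case False
  moreover have "borel_measurable (scale_measure (ennreal c) M) = borel_measurable M"
    by (rule measurable_cong_sets) auto
  ultimately show ?thesis by (auto dest: borel_measurable_integrable)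
qed

lemma integral_scale_measure:
  fixes f :: "'a \<Rightarrow> real"
  assumes c: "c > 0"
  shows "integral\<^sup>L (scale_measure (ennreal c) M) f = c * integral\<^sup>L M f"
proof (cases "integrable M f")
  case True
  then show ?thesis
    using c integral_density[of f M "\<lambda>_. c"] by (simp add: scale_measure_eq_density)
next
  case False
  then show ?thesis using integrable_scale_measure[OF c, of M f] by (simp add: not_integrable_integral_eq)
qed

lemma AE_scale_measure:
  assumes c: "c > 0"
  shows "(AE x in scale_measure (ennreal c) M. P x) \<longleftrightarrow> (AE x in M. P x)"
  unfolding scale_measure_eq_density by (subst AE_density) (use c in auto)

lemma L1_loc_scale_measure:
  "c > 0 \<Longrightarrow> L1_loc (scale_measure (ennreal c) lebesgue) U = L1_loc lebesgue U"
  by (simp add: L1_loc_def set_integrable_def integrable_scale_measure)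

lemma is_weak_deriv_scale_measure:
  assumes c: "c > 0"
  shows "is_weak_deriv (scale_measure (ennreal c) lebesgue) U X u w \<longleftrightarrow> is_weak_deriv lebesgue U X u w"
proof -
  have "c * a = - (c * b) \<longleftrightarrow> a = - b" for a b :: real
    using c mult_cancel_left[of c a "- b"] by simp
  then show ?thesis
    by (simp only: is_weak_deriv_def L1_loc_scale_measure[OF c] set_lebesgue_integral_def
        integral_scale_measure[OF c])
qed

section \<open>Localizing a Lipschitz function\<close>

text \<open>
  The distance of \<open>r\<close> from the multiples of \<open>2 h\<close>.
\<close>

definition triangle_wave :: "real \<Rightarrow> real \<Rightarrow> real" where
  "triangle_wave h r = \<bar>r - 2 * h * of_int (round (r / (2 * h)))\<bar>"

lemma abs_diff_multiple:
  fixes h r :: real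
  assumes h: "h > 0"
  shows "\<bar>r - 2 * h * of_int j\<bar> = 2 * h * \<bar>r / (2 * h) - of_int j\<bar>"
proof -
  have "r - 2 * h * of_int j = 2 * h * (r / (2 * h) - of_int j)" using h by (simp add: field_simps)
  then show ?thesis using h by (simp add: abs_mult)
qed

lemma triangle_wave_le:
  assumes h: "h > 0"
  shows "triangle_wave h r \<le> \<bar>r - 2 * h * of_int j\<bar>"
  unfolding triangle_wave_def abs_diff_multiple[OF h]
  using h round_diff_minimal[of "r / (2 * h)" j] by (intro mult_left_mono) auto

lemma triangle_wave_lipschitz:
  assumes h: "h > 0"
  shows "\<bar>triangle_wave h r - triangle_wave h s\<bar> \<le> \<bar>r - s\<bar>"
proof -
  have "triangle_wave h r \<le> \<bar>r - s\<bar> + triangle_wave h s" for r s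
    using triangle_wave_le[OF h, of r "round (s / (2 * h))"] by (simp add: triangle_wave_def)
  from this[of r s] this[of s r] show ?thesis by linarith
qed

lemma triangle_wave_bounded:
  assumes h: "h > 0"
  shows "triangle_wave h r \<le> h"
proof -
  have "\<bar>r / (2 * h) - of_int (round (r / (2 * h)))\<bar> \<le> 1 / 2"
    using of_int_round_abs_le[of "r / (2 * h)"] by (simp add: abs_minus_commute)
  then have "2 * h * \<bar>r / (2 * h) - of_int (round (r / (2 * h)))\<bar> \<le> 2 * h * (1 / 2)"
    using h by (intro mult_left_mono) auto
  then show ?thesis by (simp add: triangle_wave_def abs_diff_multiple[OF h])
qed

lemma triangle_wave_piecewise_affine:
  "\<exists>\<sigma>\<in>{1, -1}. \<exists>j :: int. triangle_wave h r = \<sigma> * r + 2 * h * of_int j"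
proof (cases "r - 2 * h * of_int (round (r / (2 * h))) \<ge> 0")
  case True
  then show ?thesis
    by (intro bexI[of _ 1] exI[of _ "- round (r / (2 * h))"]) (auto simp: triangle_wave_def)
next
  case False
  then show ?thesis
    by (intro bexI[of _ "-1"] exI[of _ "round (r / (2 * h))"]) (auto simp: triangle_wave_def)
qed

lemma edist_sets_pos_if_infdist_ge:
  fixes S N :: "'y::metric_space set"
  assumes h: "h > 0" and S: "\<And>y. y \<in> S \<Longrightarrow> h \<le> infdist y N"
  shows "edist_sets S N > 0"
proof -
  have "ereal h \<le> edist_sets S N" unfolding edist_sets_def
  proof (rule INF_greatest, clarify)
    fix x y assume "x \<in> S" "y \<in> N"
    then show "ereal h \<le> ereal (dist x y)"
      using S[of x] infdist_le[of y N x] by simp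
  qed
  moreover have "0 < ereal h" using h by simp
  ultimately show ?thesis by (rule less_le_trans[rotated])
qed

lemma lipschitz_1_iff: "1-lipschitz_on UNIV u \<longleftrightarrow> (\<forall>x y. \<bar>u x - u y\<bar> \<le> dist x y)"
  for u :: "'y::metric_space \<Rightarrow> real"
  by (auto simp: lipschitz_on_def dist_real_def)

lemma spt_subset_infdist_ge:
  fixes \<omega> :: "'y::metric_space \<Rightarrow> real"
  assumes "\<And>y. \<omega> y \<noteq> 0 \<Longrightarrow> h \<le> infdist y N"
  shows "y \<in> spt \<omega> \<Longrightarrow> h \<le> infdist y N"
proof -
  have "closed {y. h \<le> infdist y N}"
    by (intro closed_Collect_le continuous_intros continuous_on_infdist)
  then have "spt \<omega> \<subseteq> {y. h \<le> infdist y N}"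
    unfolding spt_def using assms by (intro closure_minimal) auto
  then show "y \<in> spt \<omega> \<Longrightarrow> h \<le> infdist y N" by auto
qed

text \<open>
  Lowering the distance to \<open>N\<close> by \<open>h\<close> keeps the Lipschitz constant \<open>1\<close> and moves the support away from \<open>N\<close>.
\<close>

definition inner_distance :: "real \<Rightarrow> 'y::metric_space set \<Rightarrow> 'y \<Rightarrow> real" where
  "inner_distance h N y = max (infdist y N - h) 0"

lemma inner_distance_admissible:
  assumes h: "h > 0"
  shows "1-lipschitz_on UNIV (inner_distance h N)" "edist_sets (spt (inner_distance h N)) N > 0"
proof -
  show "1-lipschitz_on UNIV (inner_distance h N)"
    unfolding lipschitz_1_iff inner_distance_def
  proof (intro allI)
    fix x y show "\<bar>max (infdist x N - h) 0 - max (infdist y N - h) 0\<bar> \<le> dist x y"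
      using infdist_triangle_abs[of x N y] by linarith
  qed
  have "h \<le> infdist y N" if "inner_distance h N y \<noteq> 0" for y
    using that by (auto simp: inner_distance_def max_def split: if_splits)
  from spt_subset_infdist_ge[OF this] show "edist_sets (spt (inner_distance h N)) N > 0"
    by (intro edist_sets_pos_if_infdist_ge[OF h])
qed

text \<open>
  Where \<open>N\<close> is further away than \<open>2 h\<close>, the cutoff exceeds \<open>h\<close>, the maximum of the triangle wave, and so does not
  alter it.
\<close>

lemma folded_lipschitz_admissible:
  fixes u :: "'y::metric_space \<Rightarrow> real" and N :: "'y set"
  assumes u: "1-lipschitz_on UNIV u" and h: "h > 0"
  defines "\<omega> \<equiv> \<lambda>y. min (triangle_wave h (u y)) (inner_distance h N y)"
  shows "1-lipschitz_on UNIV \<omega>" "edist_sets (spt \<omega>) N > 0"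
    "\<And>y. infdist y N > 2 * h \<Longrightarrow> \<exists>\<sigma>\<in>{1, -1}. \<exists>j :: int. \<omega> y = \<sigma> * u y + 2 * h * of_int j"
proof -
  show "1-lipschitz_on UNIV \<omega>"
    unfolding lipschitz_1_iff
  proof (intro allI)
    fix x y
    have "\<bar>triangle_wave h (u x) - triangle_wave h (u y)\<bar> \<le> dist x y"
      using triangle_wave_lipschitz[OF h, of "u x" "u y"] u unfolding lipschitz_1_iff
      by (metis order_trans)
    moreover have "\<bar>inner_distance h N x - inner_distance h N y\<bar> \<le> dist x y"
      using inner_distance_admissible(1)[OF h, of N] unfolding lipschitz_1_iff by blast
    ultimately show "\<bar>\<omega> x - \<omega> y\<bar> \<le> dist x y" unfolding \<omega>_def by linarith
  qed
  have "h \<le> infdist y N" if "\<omega> y \<noteq> 0" for y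
  proof (rule ccontr)
    assume "\<not> h \<le> infdist y N"
    then have "inner_distance h N y = 0" by (simp add: inner_distance_def)
    moreover have "triangle_wave h (u y) \<ge> 0" by (simp add: triangle_wave_def)
    ultimately show False using that by (simp add: \<omega>_def)
  qed
  from spt_subset_infdist_ge[OF this] show "edist_sets (spt \<omega>) N > 0"
    by (intro edist_sets_pos_if_infdist_ge[OF h])
  show "\<exists>\<sigma>\<in>{1, -1}. \<exists>j :: int. \<omega> y = \<sigma> * u y + 2 * h * of_int j" if "infdist y N > 2 * h" for y
  proof -
    have "\<omega> y = triangle_wave h (u y)"
      using that triangle_wave_bounded[OF h, of "u y"] by (simp add: \<omega>_def inner_distance_def)
    then show ?thesis using triangle_wave_piecewise_affine by simp
  qed
qed

section \<open>The energy inequality\<close>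

lemma L2_set_sign: "\<sigma> \<in> {1, -1} \<Longrightarrow> (\<And>i. i \<in> I \<Longrightarrow> a i = \<sigma> * b i) \<Longrightarrow> L2_set a I = L2_set b I"
  for a b :: "'i \<Rightarrow> real"
  unfolding L2_set_def by (intro arg_cong[where f = sqrt] sum.cong) auto

theorem lemma4p2:
  fixes mul :: "'a::euclidean_space \<Rightarrow> 'a \<Rightarrow> 'a" and ginv :: "'a \<Rightarrow> 'a"
    and m :: nat and g :: "nat \<Rightarrow> 'a set" and ip :: "'a \<Rightarrow> 'a \<Rightarrow> real"
    and n :: nat and e :: "nat \<Rightarrow> 'a"
    and c :: real and M :: "'a measure"
    and \<Omega> :: "'a set" and \<phi> :: "'a \<Rightarrow> 'y::metric_space" and V :: "'y set"
    and A q :: real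
  assumes "carnot_group mul ginv m g ip n e"
    and "c > 0" and "M = scale_measure (ennreal c) lebesgue"
    and "open \<Omega>" and "connected \<Omega>" and "\<Omega> \<noteq> {}"
    and "open V" and "A \<ge> 0" and "1 \<le> q"
    and "\<And>u :: 'y \<Rightarrow> real. 1-lipschitz_on UNIV u \<Longrightarrow> edist_sets (spt u) (UNIV - V) > 0 \<Longrightarrow>
           u \<circ> \<phi> \<in> L1q M mul n e q \<Omega> \<and>
           (\<integral>\<^sup>+ x \<in> {x \<in> \<Omega>. \<phi> x \<in> V}. ennreal (hgrad_norm M mul n e \<Omega> (u \<circ> \<phi>) x powr q) \<partial>M)
             \<le> ennreal A"
  shows "\<forall>u :: 'y \<Rightarrow> real. 1-lipschitz_on UNIV u \<longrightarrow> u \<circ> \<phi> \<in> L1q M mul n e q \<Omega> \<longrightarrow>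
           (\<integral>\<^sup>+ x \<in> {x \<in> \<Omega>. \<phi> x \<in> V}. ennreal (hgrad_norm M mul n e \<Omega> (u \<circ> \<phi>) x powr q) \<partial>M)
             \<le> ennreal A"
proof (intro allI impI)
  fix u :: "'y \<Rightarrow> real"
  assume u: "1-lipschitz_on UNIV u" and uq: "u \<circ> \<phi> \<in> L1q M mul n e q \<Omega>"
  interpret carnot_group mul ginv m g ip n e by fact
  note M = \<open>M = scale_measure (ennreal c) lebesgue\<close> and c = \<open>c > 0\<close>
  note hyp = assms(10)
  let ?N = "UNIV - V"
  let ?P = "{x \<in> \<Omega>. \<phi> x \<in> V}"
  let ?E = "\<lambda>f x. ennreal (hgrad_norm M mul n e \<Omega> f x powr q)"
  show "(\<integral>\<^sup>+ x \<in> ?P. ?E (u \<circ> \<phi>) x \<partial>M) \<le> ennreal A"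
  proof (cases "V = UNIV")
    case True
    \<comment> \<open>the distance to the empty set is infinite\<close>
    then have "edist_sets (spt u) ?N > 0" by (simp add: edist_sets_def top_ereal_def)
    then show ?thesis using hyp[OF u] by blast
  next
    case False
    then have N: "closed ?N" "?N \<noteq> {}" using \<open>open V\<close> by (auto simp: closed_def Compl_eq_Diff_UNIV[symmetric])
    have loc: "f \<in> L1_loc lebesgue \<Omega>" if "f \<in> L1q M mul n e q \<Omega>" for f
      using that by (simp add: L1q_def M L1_loc_scale_measure[OF c])
    have wd: "is_weak_deriv lebesgue \<Omega> (Z (e i)) f (\<lambda>x. hgrad M mul e \<Omega> f x i)"
      if f: "f \<in> L1q M mul n e q \<Omega>" and i: "i \<in> {1..n}" for f i
    proof -
      have "\<exists>w. is_weak_deriv M \<Omega> (Z (e i)) f w" using f i by (auto simp: L1q_def)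
      then have "is_weak_deriv M \<Omega> (Z (e i)) f (weak_deriv M \<Omega> (Z (e i)) f)"
        unfolding weak_deriv_def by (rule someI_ex)
      then show ?thesis unfolding hgrad_def M is_weak_deriv_scale_measure[OF c] .
    qed
    \<comment> \<open>the sets \<open>P k\<close> exhaust the preimage of \<open>V\<close>; on each of them a folded function replaces \<open>u\<close>\<close>
    define h where "h k = inverse (real (Suc k))" for k
    have h: "h k > 0" for k by (simp add: h_def)
    define P where "P k = {x \<in> \<Omega>. infdist (\<phi> x) ?N > 2 * h k}" for k
    have P_sets: "P k \<in> sets lebesgue" for k
    proof -
      \<comment> \<open>\<open>\<phi>\<close> need not be measurable, but its composition with an admissible function is\<close>
      let ?d = "inner_distance (h k) ?N \<circ> \<phi>"
      have "?d \<in> L1q M mul n e q \<Omega>"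
        using hyp[OF inner_distance_admissible[OF h]] by blast
      note [measurable] = L1_loc_measurable[OF \<open>open \<Omega>\<close> loc[OF this]]
      have "{x \<in> space lebesgue. indicator \<Omega> x * ?d x > h k} \<in> sets lebesgue" by measurable
      also have "{x \<in> space lebesgue. indicator \<Omega> x * ?d x > h k} = P k"
        using h[of k] by (auto simp: P_def inner_distance_def indicator_def)
      finally show ?thesis .
    qed
    have P_subset: "P k \<subseteq> ?P" for k
    proof
      fix x assume x: "x \<in> P k"
      have "\<phi> x \<notin> ?N"
      proof
        assume "\<phi> x \<in> ?N"
        then have "infdist (\<phi> x) ?N = 0" by simp
        then show False using x h[of k] by (simp add: P_def)
      qed
      then show "x \<in> ?P" using x by (simp add: P_def)
    qed
    have "incseq P"
    proof (rule incseq_SucI)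
      fix k
      have "h (Suc k) \<le> h k" unfolding h_def by (intro le_imp_inverse_le) auto
      then show "P k \<le> P (Suc k)" by (auto simp: P_def)
    qed
    have P_Union: "(\<Union>k. P k) = ?P"
    proof (intro equalityI subsetI)
      fix x assume x: "x \<in> ?P"
      then have "infdist (\<phi> x) ?N > 0"
        using infdist_pos_not_in_closed[OF N, of "\<phi> x"] by simp
      then obtain k where "inverse (real (Suc k)) < infdist (\<phi> x) ?N / 2"
        using reals_Archimedean[of "infdist (\<phi> x) ?N / 2"] by auto
      then have "x \<in> P k" using x by (simp add: P_def h_def)
      then show "x \<in> (\<Union>k. P k)" by blast
    qed (use P_subset in blast)
    have bound: "(\<integral>\<^sup>+ x. ?E (u \<circ> \<phi>) x * indicator (P k) x \<partial>M) \<le> ennreal A" for k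
    proof -
      let ?\<omega> = "\<lambda>y. min (triangle_wave (h k) (u y)) (inner_distance (h k) ?N y)"
      note \<omega> = folded_lipschitz_admissible[OF u h[of k], where N = ?N]
      have wq: "?\<omega> \<circ> \<phi> \<in> L1q M mul n e q \<Omega>"
        and wA: "(\<integral>\<^sup>+ x \<in> ?P. ?E (?\<omega> \<circ> \<phi>) x \<partial>M) \<le> ennreal A"
        using hyp[OF \<omega>(1,2)] by blast+
      have level: "AE x in lebesgue. x \<in> \<Omega> \<longrightarrow>
          (?\<omega> \<circ> \<phi>) x = \<sigma> * (u \<circ> \<phi>) x + 2 * h k * of_int j \<longrightarrow>
          hgrad M mul e \<Omega> (?\<omega> \<circ> \<phi>) x i = \<sigma> * hgrad M mul e \<Omega> (u \<circ> \<phi>) x i"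
        if i: "i \<in> {1..n}" for i \<sigma> and j :: int
        by (rule weak_deriv_eq_AE_on_level_set[OF \<open>open \<Omega>\<close> loc[OF wq] loc[OF uq] wd[OF wq i] wd[OF uq i]])
      have "AE x in lebesgue. \<forall>i\<in>{1..n}. \<forall>\<sigma>\<in>{1, -1}. \<forall>j :: int. x \<in> \<Omega> \<longrightarrow>
          (?\<omega> \<circ> \<phi>) x = \<sigma> * (u \<circ> \<phi>) x + 2 * h k * of_int j \<longrightarrow>
          hgrad M mul e \<Omega> (?\<omega> \<circ> \<phi>) x i = \<sigma> * hgrad M mul e \<Omega> (u \<circ> \<phi>) x i"
        by (intro AE_ball_countable[THEN iffD2] AE_all_countable[THEN iffD2] ballI allI level) auto
      then have "AE x in lebesgue. x \<in> P k \<longrightarrow> hgrad_norm M mul n e \<Omega> (u \<circ> \<phi>) x = hgrad_norm M mul n e \<Omega> (?\<omega> \<circ> \<phi>) x"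
      proof eventually_elim
        case (elim x)
        show ?case
        proof
          assume x: "x \<in> P k"
          then have "infdist (\<phi> x) ?N > 2 * h k" by (simp add: P_def)
          from \<omega>(3)[OF this] obtain \<sigma> and j :: int
            where s: "\<sigma> \<in> {1, -1}" "(?\<omega> \<circ> \<phi>) x = \<sigma> * (u \<circ> \<phi>) x + 2 * h k * of_int j"
            unfolding o_apply by blast
          show "hgrad_norm M mul n e \<Omega> (u \<circ> \<phi>) x = hgrad_norm M mul n e \<Omega> (?\<omega> \<circ> \<phi>) x"
            unfolding hgrad_norm_def
          proof (rule L2_set_sign[OF s(1), symmetric])
            fix i assume i: "i \<in> {1..n}"
            have "x \<in> \<Omega>" using x by (simp add: P_def)
            with elim i s show "hgrad M mul e \<Omega> (?\<omega> \<circ> \<phi>) x i = \<sigma> * hgrad M mul e \<Omega> (u \<circ> \<phi>) x i"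
              by blast
          qed
        qed
      qed
      then have "AE x in M. x \<in> P k \<longrightarrow> hgrad_norm M mul n e \<Omega> (u \<circ> \<phi>) x = hgrad_norm M mul n e \<Omega> (?\<omega> \<circ> \<phi>) x"
        unfolding M AE_scale_measure[OF c] .
      then have "(\<integral>\<^sup>+ x. ?E (u \<circ> \<phi>) x * indicator (P k) x \<partial>M) = (\<integral>\<^sup>+ x. ?E (?\<omega> \<circ> \<phi>) x * indicator (P k) x \<partial>M)"
        by (intro nn_integral_cong_AE) (auto elim!: eventually_mono simp: indicator_def)
      also have "\<dots> \<le> (\<integral>\<^sup>+ x \<in> ?P. ?E (?\<omega> \<circ> \<phi>) x \<partial>M)"
        using P_subset[of k] by (intro nn_integral_mono mult_left_mono) (auto simp: indicator_def)
      finally show ?thesis using wA by (rule order_trans)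
    qed
    have meas: "(\<lambda>x. ?E (u \<circ> \<phi>) x * indicator (P k) x) \<in> borel_measurable M" for k
    proof -
      have hm: "(\<lambda>x. indicator \<Omega> x * hgrad M mul e \<Omega> (u \<circ> \<phi>) x i) \<in> borel_measurable lebesgue" if "i \<in> {1..n}" for i
        using wd[OF uq that] by (intro L1_loc_measurable[OF \<open>open \<Omega>\<close>]) (simp add: is_weak_deriv_def)
      have [measurable]: "(\<lambda>x. \<Sum>i=1..n. (indicator \<Omega> x * hgrad M mul e \<Omega> (u \<circ> \<phi>) x i)\<^sup>2) \<in> borel_measurable lebesgue"
        by (intro borel_measurable_sum borel_measurable_power hm)
      have [measurable]: "(\<lambda>x. L2_set (\<lambda>i. indicator \<Omega> x * hgrad M mul e \<Omega> (u \<circ> \<phi>) x i) {1..n}) \<in> borel_measurable lebesgue"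
        unfolding L2_set_def by measurable
      have "(\<lambda>x. ennreal (L2_set (\<lambda>i. indicator \<Omega> x * hgrad M mul e \<Omega> (u \<circ> \<phi>) x i) {1..n} powr q) * indicator (P k) x) \<in> borel_measurable lebesgue"
        using P_sets by measurable
      also have "(\<lambda>x. ennreal (L2_set (\<lambda>i. indicator \<Omega> x * hgrad M mul e \<Omega> (u \<circ> \<phi>) x i) {1..n} powr q) * indicator (P k) x)
          = (\<lambda>x. ?E (u \<circ> \<phi>) x * indicator (P k) x)"
        by (auto simp: fun_eq_iff hgrad_norm_def P_def indicator_def)
      finally show ?thesis unfolding M by (simp cong: measurable_cong_sets)
    qed
    have indicator_P: "(SUP k. indicator (P k) x :: ennreal) = indicator ?P x" for x
    proof (cases "x \<in> ?P")
      case True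
      then obtain k where "x \<in> P k" using P_Union by blast
      then have "(1 :: ennreal) \<le> (SUP k. indicator (P k) x)" by (intro SUP_upper2[of k]) auto
      moreover have "(SUP k. indicator (P k) x) \<le> (1 :: ennreal)"
        by (rule SUP_least) (simp add: indicator_def)
      ultimately have "(SUP k. indicator (P k) x) = (1 :: ennreal)" by (intro antisym)
      then show ?thesis using True by simp
    next
      case False
      then have "x \<notin> P k" for k using P_subset by blast
      then show ?thesis using False by simp
    qed
    have "(\<integral>\<^sup>+ x \<in> ?P. ?E (u \<circ> \<phi>) x \<partial>M) = (\<integral>\<^sup>+ x. (SUP k. ?E (u \<circ> \<phi>) x * indicator (P k) x) \<partial>M)"
      by (simp add: indicator_P flip: SUP_mult_left_ennreal)
    also have "\<dots> = (SUP k. \<integral>\<^sup>+ x. ?E (u \<circ> \<phi>) x * indicator (P k) x \<partial>M)"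
    proof (rule nn_integral_monotone_convergence_SUP[OF _ meas])
      show "incseq (\<lambda>k x. ?E (u \<circ> \<phi>) x * indicator (P k) x)"
        using \<open>incseq P\<close> by (auto simp: incseq_def le_fun_def indicator_def intro!: mult_left_mono)
    qed
    also have "\<dots> \<le> ennreal A" by (rule SUP_least) (rule bound)
    finally show ?thesis .
  qed
qed

end
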